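(* Let $A$ be a commutative algebra with identity $1_A$ and let $(\Omega,\leftarrow,\rightarrow,\lhd,\rhd,\cdot,\lambda)$ be a commutative $\lambda$-extended triassociative semigroup ($\lambda$-ETS). Let $\mathrm{Sh}^+_\Omega(A)$ be the space of $\Omega$-typed words in $A$ with the product $\diamond$ defined in the context, and for each $\omega\in\Omega$ let $P_\omega:\mathrm{Sh}^+_\Omega(A)\to\mathrm{Sh}^+_\Omega(A)$ be the linear map $\mathbf{a}\mapsto 1_A\otimes_\omega\mathbf{a}$. Then $(\mathrm{Sh}^+_\Omega(A),\diamond,(P_\omega)_{\omega\in\Omega})$ is the free commutative $\Omega$-Rota-Baxter algebra (of weight $\lambda$) generated by $A$.
   Context: $\mathbf{k}$ is a unitary commutative ring, the base ring of all modules, algebras and linear maps. **EDS.** A diassociative semigroup is $(\Omega,\leftarrow,\rightarrow)$ with, for all $\alpha,\beta,\gamma\in\Omega$: $(\alpha\leftarrow\beta)\leftarrow\gamma=\alpha\leftarrow(\beta\leftarrow\gamma)=\alpha\leftarrow(\beta\rightarrow\gamma)$; $(\alpha\rightarrow\beta)\leftarrow\gamma=\alpha\rightarrow(\beta\leftarrow\gamma)$; $(\alpha\rightarrow\beta)\rightarrow\gamma=(\alpha\leftarrow\beta)\rightarrow\gamma=\alpha\rightarrow(\beta\rightarrow\gamma)$. An extended diassociative semigroup (EDS) is $(\Omega,\leftarrow,\rightarrow,\lhd,\rhd)$ where $(\Omega,\leftarrow,\rightarrow)$ is a diassociative semigroup and, for all $\alpha,\beta,\gamma\in\Omega$: $\alpha\rhd(\beta\leftarrow\gamma)=\alpha\rhd\beta$;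 $(\alpha\rightarrow\beta)\lhd\gamma=\beta\lhd\gamma$; $(\alpha\lhd\beta)\leftarrow((\alpha\leftarrow\beta)\lhd\gamma)=\alpha\lhd(\beta\leftarrow\gamma)$; $(\alpha\lhd\beta)\lhd((\alpha\leftarrow\beta)\lhd\gamma)=\beta\lhd\gamma$; $(\alpha\lhd\beta)\rightarrow((\alpha\leftarrow\beta)\lhd\gamma)=\alpha\lhd(\beta\rightarrow\gamma)$; $(\alpha\lhd\beta)\rhd((\alpha\leftarrow\beta)\lhd\gamma)=\beta\rhd\gamma$; $(\alpha\rhd(\beta\rightarrow\gamma))\leftarrow(\beta\rhd\gamma)=(\alpha\leftarrow\beta)\rhd\gamma$; $(\alpha\rhd(\beta\rightarrow\gamma))\lhd(\beta\rhd\gamma)=\alpha\lhd\beta$; $(\alpha\rhd(\beta\rightarrow\gamma))\rightarrow(\beta\rhd\gamma)=(\alpha\rightarrow\beta)\rhd\gamma$; $(\alpha\rhd(\beta\rightarrow\gamma))\rhd(\beta\rhd\gamma)=\alpha\rhd\beta$. **$\lambda$-ETS.** $(\Omega,\leftarrow,\rightarrow,\lhd,\rhd,\cdot,\lambda)$ is a $\lambda$-extended triassociative semigroup ($\lambda$-ETS) if $(\Omega,\leftarrow,\rightarrow,\lhd,\rhd)$ is an EDS, $\cdot$ is a binary operation on $\Omega$, $\lambda=(\lambda_{\alpha,\beta})_{\alpha,\beta\in\Omega}$ is a family of elements of $\mathbf{k}$, and for all $\alpha,\beta,\gamma\in\Omega$: $\lambda_{\alpha\rightarrow\beta,\gamma}=\lambda_{\beta,\gamma}$;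 $\lambda_{\alpha\lhd\beta,(\alpha\leftarrow\beta)\lhd\gamma}=\lambda_{\beta,\gamma}$; $\lambda_{\alpha\leftarrow\beta,\gamma}=\lambda_{\alpha,\beta\rightarrow\gamma}$; $\lambda_{\alpha\rhd(\beta\rightarrow\gamma),\beta\rhd\gamma}=\lambda_{\alpha,\beta}$; $\lambda_{\alpha,\beta}=\lambda_{\alpha,\beta\leftarrow\gamma}$; $\lambda_{\alpha,\beta}\lambda_{\alpha\cdot\beta,\gamma}=\lambda_{\beta,\gamma}\lambda_{\alpha,\beta\cdot\gamma}$; and moreover: (1) if $\lambda_{\alpha\rightarrow\beta,\gamma}=\lambda_{\beta,\gamma}\neq0$, then $\alpha\rhd\beta=\alpha\rhd(\beta\cdot\gamma)$ and $(\alpha\rightarrow\beta)\cdot\gamma=\alpha\rightarrow(\beta\cdot\gamma)$; (2) if $\lambda_{\alpha\lhd\beta,(\alpha\leftarrow\beta)\lhd\gamma}=\lambda_{\beta,\gamma}\neq0$, then $(\alpha\lhd\beta)\cdot((\alpha\leftarrow\beta)\lhd\gamma)=\alpha\lhd(\beta\cdot\gamma)$ and $(\alpha\leftarrow\beta)\leftarrow\gamma=\alpha\leftarrow(\beta\cdot\gamma)$; (3) if $\lambda_{\alpha\rhd(\beta\rightarrow\gamma),\beta\rhd\gamma}=\lambda_{\alpha,\beta}\neq0$, then $\alpha\rightarrow(\beta\rightarrow\gamma)=(\alpha\cdot\beta)\rightarrow\gamma$ and $(\alpha\rhd(\beta\rightarrow\gamma))\cdot(\beta\rhd\gamma)=(\alpha\cdot\beta)\rhd\gamma$;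 (4) if $\lambda_{\alpha\leftarrow\beta,\gamma}=\lambda_{\alpha,\beta\rightarrow\gamma}\neq0$, then $(\alpha\leftarrow\beta)\cdot\gamma=\alpha\cdot(\beta\rightarrow\gamma)$ and $\alpha\lhd\beta=\beta\rhd\gamma$; (5) if $\lambda_{\alpha,\beta}=\lambda_{\alpha,\beta\leftarrow\gamma}\neq0$, then $(\alpha\cdot\beta)\lhd\gamma=\beta\lhd\gamma$ and $(\alpha\cdot\beta)\leftarrow\gamma=\alpha\cdot(\beta\leftarrow\gamma)$; (6) if $\lambda_{\alpha,\beta}\lambda_{\alpha\cdot\beta,\gamma}=\lambda_{\beta,\gamma}\lambda_{\alpha,\beta\cdot\gamma}\neq0$, then $(\alpha\cdot\beta)\cdot\gamma=\alpha\cdot(\beta\cdot\gamma)$. A $\lambda$-ETS is commutative if it equals its opposite, i.e. for all $\alpha,\beta\in\Omega$: $\alpha\leftarrow\beta=\beta\rightarrow\alpha$, $\alpha\lhd\beta=\beta\rhd\alpha$, $\alpha\cdot\beta=\beta\cdot\alpha$, $\lambda_{\alpha,\beta}=\lambda_{\beta,\alpha}$. **$\Omega$-Rota-Baxter algebra.** An $\Omega$-Rota-Baxter algebra of weight $\lambda$ is a pair $(R,(P_\omega)_{\omega\in\Omega})$ with $R$ an associative (here unitary) algebra and $P_\omega:R\to R$ linear maps such that for all $a,b\in R$, $\alpha,\beta\in\Omega$: $$P_\alpha(a)P_\beta(b)=P_{\alpha\rightarrow\beta}(P_{\alpha\rhd\beta}(a)b)+P_{\alpha\leftarrow\beta}(aP_{\alpha\lhd\beta}(b))+\lambda_{\alpha,\beta}P_{\alpha\cdot\beta}(ab).$$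 It is commutative if $R$ is commutative. Morphisms are unitary algebra morphisms commuting with all $P_\omega$. "Free commutative $\Omega$-Rota-Baxter algebra generated by $A$" means: it is a commutative $\Omega$-Rota-Baxter algebra and, for every commutative $\Omega$-Rota-Baxter algebra $R$ of weight $\lambda$ and every unitary algebra morphism $f:A\to R$, there is a unique morphism $\overline f:\mathrm{Sh}^+_\Omega(A)\to R$ of $\Omega$-Rota-Baxter algebras extending $f$ (where $A$ is embedded as the words of length $1$). **Typed words.** $\mathrm{Sh}^+_\Omega(A)=\bigoplus_{n\ge0}A\otimes(\mathbf{k}\Omega)\otimes A\otimes\cdots\otimes(\mathbf{k}\Omega)\otimes A$ (with $n+1$ factors $A$ alternating with $n$ factors $\mathbf{k}\Omega$, the free module on $\Omega$). A pure tensor $a_0\otimes\omega_1\otimes a_1\otimes\cdots\otimes\omega_n\otimes a_n$ with $\omega_i\in\Omega$ is written $a_0\otimes_{\omega_1}a_1\otimes_{\omega_2}\cdots\otimes_{\omega_n}a_n$; its length is $n+1$. The bilinear product $\diamond$ is defined inductively on pure tensors: $a_0\diamond b_0=a_0b_0$; $(a_0\otimes_{\alpha_1}\mathbf{a}')\diamond b_0=a_0b_0\otimes_{\alpha_1}\mathbf{a}'$; $a_0\diamond(b_0\otimes_{\beta_1}\mathbf{b}')=a_0b_0\otimes_{\beta_1}\mathbf{b}'$; and $$(a_0\otimes_{\alpha_1}\mathbf{a}')\diamond(b_0\otimes_{\beta_1}\mathbf{b}')=a_0b_0\otimes_{\alpha_1\rightarrow\beta_1}\big((1_A\otimes_{\alpha_1\rhd\beta_1}\mathbf{a}')\diamond\mathbf{b}'\big)+a_0b_0\otimes_{\alpha_1\leftarrow\beta_1}\big(\mathbf{a}'\diamond(1_A\otimes_{\alpha_1\lhd\beta_1}\mathbf{b}')\big)+\lambda_{\alpha_1,\beta_1}a_0b_0\otimes_{\alpha_1\cdot\beta_1}(\mathbf{a}'\diamond\mathbf{b}').$$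 *)

theory Defs
  imports "HOL-Algebra.Module" "HOL-Algebra.QuotRing"
begin

section \<open>Extended triassociative semigroups\<close>

text \<open>
  The underlying set \<open>\<Omega>\<close> is the type \<open>'w\<close>. The four operations of an EDS, written
  \<open>\<leftarrow>, \<rightarrow>, \<lhd>, \<rhd>\<close> on paper, are written with harpoons and triangles here, because the plain
  arrows and \<open>\<lhd>\<close> are taken by function sets and normal subgroups.
\<close>

record ('w, 'k) ets =
  larr :: "'w \<Rightarrow> 'w \<Rightarrow> 'w" (infixl "\<leftharpoonup>\<index>" 70)
  rarr :: "'w \<Rightarrow> 'w \<Rightarrow> 'w" (infixl "\<rightharpoonup>\<index>" 70)
  ltri :: "'w \<Rightarrow> 'w \<Rightarrow> 'w" (infixl "\<triangleleft>\<index>" 70)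
  rtri :: "'w \<Rightarrow> 'w \<Rightarrow> 'w" (infixl "\<triangleright>\<index>" 70)
  dot  :: "'w \<Rightarrow> 'w \<Rightarrow> 'w" (infixl "\<cdot>\<index>" 70)
  lam  :: "'w \<Rightarrow> 'w \<Rightarrow> 'k"

locale diassociative_semigroup =
  fixes E :: "('w, 'k) ets" (structure)
  assumes "(\<alpha> \<leftharpoonup> \<beta>) \<leftharpoonup> \<gamma> = \<alpha> \<leftharpoonup> (\<beta> \<leftharpoonup> \<gamma>)"
    and "\<alpha> \<leftharpoonup> (\<beta> \<leftharpoonup> \<gamma>) = \<alpha> \<leftharpoonup> (\<beta> \<rightharpoonup> \<gamma>)"
    and "(\<alpha> \<rightharpoonup> \<beta>) \<leftharpoonup> \<gamma> = \<alpha> \<rightharpoonup> (\<beta> \<leftharpoonup> \<gamma>)"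
    and "(\<alpha> \<rightharpoonup> \<beta>) \<rightharpoonup> \<gamma> = (\<alpha> \<leftharpoonup> \<beta>) \<rightharpoonup> \<gamma>"
    and "(\<alpha> \<leftharpoonup> \<beta>) \<rightharpoonup> \<gamma> = \<alpha> \<rightharpoonup> (\<beta> \<rightharpoonup> \<gamma>)"

locale extended_diassociative_semigroup = diassociative_semigroup +
  assumes "\<alpha> \<triangleright> (\<beta> \<leftharpoonup> \<gamma>) = \<alpha> \<triangleright> \<beta>"
    and "(\<alpha> \<rightharpoonup> \<beta>) \<triangleleft> \<gamma> = \<beta> \<triangleleft> \<gamma>"
    and "(\<alpha> \<triangleleft> \<beta>) \<leftharpoonup> ((\<alpha> \<leftharpoonup> \<beta>) \<triangleleft> \<gamma>) = \<alpha> \<triangleleft> (\<beta> \<leftharpoonup> \<gamma>)"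
    and "(\<alpha> \<triangleleft> \<beta>) \<triangleleft> ((\<alpha> \<leftharpoonup> \<beta>) \<triangleleft> \<gamma>) = \<beta> \<triangleleft> \<gamma>"
    and "(\<alpha> \<triangleleft> \<beta>) \<rightharpoonup> ((\<alpha> \<leftharpoonup> \<beta>) \<triangleleft> \<gamma>) = \<alpha> \<triangleleft> (\<beta> \<rightharpoonup> \<gamma>)"
    and "(\<alpha> \<triangleleft> \<beta>) \<triangleright> ((\<alpha> \<leftharpoonup> \<beta>) \<triangleleft> \<gamma>) = \<beta> \<triangleright> \<gamma>"
    and "(\<alpha> \<triangleright> (\<beta> \<rightharpoonup> \<gamma>)) \<leftharpoonup> (\<beta> \<triangleright> \<gamma>) = (\<alpha> \<leftharpoonup> \<beta>) \<triangleright> \<gamma>"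
    and "(\<alpha> \<triangleright> (\<beta> \<rightharpoonup> \<gamma>)) \<triangleleft> (\<beta> \<triangleright> \<gamma>) = \<alpha> \<triangleleft> \<beta>"
    and "(\<alpha> \<triangleright> (\<beta> \<rightharpoonup> \<gamma>)) \<rightharpoonup> (\<beta> \<triangleright> \<gamma>) = (\<alpha> \<rightharpoonup> \<beta>) \<triangleright> \<gamma>"
    and "(\<alpha> \<triangleright> (\<beta> \<rightharpoonup> \<gamma>)) \<triangleright> (\<beta> \<triangleright> \<gamma>) = \<alpha> \<triangleright> \<beta>"

locale lambda_ets = extended_diassociative_semigroup E
  for E :: "('w, 'k) ets" (structure) and k :: "'k ring" (structure) +
  assumes "lam E \<alpha> \<beta> \<in> carrier k"
    and "lam E (\<alpha> \<rightharpoonup> \<beta>) \<gamma> = lam E \<beta> \<gamma>"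
    and "lam E (\<alpha> \<triangleleft> \<beta>) ((\<alpha> \<leftharpoonup> \<beta>) \<triangleleft> \<gamma>) = lam E \<beta> \<gamma>"
    and "lam E (\<alpha> \<leftharpoonup> \<beta>) \<gamma> = lam E \<alpha> (\<beta> \<rightharpoonup> \<gamma>)"
    and "lam E (\<alpha> \<triangleright> (\<beta> \<rightharpoonup> \<gamma>)) (\<beta> \<triangleright> \<gamma>) = lam E \<alpha> \<beta>"
    and "lam E \<alpha> \<beta> = lam E \<alpha> (\<beta> \<leftharpoonup> \<gamma>)"
    and "lam E \<alpha> \<beta> \<otimes>\<^bsub>k\<^esub> lam E (\<alpha> \<cdot> \<beta>) \<gamma> = lam E \<beta> \<gamma> \<otimes>\<^bsub>k\<^esub> lam E \<alpha> (\<beta> \<cdot> \<gamma>)"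
    and "lam E \<beta> \<gamma> \<noteq> \<zero>\<^bsub>k\<^esub> \<Longrightarrow>
      \<alpha> \<triangleright> \<beta> = \<alpha> \<triangleright> (\<beta> \<cdot> \<gamma>) \<and> (\<alpha> \<rightharpoonup> \<beta>) \<cdot> \<gamma> = \<alpha> \<rightharpoonup> (\<beta> \<cdot> \<gamma>)"
    and "lam E \<beta> \<gamma> \<noteq> \<zero>\<^bsub>k\<^esub> \<Longrightarrow>
      (\<alpha> \<triangleleft> \<beta>) \<cdot> ((\<alpha> \<leftharpoonup> \<beta>) \<triangleleft> \<gamma>) = \<alpha> \<triangleleft> (\<beta> \<cdot> \<gamma>) \<and>
      (\<alpha> \<leftharpoonup> \<beta>) \<leftharpoonup> \<gamma> = \<alpha> \<leftharpoonup> (\<beta> \<cdot> \<gamma>)"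
    and "lam E \<alpha> \<beta> \<noteq> \<zero>\<^bsub>k\<^esub> \<Longrightarrow>
      \<alpha> \<rightharpoonup> (\<beta> \<rightharpoonup> \<gamma>) = (\<alpha> \<cdot> \<beta>) \<rightharpoonup> \<gamma> \<and>
      (\<alpha> \<triangleright> (\<beta> \<rightharpoonup> \<gamma>)) \<cdot> (\<beta> \<triangleright> \<gamma>) = (\<alpha> \<cdot> \<beta>) \<triangleright> \<gamma>"
    and "lam E (\<alpha> \<leftharpoonup> \<beta>) \<gamma> \<noteq> \<zero>\<^bsub>k\<^esub> \<Longrightarrow>
      (\<alpha> \<leftharpoonup> \<beta>) \<cdot> \<gamma> = \<alpha> \<cdot> (\<beta> \<rightharpoonup> \<gamma>) \<and> \<alpha> \<triangleleft> \<beta> = \<beta> \<triangleright> \<gamma>"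
    and "lam E \<alpha> \<beta> \<noteq> \<zero>\<^bsub>k\<^esub> \<Longrightarrow>
      (\<alpha> \<cdot> \<beta>) \<triangleleft> \<gamma> = \<beta> \<triangleleft> \<gamma> \<and> (\<alpha> \<cdot> \<beta>) \<leftharpoonup> \<gamma> = \<alpha> \<cdot> (\<beta> \<leftharpoonup> \<gamma>)"
    and "lam E \<alpha> \<beta> \<otimes>\<^bsub>k\<^esub> lam E (\<alpha> \<cdot> \<beta>) \<gamma> \<noteq> \<zero>\<^bsub>k\<^esub> \<Longrightarrow>
      (\<alpha> \<cdot> \<beta>) \<cdot> \<gamma> = \<alpha> \<cdot> (\<beta> \<cdot> \<gamma>)"

locale commutative_lambda_ets = lambda_ets E k
  for E :: "('w, 'k) ets" (structure) and k :: "'k ring" (structure) +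
  assumes "\<alpha> \<leftharpoonup> \<beta> = \<beta> \<rightharpoonup> \<alpha>"
    and "\<alpha> \<triangleleft> \<beta> = \<beta> \<triangleright> \<alpha>"
    and "\<alpha> \<cdot> \<beta> = \<beta> \<cdot> \<alpha>"
    and "lam E \<alpha> \<beta> = lam E \<beta> \<alpha>"


section \<open>Commutative Rota-Baxter algebras indexed by an ETS\<close>

definition linear_maps ::
    "'k ring \<Rightarrow> ('k, 'a) module \<Rightarrow> ('k, 'b) module \<Rightarrow> ('a \<Rightarrow> 'b) set" where
  "linear_maps k M N = {h \<in> carrier M \<rightarrow> carrier N.
     (\<forall>x\<in>carrier M. \<forall>y\<in>carrier M. h (x \<oplus>\<^bsub>M\<^esub> y) = h x \<oplus>\<^bsub>N\<^esub> h y) \<and>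
     (\<forall>c\<in>carrier k. \<forall>x\<in>carrier M. h (c \<odot>\<^bsub>M\<^esub> x) = c \<odot>\<^bsub>N\<^esub> h x)}"

definition algebra_homs ::
    "'k ring \<Rightarrow> ('k, 'a) module \<Rightarrow> ('k, 'b) module \<Rightarrow> ('a \<Rightarrow> 'b) set" where
  "algebra_homs k M N = ring_hom M N \<inter> linear_maps k M N"

text \<open>The library's \<^locale>\<open>algebra\<close> is by definition commutative and unitary.\<close>

definition comm_rota_baxter_algebra ::
    "'k ring \<Rightarrow> ('w, 'k) ets \<Rightarrow> ('k, 'r) module \<Rightarrow> ('w \<Rightarrow> 'r \<Rightarrow> 'r) \<Rightarrow> bool" where
  "comm_rota_baxter_algebra k E R P \<longleftrightarrow>
     algebra k R \<and>
     (\<forall>\<omega>. P \<omega> \<in> linear_maps k R R) \<and>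
     (\<forall>\<alpha> \<beta>. \<forall>a\<in>carrier R. \<forall>b\<in>carrier R.
        P \<alpha> a \<otimes>\<^bsub>R\<^esub> P \<beta> b =
          P (\<alpha> \<rightharpoonup>\<^bsub>E\<^esub> \<beta>) (P (\<alpha> \<triangleright>\<^bsub>E\<^esub> \<beta>) a \<otimes>\<^bsub>R\<^esub> b)
          \<oplus>\<^bsub>R\<^esub> P (\<alpha> \<leftharpoonup>\<^bsub>E\<^esub> \<beta>) (a \<otimes>\<^bsub>R\<^esub> P (\<alpha> \<triangleleft>\<^bsub>E\<^esub> \<beta>) b)
          \<oplus>\<^bsub>R\<^esub> lam E \<alpha> \<beta> \<odot>\<^bsub>R\<^esub> P (\<alpha> \<cdot>\<^bsub>E\<^esub> \<beta>) (a \<otimes>\<^bsub>R\<^esub> b))"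

definition rota_baxter_homs ::
    "'k ring \<Rightarrow> ('k, 'r) module \<Rightarrow> ('w \<Rightarrow> 'r \<Rightarrow> 'r)
       \<Rightarrow> ('k, 's) module \<Rightarrow> ('w \<Rightarrow> 's \<Rightarrow> 's) \<Rightarrow> ('r \<Rightarrow> 's) set" where
  "rota_baxter_homs k R P S Q =
     {h \<in> algebra_homs k R S. \<forall>\<omega>. \<forall>x\<in>carrier R. h (P \<omega> x) = Q \<omega> (h x)}"


section \<open>Free modules\<close>

text \<open>
  The free module on \<open>S\<close> consists of the finitely supported functions. A module record has
  ring multiplication and unit as fields; they are irrelevant for a mere module.
\<close>

definition free_module :: "'k ring \<Rightarrow> 's set \<Rightarrow> ('k, 's \<Rightarrow> 'k) module" where
  "free_module k S =
     \<lparr>carrier = {f. (\<forall>s\<in>S. f s \<in> carrier k) \<and> (\<forall>s. s \<notin> S \<longrightarrow> f s = \<zero>\<^bsub>k\<^esub>) \<and>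
                    finite {s. f s \<noteq> \<zero>\<^bsub>k\<^esub>}},
      monoid.mult = undefined, one = undefined,
      zero = (\<lambda>s. \<zero>\<^bsub>k\<^esub>), add = (\<lambda>f g s. f s \<oplus>\<^bsub>k\<^esub> g s),
      smult = (\<lambda>c f s. c \<otimes>\<^bsub>k\<^esub> f s)\<rparr>"

definition basis_vec :: "'k ring \<Rightarrow> 's \<Rightarrow> 's \<Rightarrow> 'k" where
  "basis_vec k s = (\<lambda>t. if t = s then \<one>\<^bsub>k\<^esub> else \<zero>\<^bsub>k\<^esub>)"

definition linear_ext :: "'k ring \<Rightarrow> ('s \<Rightarrow> 'v \<Rightarrow> 'k) \<Rightarrow> ('s \<Rightarrow> 'k) \<Rightarrow> 'v \<Rightarrow> 'k" where
  "linear_ext k g f = (\<lambda>v. \<Oplus>\<^bsub>k\<^esub>s\<in>{s. f s \<noteq> \<zero>\<^bsub>k\<^esub>}. f s \<otimes>\<^bsub>k\<^esub> g s v)"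

definition bilinear_ext ::
    "'k ring \<Rightarrow> ('s \<Rightarrow> 't \<Rightarrow> 'v \<Rightarrow> 'k) \<Rightarrow> ('s \<Rightarrow> 'k) \<Rightarrow> ('t \<Rightarrow> 'k) \<Rightarrow> 'v \<Rightarrow> 'k" where
  "bilinear_ext k g f h = linear_ext k (\<lambda>s. linear_ext k (g s) h) f"


section \<open>Typed words\<close>

text \<open>
  A tuple \<open>(a\<^sub>0, [(x\<^sub>1, a\<^sub>1), \<dots>, (x\<^sub>n, a\<^sub>n)])\<close> with \<open>a\<^sub>i \<in> A\<close> and \<open>x\<^sub>i \<in> k\<Omega>\<close> stands for
  \<open>a\<^sub>0 \<otimes> x\<^sub>1 \<otimes> a\<^sub>1 \<otimes> \<dots> \<otimes> x\<^sub>n \<otimes> a\<^sub>n\<close>; it is an \<open>\<Omega>\<close>-typed word if all \<open>x\<^sub>i\<close> are basis vectors.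
  The direct sum over \<open>n\<close> of the tensor products \<open>A \<otimes> k\<Omega> \<otimes> A \<otimes> \<dots> \<otimes> k\<Omega> \<otimes> A\<close> is the free
  module on the tuples of all lengths, modulo linearity in each slot: the relations never
  mix lengths.
\<close>

type_synonym ('a, 'w, 'k) tuple = "'a \<times> (('w \<Rightarrow> 'k) \<times> 'a) list"

definition tuples :: "'k ring \<Rightarrow> ('k, 'a) module \<Rightarrow> ('a, 'w, 'k) tuple set" where
  "tuples k A = carrier A \<times> lists (carrier (free_module k UNIV) \<times> carrier A)"

abbreviation tuple_module ::
    "'k ring \<Rightarrow> ('k, 'a) module \<Rightarrow> ('k, ('a, 'w, 'k) tuple \<Rightarrow> 'k) module" where
  "tuple_module k A \<equiv> free_module k (tuples k A)"

inductive_set multilinearity ::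
    "'k ring \<Rightarrow> ('k, 'a) module \<Rightarrow> (('a, 'w, 'k) tuple \<Rightarrow> 'k) set"
  for k :: "'k ring" and A :: "('k, 'a) module" where
  head_add: "(a, u) \<in> tuples k A \<Longrightarrow> (b, u) \<in> tuples k A \<Longrightarrow>
    basis_vec k (a \<oplus>\<^bsub>A\<^esub> b, u)
      \<ominus>\<^bsub>tuple_module k A\<^esub> (basis_vec k (a, u) \<oplus>\<^bsub>tuple_module k A\<^esub> basis_vec k (b, u))
    \<in> multilinearity k A"
| head_smult: "c \<in> carrier k \<Longrightarrow> (a, u) \<in> tuples k A \<Longrightarrow>
    basis_vec k (c \<odot>\<^bsub>A\<^esub> a, u)
      \<ominus>\<^bsub>tuple_module k A\<^esub> (c \<odot>\<^bsub>tuple_module k A\<^esub> basis_vec k (a, u))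
    \<in> multilinearity k A"
| type_add: "(a, u @ (x, b) # v) \<in> tuples k A \<Longrightarrow> (a, u @ (y, b) # v) \<in> tuples k A \<Longrightarrow>
    basis_vec k (a, u @ (x \<oplus>\<^bsub>free_module k UNIV\<^esub> y, b) # v)
      \<ominus>\<^bsub>tuple_module k A\<^esub>
        (basis_vec k (a, u @ (x, b) # v) \<oplus>\<^bsub>tuple_module k A\<^esub> basis_vec k (a, u @ (y, b) # v))
    \<in> multilinearity k A"
| type_smult: "c \<in> carrier k \<Longrightarrow> (a, u @ (x, b) # v) \<in> tuples k A \<Longrightarrow>
    basis_vec k (a, u @ (c \<odot>\<^bsub>free_module k UNIV\<^esub> x, b) # v)
      \<ominus>\<^bsub>tuple_module k A\<^esub> (c \<odot>\<^bsub>tuple_module k A\<^esub> basis_vec k (a, u @ (x, b) # v))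
    \<in> multilinearity k A"
| letter_add: "(a, u @ (x, b) # v) \<in> tuples k A \<Longrightarrow> (a, u @ (x, b') # v) \<in> tuples k A \<Longrightarrow>
    basis_vec k (a, u @ (x, b \<oplus>\<^bsub>A\<^esub> b') # v)
      \<ominus>\<^bsub>tuple_module k A\<^esub>
        (basis_vec k (a, u @ (x, b) # v) \<oplus>\<^bsub>tuple_module k A\<^esub> basis_vec k (a, u @ (x, b') # v))
    \<in> multilinearity k A"
| letter_smult: "c \<in> carrier k \<Longrightarrow> (a, u @ (x, b) # v) \<in> tuples k A \<Longrightarrow>
    basis_vec k (a, u @ (x, c \<odot>\<^bsub>A\<^esub> b) # v)
      \<ominus>\<^bsub>tuple_module k A\<^esub> (c \<odot>\<^bsub>tuple_module k A\<^esub> basis_vec k (a, u @ (x, b) # v))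
    \<in> multilinearity k A"

definition tensor_relations ::
    "'k ring \<Rightarrow> ('k, 'a) module \<Rightarrow> (('a, 'w, 'k) tuple \<Rightarrow> 'k) set" where
  "tensor_relations k A =
     \<Inter>{H. submodule H k (tuple_module k A) \<and> multilinearity k A \<subseteq> H}"

text \<open>\<open>prefix k a x\<close> is the linear map \<open>f \<mapsto> a \<otimes> x \<otimes> f\<close>.\<close>

definition prefix ::
    "'k ring \<Rightarrow> 'a \<Rightarrow> ('w \<Rightarrow> 'k) \<Rightarrow> (('a, 'w, 'k) tuple \<Rightarrow> 'k) \<Rightarrow> ('a, 'w, 'k) tuple \<Rightarrow> 'k" where
  "prefix k a x = linear_ext k (\<lambda>(b, u). basis_vec k (a, (x, b) # u))"

text \<open>
  The product of two tuples: the recursion for typed words, extended bilinearly in the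
  leading factors \<open>x, y \<in> k\<Omega>\<close>. The binders \<open>\<alpha>\<close> and \<open>\<beta>\<close> range over the supports of \<open>x\<close> and \<open>y\<close>,
  so for basis vectors \<open>x\<close> and \<open>y\<close> only the types of the two words remain.
\<close>

fun tuple_mult ::
    "'k ring \<Rightarrow> ('k, 'a) module \<Rightarrow> ('w, 'k) ets
       \<Rightarrow> ('a, 'w, 'k) tuple \<Rightarrow> ('a, 'w, 'k) tuple \<Rightarrow> ('a, 'w, 'k) tuple \<Rightarrow> 'k" where
  "tuple_mult k A E (a, []) (b, v) = basis_vec k (a \<otimes>\<^bsub>A\<^esub> b, v)"
| "tuple_mult k A E (a, p # u) (b, []) = basis_vec k (a \<otimes>\<^bsub>A\<^esub> b, p # u)"
| "tuple_mult k A E (a, (x, a') # u) (b, (y, b') # v) =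
     bilinear_ext k (\<lambda>\<alpha> \<beta>.
       prefix k (a \<otimes>\<^bsub>A\<^esub> b) (basis_vec k (\<alpha> \<rightharpoonup>\<^bsub>E\<^esub> \<beta>))
         (tuple_mult k A E (\<one>\<^bsub>A\<^esub>, (basis_vec k (\<alpha> \<triangleright>\<^bsub>E\<^esub> \<beta>), a') # u) (b', v))
       \<oplus>\<^bsub>tuple_module k A\<^esub>
       prefix k (a \<otimes>\<^bsub>A\<^esub> b) (basis_vec k (\<alpha> \<leftharpoonup>\<^bsub>E\<^esub> \<beta>))
         (tuple_mult k A E (a', u) (\<one>\<^bsub>A\<^esub>, (basis_vec k (\<alpha> \<triangleleft>\<^bsub>E\<^esub> \<beta>), b') # v))
       \<oplus>\<^bsub>tuple_module k A\<^esub>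
       lam E \<alpha> \<beta> \<odot>\<^bsub>tuple_module k A\<^esub>
         prefix k (a \<otimes>\<^bsub>A\<^esub> b) (basis_vec k (\<alpha> \<cdot>\<^bsub>E\<^esub> \<beta>))
           (tuple_mult k A E (a', u) (b', v))) x y"

text \<open>
  \<open>tuple_algebra\<close> need not be associative; its product becomes that of an algebra only
  modulo \<open>tensor_relations\<close>.
\<close>

definition tuple_algebra ::
    "'k ring \<Rightarrow> ('k, 'a) module \<Rightarrow> ('w, 'k) ets \<Rightarrow> ('k, ('a, 'w, 'k) tuple \<Rightarrow> 'k) module" where
  "tuple_algebra k A E = (tuple_module k A)
     \<lparr>monoid.mult := bilinear_ext k (tuple_mult k A E), one := basis_vec k (\<one>\<^bsub>A\<^esub>, [])\<rparr>"

definition typed_word_class ::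
    "'k ring \<Rightarrow> ('k, 'a) module \<Rightarrow> (('a, 'w, 'k) tuple \<Rightarrow> 'k) \<Rightarrow> (('a, 'w, 'k) tuple \<Rightarrow> 'k) set"
  where "typed_word_class k A f = tensor_relations k A +>\<^bsub>tuple_module k A\<^esub> f"

text \<open>\<open>Sh\<^sup>+\<^sub>\<Omega>(A)\<close> with the product \<open>\<diamond>\<close>: operations on classes act on representatives.\<close>

definition typed_words ::
    "'k ring \<Rightarrow> ('k, 'a) module \<Rightarrow> ('w, 'k) ets
       \<Rightarrow> ('k, (('a, 'w, 'k) tuple \<Rightarrow> 'k) set) module" where
  "typed_words k A E = ring.extend (tuple_algebra k A E Quot tensor_relations k A)
     (module.fields (\<lambda>c X. \<Union>f\<in>X. typed_word_class k A (c \<odot>\<^bsub>tuple_module k A\<^esub> f)))"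

definition typed_word_op ::
    "'k ring \<Rightarrow> ('k, 'a) module
       \<Rightarrow> 'w \<Rightarrow> (('a, 'w, 'k) tuple \<Rightarrow> 'k) set \<Rightarrow> (('a, 'w, 'k) tuple \<Rightarrow> 'k) set" where
  "typed_word_op k A \<omega> X =
     (\<Union>f\<in>X. typed_word_class k A (prefix k \<one>\<^bsub>A\<^esub> (basis_vec k \<omega>) f))"

definition length_one_word ::
    "'k ring \<Rightarrow> ('k, 'a) module \<Rightarrow> 'a \<Rightarrow> (('a, 'w, 'k) tuple \<Rightarrow> 'k) set" where
  "length_one_word k A a = typed_word_class k A (basis_vec k (a, []))"

end

theory Submission
  imports Defs
begin

text \<open>
  A typed word \<open>a\<^sub>0 \<otimes>\<^bsub>\<omega>\<^esub> X\<close> equals \<open>a\<^sub>0 \<diamond> P\<^sub>\<omega>(X)\<close>, so a morphism of Rota-Baxter algebras is determined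
  by its values on \<open>A\<close>, and the only possible extension of \<open>f\<close> sends this word to
  \<open>f(a\<^sub>0) P\<^sub>\<omega>(f(X))\<close>. The recursion for \<open>\<diamond>\<close> is the Rota-Baxter identity, hence that extension is
  multiplicative by induction on the total length. For associativity, both bracketings of three
  words of length at least two expand into nine terms. The terms headed by
  \<open>\<alpha> \<rightarrow> (\<beta> \<rightarrow> \<gamma>)\<close> and \<open>(\<alpha> \<leftarrow> \<beta>) \<leftarrow> \<gamma>\<close> split further into three by the induction hypothesis and
  the identity for \<open>P(x) \<diamond> P(y)\<close>; after that the axioms of a \<open>\<lambda>\<close>-ETS match the two expansions
  term by term. The product is compatible with multilinearity by induction on the total length, and its
  symmetry makes one argument suffice.
\<close>

section \<open>Linear maps on free modules\<close>

text \<open>\<open>A\<close> is not assumed free over \<open>k\<close>, so typed words form no basis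
  and the product cannot be prescribed on one. It is computed on formal tuples, where nothing is
  multilinear yet: the basis vector of a tuple with a sum in some slot is not the sum of two basis
  vectors. Identities are therefore stated for classes, and \<open>tuple_prod\<close> passes to the
  quotient at once. Descent of the product asks for linearity in every slot, including types that
  are arbitrary vectors of k\<Omega>. Once the product is bilinear on classes, words with basis
  types suffice for testing, because they span the quotient, and the sums over supports disappear.
  The conditional axioms equate two words only where a coefficient is nonzero, so matching terms are
  compared together with their scalars. As \<open>k\<close> may have zero divisors, a term with two
  scalars has to be treated through the product of both.\<close>

lemma linear_mapsI:
  assumes "\<And>x. x \<in> carrier M \<Longrightarrow> h x \<in> carrier N"
    and "\<And>x y. x \<in> carrier M \<Longrightarrow> y \<in> carrier M \<Longrightarrow> h (x \<oplus>\<^bsub>M\<^esub> y) = h x \<oplus>\<^bsub>N\<^esub> h y"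
    and "\<And>c x. c \<in> carrier k \<Longrightarrow> x \<in> carrier M \<Longrightarrow> h (c \<odot>\<^bsub>M\<^esub> x) = c \<odot>\<^bsub>N\<^esub> h x"
  shows "h \<in> linear_maps k M N"
  using assms by (simp add: linear_maps_def)

lemma linear_mapsD:
  assumes "h \<in> linear_maps k M N"
  shows "x \<in> carrier M \<Longrightarrow> h x \<in> carrier N"
    and "x \<in> carrier M \<Longrightarrow> y \<in> carrier M \<Longrightarrow> h (x \<oplus>\<^bsub>M\<^esub> y) = h x \<oplus>\<^bsub>N\<^esub> h y"
    and "c \<in> carrier k \<Longrightarrow> x \<in> carrier M \<Longrightarrow> h (c \<odot>\<^bsub>M\<^esub> x) = c \<odot>\<^bsub>N\<^esub> h x"
  using assms by (auto simp: linear_maps_def)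

lemma linear_maps_zero:
  assumes "module k M" "module k N" "h \<in> linear_maps k M N"
  shows "h \<zero>\<^bsub>M\<^esub> = \<zero>\<^bsub>N\<^esub>"
proof -
  interpret M: module k M by fact
  interpret N: module k N by fact
  have "h (\<zero>\<^bsub>k\<^esub> \<odot>\<^bsub>M\<^esub> \<zero>\<^bsub>M\<^esub>) = \<zero>\<^bsub>k\<^esub> \<odot>\<^bsub>N\<^esub> h \<zero>\<^bsub>M\<^esub>"
    by (rule linear_mapsD(3)[OF assms(3)]) simp_all
  then show ?thesis
    using linear_mapsD(1)[OF assms(3) M.M.zero_closed] by simp
qed

lemma linear_maps_comp:
  assumes "g \<in> linear_maps k L M" "h \<in> linear_maps k M N"
  shows "(\<lambda>x. h (g x)) \<in> linear_maps k L N"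
  by (rule linear_mapsI) (simp_all add: linear_mapsD[OF assms(1)] linear_mapsD[OF assms(2)])

lemma linear_maps_add:
  assumes "module k N" "g \<in> linear_maps k M N" "h \<in> linear_maps k M N"
  shows "(\<lambda>x. g x \<oplus>\<^bsub>N\<^esub> h x) \<in> linear_maps k M N"
proof -
  interpret N: module k N by fact
  show ?thesis
    by (rule linear_mapsI)
      (simp_all add: linear_mapsD[OF assms(2)] linear_mapsD[OF assms(3)] N.M.a_ac N.smult_r_distr)
qed

lemma linear_maps_smult:
  assumes "module k N" "c \<in> carrier k" "h \<in> linear_maps k M N"
  shows "(\<lambda>x. c \<odot>\<^bsub>N\<^esub> h x) \<in> linear_maps k M N"
proof -
  interpret N: module k N by fact
  show ?thesis
    by (rule linear_mapsI)
      (simp_all add: linear_mapsD[OF assms(3)] N.smult_r_distr assms(2) N.m_comm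
        flip: N.smult_assoc1)
qed

section \<open>Free modules and their basis vectors\<close>

lemma carrier_free_module:
  "f \<in> carrier (free_module k S) \<longleftrightarrow>
     (\<forall>s\<in>S. f s \<in> carrier k) \<and> (\<forall>s. s \<notin> S \<longrightarrow> f s = \<zero>\<^bsub>k\<^esub>) \<and> finite {s. f s \<noteq> \<zero>\<^bsub>k\<^esub>}"
  by (simp add: free_module_def)

lemma free_module_simps:
  "\<zero>\<^bsub>free_module k S\<^esub> = (\<lambda>s. \<zero>\<^bsub>k\<^esub>)"
  "f \<oplus>\<^bsub>free_module k S\<^esub> g = (\<lambda>s. f s \<oplus>\<^bsub>k\<^esub> g s)"
  "c \<odot>\<^bsub>free_module k S\<^esub> f = (\<lambda>s. c \<otimes>\<^bsub>k\<^esub> f s)"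
  by (simp_all add: free_module_def)

lemma free_module_in_carrier:
  assumes "cring k" "f \<in> carrier (free_module k S)"
  shows "f s \<in> carrier k"
proof -
  interpret cring k by fact
  show ?thesis using assms(2) by (cases "s \<in> S") (auto simp: carrier_free_module)
qed

lemma module_free_module:
  fixes k :: "'k ring"
  assumes "cring k"
  shows "module k (free_module k S)"
proof -
  interpret cring k by fact
  let ?F = "free_module k S"
  note [simp] = free_module_simps and [intro] = free_module_in_carrier[OF assms]
  have add: "f \<oplus>\<^bsub>?F\<^esub> g \<in> carrier ?F" if "f \<in> carrier ?F" "g \<in> carrier ?F" for f g
  proof -
    have "{s. f s \<oplus>\<^bsub>k\<^esub> g s \<noteq> \<zero>\<^bsub>k\<^esub>} \<subseteq> {s. f s \<noteq> \<zero>\<^bsub>k\<^esub>} \<union> {s. g s \<noteq> \<zero>\<^bsub>k\<^esub>}"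
      by auto
    with that show ?thesis
      by (auto simp: carrier_free_module intro: finite_subset)
  qed
  have smult: "c \<odot>\<^bsub>?F\<^esub> f \<in> carrier ?F" if "c \<in> carrier k" "f \<in> carrier ?F" for c f
  proof -
    have "{s. c \<otimes>\<^bsub>k\<^esub> f s \<noteq> \<zero>\<^bsub>k\<^esub>} \<subseteq> {s. f s \<noteq> \<zero>\<^bsub>k\<^esub>}"
      using that(1) by auto
    with that show ?thesis
      by (auto simp: carrier_free_module intro: finite_subset)
  qed
  have "abelian_group ?F"
  proof (rule abelian_groupI)
    show "\<zero>\<^bsub>?F\<^esub> \<in> carrier ?F"
      by (simp add: carrier_free_module)
    \<comment> \<open>The inverse is taken as minus one times \<open>x\<close>, so that its
      closedness is an instance of \<open>smult\<close>.\<close>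
    show "\<exists>y\<in>carrier ?F. y \<oplus>\<^bsub>?F\<^esub> x = \<zero>\<^bsub>?F\<^esub>" if "x \<in> carrier ?F" for x
    proof
      show "(\<ominus>\<^bsub>k\<^esub> \<one>\<^bsub>k\<^esub>) \<odot>\<^bsub>?F\<^esub> x \<in> carrier ?F"
        using smult[OF _ that] by simp
      show "(\<ominus>\<^bsub>k\<^esub> \<one>\<^bsub>k\<^esub>) \<odot>\<^bsub>?F\<^esub> x \<oplus>\<^bsub>?F\<^esub> x = \<zero>\<^bsub>?F\<^esub>"
        using free_module_in_carrier[OF assms that] by (simp add: l_minus l_neg)
    qed
  qed (use add in \<open>auto simp: free_module_in_carrier[OF assms] a_ac\<close>)
  then show ?thesis
    by (intro moduleI assms smult)
      (simp_all add: free_module_in_carrier[OF assms] l_distr r_distr m_assoc)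
qed

lemma basis_vec_closed:
  assumes "cring k" "s \<in> S"
  shows "basis_vec k s \<in> carrier (free_module k S)"
proof -
  interpret cring k by fact
  have "{t. basis_vec k s t \<noteq> \<zero>\<^bsub>k\<^esub>} \<subseteq> {s}"
    by (auto simp: basis_vec_def)
  then show ?thesis
    using assms(2) by (auto simp: carrier_free_module basis_vec_def intro: finite_subset)
qed

lemma free_module_induct [consumes 2, case_names zero add]:
  fixes k :: "'k ring"
  assumes "cring k" "f \<in> carrier (free_module k S)"
    and zero: "P \<zero>\<^bsub>free_module k S\<^esub>"
    and add: "\<And>f c s. f \<in> carrier (free_module k S) \<Longrightarrow> c \<in> carrier k \<Longrightarrow> s \<in> S \<Longrightarrow> P f \<Longrightarrow>
      P (f \<oplus>\<^bsub>free_module k S\<^esub> c \<odot>\<^bsub>free_module k S\<^esub> basis_vec k s)"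
  shows "P f"
proof -
  interpret cring k by fact
  have "P f" if "finite U" "{s. f s \<noteq> \<zero>\<^bsub>k\<^esub>} \<subseteq> U" "f \<in> carrier (free_module k S)" for U f
    using that
  proof (induction U arbitrary: f rule: finite_induct)
    case empty
    then have "f = \<zero>\<^bsub>free_module k S\<^esub>"
      by (auto simp: free_module_simps)
    then show ?case using zero by simp
  next
    case (insert t U)
    show ?case
    proof (cases "t \<in> S")
      case False
      then show ?thesis
        using insert by (intro insert.IH) (auto simp: carrier_free_module)
    next
      case True
      let ?g = "f(t := \<zero>\<^bsub>k\<^esub>)"
      have "{s. ?g s \<noteq> \<zero>\<^bsub>k\<^esub>} \<subseteq> {s. f s \<noteq> \<zero>\<^bsub>k\<^esub>}"
        by auto
      then have g: "?g \<in> carrier (free_module k S)"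
        using insert.prems(2) by (auto simp: carrier_free_module intro: finite_subset)
      have "P ?g"
        by (rule insert.IH[OF _ g]) (use insert.prems in auto)
      moreover have "f = ?g \<oplus>\<^bsub>free_module k S\<^esub> f t \<odot>\<^bsub>free_module k S\<^esub> basis_vec k t"
        using free_module_in_carrier[OF assms(1) insert.prems(2)]
        by (auto simp: free_module_simps basis_vec_def)
      ultimately show ?thesis
        using add[OF g _ True] free_module_in_carrier[OF assms(1) insert.prems(2)] by metis
    qed
  qed
  then show ?thesis
    using assms(2) by (auto simp: carrier_free_module)
qed

text \<open>The vectors on which both maps agree include zero and are stable under adding a multiple
  of a basis vector. This spares most later lemmas a computation with finite sums.\<close>

lemma linear_maps_free_module_eqI:
  assumes N: "module k N" and h: "h \<in> linear_maps k (free_module k S) N"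
    and h': "h' \<in> linear_maps k (free_module k S) N"
    and eq: "\<And>s. s \<in> S \<Longrightarrow> h (basis_vec k s) = h' (basis_vec k s)"
    and f: "f \<in> carrier (free_module k S)"
  shows "h f = h' f"
proof -
  interpret N: module k N by fact
  interpret F: module k "free_module k S"
    by (rule module_free_module) (rule N.R.is_cring)
  show ?thesis
    using N.R.is_cring f
  proof (induction rule: free_module_induct)
    case zero
    then show ?case
      by (simp add: linear_maps_zero[OF F.module_axioms N h] linear_maps_zero[OF F.module_axioms N h'])
  next
    case (add f c s)
    then show ?case
      by (simp add: linear_mapsD[OF h] linear_mapsD[OF h'] basis_vec_closed N.R.is_cring eq)
  qed
qed

text \<open>The linear extension of \<open>F\<close> with values in an arbitrary module. The sum in
  \<open>linear_ext\<close> is taken pointwise in \<open>k\<close> and only reaches modules of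
  functions, whereas the targets below are the quotient and Rota-Baxter algebras.\<close>

definition lincomb :: "'k ring \<Rightarrow> ('k, 'b) module \<Rightarrow> ('s \<Rightarrow> 'b) \<Rightarrow> ('s \<Rightarrow> 'k) \<Rightarrow> 'b" where
  "lincomb k N F f = (\<Oplus>\<^bsub>N\<^esub>s\<in>{s. f s \<noteq> \<zero>\<^bsub>k\<^esub>}. f s \<odot>\<^bsub>N\<^esub> F s)"

text \<open>Supports change under addition and scaling; a common finite superset makes two
  combinations comparable.\<close>

lemma lincomb_superset:
  assumes N: "module k N" and F: "F \<in> S \<rightarrow> carrier N" and f: "f \<in> carrier (free_module k S)"
    and U: "finite U" "{s. f s \<noteq> \<zero>\<^bsub>k\<^esub>} \<subseteq> U" "U \<subseteq> S"
  shows "lincomb k N F f = (\<Oplus>\<^bsub>N\<^esub>s\<in>U. f s \<odot>\<^bsub>N\<^esub> F s)"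
proof -
  interpret N: module k N by fact
  note f_in = free_module_in_carrier[OF N.R.is_cring f]
  have F_in: "F s \<in> carrier N" if "s \<in> U" for s
    using F U(3) that by auto
  show ?thesis
    unfolding lincomb_def
    by (rule N.M.add.finprod_mono_neutral_cong_left)
      (use U F_in f_in in auto)
qed

lemma lincomb_linear:
  assumes N: "module k N" and F: "F \<in> S \<rightarrow> carrier N"
  shows "lincomb k N F \<in> linear_maps k (free_module k S) N"
proof -
  interpret N: module k N by fact
  interpret Fr: module k "free_module k S"
    by (rule module_free_module) (rule N.R.is_cring)
  note in_k = free_module_in_carrier[OF N.R.is_cring]
  have supp: "finite {s. f s \<noteq> \<zero>\<^bsub>k\<^esub>} \<and> {s. f s \<noteq> \<zero>\<^bsub>k\<^esub>} \<subseteq> S" if "f \<in> carrier (free_module k S)" for f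
    using that by (auto simp: carrier_free_module)
  show ?thesis
  proof (rule linear_mapsI)
    fix f g assume fg: "f \<in> carrier (free_module k S)" "g \<in> carrier (free_module k S)"
    let ?h = "f \<oplus>\<^bsub>free_module k S\<^esub> g"
    let ?U = "{s. f s \<noteq> \<zero>\<^bsub>k\<^esub>} \<union> {s. g s \<noteq> \<zero>\<^bsub>k\<^esub>}"
    have U: "finite ?U" "?U \<subseteq> S" "{s. ?h s \<noteq> \<zero>\<^bsub>k\<^esub>} \<subseteq> ?U"
      using supp fg by (auto simp: free_module_simps)
    have F_in: "F s \<in> carrier N" if "s \<in> ?U" for s
      using F U(2) that by blast
    have hin: "?h \<in> carrier (free_module k S)"
      using fg by simp
    have "(\<Oplus>\<^bsub>N\<^esub>s\<in>?U. ?h s \<odot>\<^bsub>N\<^esub> F s) = (\<Oplus>\<^bsub>N\<^esub>s\<in>?U. f s \<odot>\<^bsub>N\<^esub> F s \<oplus>\<^bsub>N\<^esub> g s \<odot>\<^bsub>N\<^esub> F s)"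
      using F_in in_k[OF fg(1)] in_k[OF fg(2)]
      by (intro N.M.finsum_cong') (auto simp: free_module_simps N.smult_l_distr)
    also have "\<dots> = (\<Oplus>\<^bsub>N\<^esub>s\<in>?U. f s \<odot>\<^bsub>N\<^esub> F s) \<oplus>\<^bsub>N\<^esub> (\<Oplus>\<^bsub>N\<^esub>s\<in>?U. g s \<odot>\<^bsub>N\<^esub> F s)"
      using F_in in_k[OF fg(1)] in_k[OF fg(2)] by (intro N.M.finsum_addf) auto
    finally show "lincomb k N F ?h = lincomb k N F f \<oplus>\<^bsub>N\<^esub> lincomb k N F g"
      using lincomb_superset[OF N F _ U(1) _ U(2)] fg hin U(3) by simp
  next
    fix c f assume c: "c \<in> carrier k" and f: "f \<in> carrier (free_module k S)"
    let ?h = "c \<odot>\<^bsub>free_module k S\<^esub> f"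
    let ?U = "{s. f s \<noteq> \<zero>\<^bsub>k\<^esub>}"
    have U: "finite ?U" "?U \<subseteq> S" "{s. ?h s \<noteq> \<zero>\<^bsub>k\<^esub>} \<subseteq> ?U"
      using supp f c by (auto simp: free_module_simps)
    have F_in: "F s \<in> carrier N" if "s \<in> ?U" for s
      using F U(2) that by blast
    have hin: "?h \<in> carrier (free_module k S)"
      using c f by simp
    have "(\<Oplus>\<^bsub>N\<^esub>s\<in>?U. ?h s \<odot>\<^bsub>N\<^esub> F s) = (\<Oplus>\<^bsub>N\<^esub>s\<in>?U. c \<odot>\<^bsub>N\<^esub> (f s \<odot>\<^bsub>N\<^esub> F s))"
      using F_in in_k[OF f] c
      by (intro N.M.finsum_cong') (auto simp: free_module_simps N.smult_assoc1)
    also have "\<dots> = c \<odot>\<^bsub>N\<^esub> (\<Oplus>\<^bsub>N\<^esub>s\<in>?U. f s \<odot>\<^bsub>N\<^esub> F s)"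
      using U(1) F_in in_k[OF f] c by (intro N.finsum_smult_ldistr[symmetric]) auto
    finally show "lincomb k N F ?h = c \<odot>\<^bsub>N\<^esub> lincomb k N F f"
      using lincomb_superset[OF N F _ U(1) _ U(2)] f hin U(3) by simp
  next
    fix f assume f: "f \<in> carrier (free_module k S)"
    show "lincomb k N F f \<in> carrier N"
      unfolding lincomb_def using F in_k[OF f] supp[OF f]
      by (intro N.M.finsum_closed) auto
  qed
qed

lemma lincomb_closed:
  "module k N \<Longrightarrow> F \<in> S \<rightarrow> carrier N \<Longrightarrow> f \<in> carrier (free_module k S) \<Longrightarrow> lincomb k N F f \<in> carrier N"
  by (rule linear_mapsD(1)[OF lincomb_linear])

lemma lincomb_basis_vec:
  assumes N: "module k N" and F: "F \<in> S \<rightarrow> carrier N" and s: "s \<in> S"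
  shows "lincomb k N F (basis_vec k s) = F s"
proof -
  interpret N: module k N by fact
  have "lincomb k N F (basis_vec k s) = (\<Oplus>\<^bsub>N\<^esub>t\<in>{s}. basis_vec k s t \<odot>\<^bsub>N\<^esub> F t)"
    by (rule lincomb_superset[OF N F])
      (use s in \<open>auto simp: basis_vec_def intro: basis_vec_closed[OF N.R.is_cring s, unfolded basis_vec_def]\<close>)
  then show ?thesis
    using F s by (auto simp: basis_vec_def Pi_def)
qed

text \<open>Scaling and addition in one equation \<open>c x + y\<close>, the form in which
  \<open>slot_combination\<close> expresses linearity.\<close>

lemma lincomb_combination:
  assumes N: "module k N" and c: "c \<in> carrier k" and f: "f \<in> carrier (free_module k S)"
    and G: "G \<in> S \<rightarrow> carrier N" and H: "H \<in> S \<rightarrow> carrier N"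
    and F: "\<And>s. s \<in> S \<Longrightarrow> F s = c \<odot>\<^bsub>N\<^esub> G s \<oplus>\<^bsub>N\<^esub> H s"
  shows "lincomb k N F f = c \<odot>\<^bsub>N\<^esub> lincomb k N G f \<oplus>\<^bsub>N\<^esub> lincomb k N H f"
proof -
  interpret N: module k N by (rule N)
  have Fc: "F \<in> S \<rightarrow> carrier N"
    using F G H c by (simp add: Pi_iff)
  show ?thesis
    by (rule linear_maps_free_module_eqI[OF N lincomb_linear[OF N Fc]
          linear_maps_add[OF N linear_maps_smult[OF N c lincomb_linear[OF N G]] lincomb_linear[OF N H]] _ f])
      (simp add: lincomb_basis_vec[OF N Fc] lincomb_basis_vec[OF N G] lincomb_basis_vec[OF N H] F)
qed

lemma lincomb_cong:
  assumes "module k N" "f \<in> carrier (free_module k S)" "G \<in> S \<rightarrow> carrier N"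
    and "\<And>s. s \<in> S \<Longrightarrow> F s = G s"
  shows "lincomb k N F f = lincomb k N G f"
proof -
  interpret N: module k N by fact
  show ?thesis
    unfolding lincomb_def
  proof (rule N.M.finsum_cong'[OF refl])
    show "(\<lambda>s. f s \<odot>\<^bsub>N\<^esub> G s) \<in> {s. f s \<noteq> \<zero>\<^bsub>k\<^esub>} \<rightarrow> carrier N"
      using assms(2,3) free_module_in_carrier[OF N.R.is_cring assms(2)]
      by (fastforce simp: carrier_free_module)
    show "f s \<odot>\<^bsub>N\<^esub> F s = f s \<odot>\<^bsub>N\<^esub> G s" if "s \<in> {s. f s \<noteq> \<zero>\<^bsub>k\<^esub>}" for s
      using that assms(2,4) by (force simp: carrier_free_module)
  qed
qed

lemma linear_map_lincomb:
  assumes M: "module k M" and N: "module k N" and h: "h \<in> linear_maps k M N"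
    and F: "F \<in> S \<rightarrow> carrier M" and f: "f \<in> carrier (free_module k S)"
  shows "h (lincomb k M F f) = lincomb k N (\<lambda>s. h (F s)) f"
proof (rule linear_maps_free_module_eqI[OF N _ _ _ f])
  have hF: "(\<lambda>s. h (F s)) \<in> S \<rightarrow> carrier N"
    using linear_mapsD(1)[OF h] F by auto
  show "(\<lambda>f. h (lincomb k M F f)) \<in> linear_maps k (free_module k S) N"
    by (rule linear_maps_comp[OF lincomb_linear[OF M F] h])
  show "lincomb k N (\<lambda>s. h (F s)) \<in> linear_maps k (free_module k S) N"
    by (rule lincomb_linear[OF N hF])
  show "h (lincomb k M F (basis_vec k s)) = lincomb k N (\<lambda>s. h (F s)) (basis_vec k s)"
    if "s \<in> S" for s
    using lincomb_basis_vec[OF M F that] lincomb_basis_vec[OF N hF that] by simp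
qed

text \<open>Dual to \<open>lincomb_linear\<close>: the coefficients are fixed and the values vary.
  Both sides of each law are again linear in \<open>f\<close>, so basis vectors decide.\<close>

lemma lincomb_linear_coeffs:
  assumes M: "module k M" and N: "module k N" and f: "f \<in> carrier (free_module k S)"
    and F: "\<And>s. s \<in> S \<Longrightarrow> F s \<in> linear_maps k M N"
  shows "(\<lambda>x. lincomb k N (\<lambda>s. F s x) f) \<in> linear_maps k M N"
proof -
  interpret M: module k M by fact
  interpret N: module k N by fact
  have cl: "(\<lambda>s. F s x) \<in> S \<rightarrow> carrier N" if "x \<in> carrier M" for x
    using linear_mapsD(1)[OF F that] by auto
  note lin = lincomb_linear[OF N cl]
  show ?thesis
  proof (rule linear_mapsI)
    show "lincomb k N (\<lambda>s. F s x) f \<in> carrier N" if "x \<in> carrier M" for x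
      using linear_mapsD(1)[OF lin[OF that] f] .
    show "lincomb k N (\<lambda>s. F s (x \<oplus>\<^bsub>M\<^esub> y)) f = lincomb k N (\<lambda>s. F s x) f \<oplus>\<^bsub>N\<^esub> lincomb k N (\<lambda>s. F s y) f"
      if x: "x \<in> carrier M" and y: "y \<in> carrier M" for x y
    proof (rule linear_maps_free_module_eqI[OF N _ _ _ f])
      show "lincomb k N (\<lambda>s. F s (x \<oplus>\<^bsub>M\<^esub> y)) \<in> linear_maps k (free_module k S) N"
        using lin x y by simp
      show "(\<lambda>f. lincomb k N (\<lambda>s. F s x) f \<oplus>\<^bsub>N\<^esub> lincomb k N (\<lambda>s. F s y) f) \<in> linear_maps k (free_module k S) N"
        by (rule linear_maps_add[OF N lin[OF x] lin[OF y]])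
    qed (simp add: lincomb_basis_vec[OF N cl] x y linear_mapsD(2)[OF F])
    show "lincomb k N (\<lambda>s. F s (c \<odot>\<^bsub>M\<^esub> x)) f = c \<odot>\<^bsub>N\<^esub> lincomb k N (\<lambda>s. F s x) f"
      if c: "c \<in> carrier k" and x: "x \<in> carrier M" for c x
    proof (rule linear_maps_free_module_eqI[OF N _ _ _ f])
      show "lincomb k N (\<lambda>s. F s (c \<odot>\<^bsub>M\<^esub> x)) \<in> linear_maps k (free_module k S) N"
        using lin c x by simp
      show "(\<lambda>f. c \<odot>\<^bsub>N\<^esub> lincomb k N (\<lambda>s. F s x) f) \<in> linear_maps k (free_module k S) N"
        by (rule linear_maps_smult[OF N c lin[OF x]])
    qed (simp add: lincomb_basis_vec[OF N cl] c x linear_mapsD(3)[OF F])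
  qed
qed

text \<open>Interchange of two finite sums. For fixed \<open>f\<close> both sides are linear in
  \<open>g\<close>, hence only basis vectors in place of \<open>g\<close> need to be
  compared.\<close>

lemma lincomb_swap:
  assumes N: "module k N" and f: "f \<in> carrier (free_module k S)" and g: "g \<in> carrier (free_module k T)"
    and G: "\<And>s t. s \<in> S \<Longrightarrow> t \<in> T \<Longrightarrow> G s t \<in> carrier N"
  shows "lincomb k N (\<lambda>s. lincomb k N (G s) g) f = lincomb k N (\<lambda>t. lincomb k N (\<lambda>s. G s t) f) g"
proof (rule linear_maps_free_module_eqI[OF N _ _ _ g])
  interpret N: module k N by fact
  have r: "G s \<in> T \<rightarrow> carrier N" if "s \<in> S" for s
    using G that by auto
  have l: "(\<lambda>s. G s t) \<in> S \<rightarrow> carrier N" if "t \<in> T" for t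
    using G that by auto
  show "(\<lambda>g. lincomb k N (\<lambda>s. lincomb k N (G s) g) f) \<in> linear_maps k (free_module k T) N"
    by (intro lincomb_linear_coeffs[OF module_free_module N f] lincomb_linear N r N.R.is_cring)
  have l': "(\<lambda>t. lincomb k N (\<lambda>s. G s t) f) \<in> T \<rightarrow> carrier N"
    using linear_mapsD(1)[OF lincomb_linear[OF N l] f] by auto
  then show "lincomb k N (\<lambda>t. lincomb k N (\<lambda>s. G s t) f) \<in> linear_maps k (free_module k T) N"
    by (rule lincomb_linear[OF N])
  show "lincomb k N (\<lambda>s. lincomb k N (G s) (basis_vec k t)) f =
      lincomb k N (\<lambda>t. lincomb k N (\<lambda>s. G s t) f) (basis_vec k t)" if "t \<in> T" for t
    unfolding lincomb_basis_vec[OF N l' that]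
    by (rule lincomb_cong[OF N f l[OF that]]) (rule lincomb_basis_vec[OF N r that])
qed

section \<open>Pointwise sums as linear combinations in a free module\<close>

lemma finsum_free_module:
  assumes "cring k" "finite U" "\<And>s. s \<in> U \<Longrightarrow> g s \<in> carrier (free_module k T)"
  shows "(\<Oplus>\<^bsub>free_module k T\<^esub>s\<in>U. g s) v = (\<Oplus>\<^bsub>k\<^esub>s\<in>U. g s v)"
proof -
  interpret cring k by fact
  interpret F: module k "free_module k T"
    by (rule module_free_module) fact
  show ?thesis
    using assms(2,3)
  proof (induction U rule: finite_induct)
    case empty
    then show ?case by (simp add: free_module_simps)
  next
    case (insert s U)
    then have g: "g t \<in> carrier (free_module k T)" if "t \<in> insert s U" for t
      using that by simp
    note gv = free_module_in_carrier[OF assms(1) g]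
    have "(\<Oplus>\<^bsub>free_module k T\<^esub>s\<in>insert s U. g s) v = g s v \<oplus>\<^bsub>k\<^esub> (\<Oplus>\<^bsub>free_module k T\<^esub>s\<in>U. g s) v"
      using g insert.hyps by (subst F.M.finsum_insert) (auto simp: free_module_simps(2))
    also have "\<dots> = g s v \<oplus>\<^bsub>k\<^esub> (\<Oplus>\<^bsub>k\<^esub>s\<in>U. g s v)"
      using insert by simp
    also have "\<dots> = (\<Oplus>\<^bsub>k\<^esub>s\<in>insert s U. g s v)"
      using gv insert.hyps by (subst finsum_insert) auto
    finally show ?case .
  qed
qed

text \<open>Translates the pointwise sums by which the product is defined into
  \<open>lincomb\<close>, for which linearity is available.\<close>

lemma linear_ext_eq_lincomb:
  assumes k: "cring k" and f: "f \<in> carrier (free_module k S)" and g: "g \<in> S \<rightarrow> carrier (free_module k T)"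
  shows "linear_ext k g f = lincomb k (free_module k T) g f"
proof
  interpret cring k by fact
  interpret F: module k "free_module k T"
    by (rule module_free_module) fact
  fix v
  show "linear_ext k g f v = lincomb k (free_module k T) g f v"
    unfolding linear_ext_def lincomb_def
    using f g free_module_in_carrier[OF k f]
    by (subst finsum_free_module[OF k]) (auto simp: carrier_free_module[of f] free_module_simps intro!: F.smult_closed[unfolded free_module_simps])
qed

lemma bilinear_ext_eq_lincomb:
  assumes k: "cring k" and f: "f \<in> carrier (free_module k S)" and g: "g \<in> carrier (free_module k T)"
    and G: "\<And>s t. s \<in> S \<Longrightarrow> t \<in> T \<Longrightarrow> G s t \<in> carrier (free_module k V)"
  shows "bilinear_ext k G f g = lincomb k (free_module k V) (\<lambda>s. lincomb k (free_module k V) (G s) g) f"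
    and "bilinear_ext k G f g \<in> carrier (free_module k V)"
proof -
  note V = module_free_module[OF k]
  have Gs: "G s \<in> T \<rightarrow> carrier (free_module k V)" if "s \<in> S" for s
    using G that by auto
  have eq: "linear_ext k (G s) g = lincomb k (free_module k V) (G s) g" if "s \<in> S" for s
    by (rule linear_ext_eq_lincomb[OF k g Gs[OF that]])
  have cl: "(\<lambda>s. lincomb k (free_module k V) (G s) g) \<in> S \<rightarrow> carrier (free_module k V)"
    using lincomb_closed[OF V Gs g] by auto
  then have "(\<lambda>s. linear_ext k (G s) g) \<in> S \<rightarrow> carrier (free_module k V)"
    by (auto simp: eq)
  from linear_ext_eq_lincomb[OF k f this]
  show *: "bilinear_ext k G f g = lincomb k (free_module k V) (\<lambda>s. lincomb k (free_module k V) (G s) g) f"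
    unfolding bilinear_ext_def using lincomb_cong[OF V f cl eq] by simp
  show "bilinear_ext k G f g \<in> carrier (free_module k V)"
    unfolding * by (rule lincomb_closed[OF V cl f])
qed

lemma lincomb_basis:
  assumes k: "cring k" and f: "f \<in> carrier (free_module k S)"
  shows "lincomb k (free_module k S) (basis_vec k) f = f"
proof -
  note F = module_free_module[OF k]
  have b: "basis_vec k \<in> S \<rightarrow> carrier (free_module k S)"
    by (auto intro: basis_vec_closed[OF k])
  show ?thesis
    by (rule linear_maps_free_module_eqI[OF F lincomb_linear[OF F b] _ _ f])
      (auto intro: linear_mapsI simp: lincomb_basis_vec[OF F b])
qed

section \<open>Multilinear maps on tuples\<close>

text \<open>The relations in \<^const>\<open>multilinearity\<close> are the cases \<open>c = 1\<close> and \<open>y = 0\<close> of compatibility with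
  \<open>c x + y\<close> in a single slot.\<close>

inductive slot_combination ::
    "'k ring \<Rightarrow> ('k, 'a) module \<Rightarrow> 'k \<Rightarrow> ('a, 'w, 'k) tuple \<Rightarrow> ('a, 'w, 'k) tuple
       \<Rightarrow> ('a, 'w, 'k) tuple \<Rightarrow> bool"
  for k :: "'k ring" and A :: "('k, 'a) module" and c :: 'k where
  head: "(a, u) \<in> tuples k A \<Longrightarrow> b \<in> carrier A \<Longrightarrow>
    slot_combination k A c (c \<odot>\<^bsub>A\<^esub> a \<oplus>\<^bsub>A\<^esub> b, u) (a, u) (b, u)"
| type: "(a, (x, b) # u) \<in> tuples k A \<Longrightarrow> y \<in> carrier (free_module k UNIV) \<Longrightarrow>
    slot_combination k A c
      (a, (c \<odot>\<^bsub>free_module k UNIV\<^esub> x \<oplus>\<^bsub>free_module k UNIV\<^esub> y, b) # u) (a, (x, b) # u) (a, (y, b) # u)"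
| tail: "a \<in> carrier A \<Longrightarrow> x \<in> carrier (free_module k UNIV) \<Longrightarrow>
    slot_combination k A c (b, u) (b\<^sub>1, u\<^sub>1) (b\<^sub>2, u\<^sub>2) \<Longrightarrow>
    slot_combination k A c (a, (x, b) # u) (a, (x, b\<^sub>1) # u\<^sub>1) (a, (x, b\<^sub>2) # u\<^sub>2)"

definition multilinear ::
    "'k ring \<Rightarrow> ('k, 'a) module \<Rightarrow> ('k, 'b) module \<Rightarrow> (('a, 'w, 'k) tuple \<Rightarrow> 'b) \<Rightarrow> bool" where
  "multilinear k A N F \<longleftrightarrow> F \<in> tuples k A \<rightarrow> carrier N \<and>
     (\<forall>c s s\<^sub>1 s\<^sub>2. c \<in> carrier k \<longrightarrow> slot_combination k A c s s\<^sub>1 s\<^sub>2 \<longrightarrow>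
        F s = c \<odot>\<^bsub>N\<^esub> F s\<^sub>1 \<oplus>\<^bsub>N\<^esub> F s\<^sub>2)"

lemma tuples_simps:
  "(a, []) \<in> tuples k A \<longleftrightarrow> a \<in> carrier A"
  "(a, (x, b) # u) \<in> tuples k A \<longleftrightarrow>
     a \<in> carrier A \<and> x \<in> carrier (free_module k UNIV) \<and> (b, u) \<in> tuples k A"
  "(a, v @ (x, b) # u) \<in> tuples k A \<longleftrightarrow>
     (a, v) \<in> tuples k A \<and> x \<in> carrier (free_module k UNIV) \<and> (b, u) \<in> tuples k A"
  by (auto simp: tuples_def)

lemma tuples_head: "(a, u) \<in> tuples k A \<Longrightarrow> a \<in> carrier A"
  by (auto simp: tuples_def)

lemma tuples_change_head: "(a, u) \<in> tuples k A \<Longrightarrow> b \<in> carrier A \<Longrightarrow> (b, u) \<in> tuples k A"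
  by (auto simp: tuples_def)

lemma slot_combination_tuples:
  assumes "module k A" "c \<in> carrier k" "slot_combination k A c s s\<^sub>1 s\<^sub>2"
  shows "s \<in> tuples k A \<and> s\<^sub>1 \<in> tuples k A \<and> s\<^sub>2 \<in> tuples k A"
proof -
  interpret A: module k A by fact
  interpret F: module k "free_module k UNIV" by (rule module_free_module) (rule A.R.is_cring)
  show ?thesis
    using assms(3)
    by induction (use assms(2) in \<open>auto simp: tuples_simps intro: tuples_change_head tuples_head\<close>)
qed

text \<open>\<open>multilinearity\<close> locates a slot by splitting the list,
  \<open>slot_combination\<close> by descending from the head. Passing an arbitrary front part
  \<open>w\<close> connects the two.\<close>

lemma slot_combination_append:
  assumes "(a, w) \<in> tuples k A" "x \<in> carrier (free_module k UNIV)"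
    and "slot_combination k A c (b, u) (b\<^sub>1, u\<^sub>1) (b\<^sub>2, u\<^sub>2)"
  shows "slot_combination k A c (a, w @ (x, b) # u) (a, w @ (x, b\<^sub>1) # u\<^sub>1) (a, w @ (x, b\<^sub>2) # u\<^sub>2)"
  using assms
proof (induction w arbitrary: a)
  case Nil
  then show ?case by (auto simp: tuples_simps intro: slot_combination.tail)
next
  case (Cons p w)
  then show ?case
    by (cases p) (auto simp: tuples_simps intro!: slot_combination.tail)
qed

lemma slot_combination_type:
  assumes "(a, w @ (x, b) # u) \<in> tuples k A" "y \<in> carrier (free_module k UNIV)"
  shows "slot_combination k A c
      (a, w @ (c \<odot>\<^bsub>free_module k UNIV\<^esub> x \<oplus>\<^bsub>free_module k UNIV\<^esub> y, b) # u) (a, w @ (x, b) # u) (a, w @ (y, b) # u)"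
  using assms
proof (induction w arbitrary: a)
  case Nil
  then show ?case by (auto simp: tuples_simps intro: slot_combination.type)
next
  case (Cons p w)
  then show ?case
    by (cases p) (auto simp: tuples_simps intro!: slot_combination.tail)
qed

lemma multilinear_closed: "multilinear k A N F \<Longrightarrow> s \<in> tuples k A \<Longrightarrow> F s \<in> carrier N"
  by (auto simp: multilinear_def)

lemma multilinearD:
  "multilinear k A N F \<Longrightarrow> c \<in> carrier k \<Longrightarrow> slot_combination k A c s s\<^sub>1 s\<^sub>2 \<Longrightarrow>
    F s = c \<odot>\<^bsub>N\<^esub> F s\<^sub>1 \<oplus>\<^bsub>N\<^esub> F s\<^sub>2"
  unfolding multilinear_def by blast

section \<open>Multilinear maps and the tensor relations\<close>

lemma multilinear_add:
  assumes A: "module k A" and N: "module k N" and F: "multilinear k A N F"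
    and s: "slot_combination k A \<one>\<^bsub>k\<^esub> s s\<^sub>1 s\<^sub>2"
  shows "F s = F s\<^sub>1 \<oplus>\<^bsub>N\<^esub> F s\<^sub>2"
proof -
  interpret N: module k N by fact
  show ?thesis
    using multilinearD[OF F _ s] slot_combination_tuples[OF A _ s]
    by (simp add: multilinear_closed[OF F])
qed

text \<open>\<open>z\<close> is meant to be the tuple with zero in the slot in question. The last
  hypothesis expresses this without naming the slot: it gives \<open>F z = F z + F z\<close>, so
  \<open>F z\<close> vanishes by cancellation.\<close>

lemma multilinear_smult:
  assumes A: "module k A" and N: "module k N" and F: "multilinear k A N F"
    and c: "c \<in> carrier k" and s: "slot_combination k A c s s\<^sub>1 z" and z: "slot_combination k A \<one>\<^bsub>k\<^esub> z z z"
  shows "F s = c \<odot>\<^bsub>N\<^esub> F s\<^sub>1"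
proof -
  interpret N: module k N by fact
  have tup: "s\<^sub>1 \<in> tuples k A" "z \<in> tuples k A"
    using slot_combination_tuples[OF A c s] by auto
  then have "F z = \<zero>\<^bsub>N\<^esub>"
    using multilinear_add[OF A N F z] multilinear_closed[OF F tup(2)]
    by (metis N.M.add.r_cancel_one')
  with tup show ?thesis
    using multilinearD[OF F c s] multilinear_closed[OF F tup(1)] c by simp
qed

text \<open>Each generating relation is a difference on whose two sides \<open>F\<close> takes the
  same value. That the relations lie in the carrier is recorded alongside, because it needs the same
  case analysis.\<close>

lemma multilinear_kernel:
  fixes F :: "('a, 'w, 'k) tuple \<Rightarrow> 'b"
  assumes A: "module k A" and N: "module k N" and F: "multilinear k A N F"
    and g: "g \<in> multilinearity k A"
  shows "g \<in> carrier (tuple_module k A) \<and> lincomb k N F g = \<zero>\<^bsub>N\<^esub>"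
proof -
  interpret A: module k A by fact
  interpret N: module k N by fact
  have k: "cring k" by (rule A.R.is_cring)
  interpret M: module k "tuple_module k A" by (rule module_free_module[OF k])
  interpret Fr: module k "free_module k UNIV" by (rule module_free_module[OF k])
  have Fc: "F \<in> tuples k A \<rightarrow> carrier N"
    using F by (simp add: multilinear_def)
  note lin = linear_mapsD[OF lincomb_linear[OF N Fc]]
  have ominus: "lincomb k N F (f \<ominus>\<^bsub>tuple_module k A\<^esub> g) = \<zero>\<^bsub>N\<^esub> \<and> f \<ominus>\<^bsub>tuple_module k A\<^esub> g \<in> carrier (tuple_module k A)"
    if "f \<in> carrier (tuple_module k A)" "g \<in> carrier (tuple_module k A)" "lincomb k N F f = lincomb k N F g" for f g
  proof -
    have "lincomb k N F (f \<ominus>\<^bsub>tuple_module k A\<^esub> g) \<oplus>\<^bsub>N\<^esub> lincomb k N F g = lincomb k N F f"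
      using that by (simp flip: lin(2) add: a_minus_def M.M.a_assoc M.M.l_neg)
    moreover have "f \<ominus>\<^bsub>tuple_module k A\<^esub> g \<in> carrier (tuple_module k A)"
      using that by simp
    ultimately show ?thesis
      using N.M.add.r_cancel_one[OF lin(1)[OF that(2)] lin(1)] that(3) by simp
  qed
  have F_eq: "lincomb k N F (basis_vec k s) = F s \<and> basis_vec k s \<in> carrier (tuple_module k A)"
    if "s \<in> tuples k A" for s
    using lincomb_basis_vec[OF N Fc that] basis_vec_closed[OF k that] by simp
  have add: "lincomb k N F (basis_vec k s \<ominus>\<^bsub>tuple_module k A\<^esub> (basis_vec k s\<^sub>1 \<oplus>\<^bsub>tuple_module k A\<^esub> basis_vec k s\<^sub>2)) = \<zero>\<^bsub>N\<^esub>
     \<and> basis_vec k s \<ominus>\<^bsub>tuple_module k A\<^esub> (basis_vec k s\<^sub>1 \<oplus>\<^bsub>tuple_module k A\<^esub> basis_vec k s\<^sub>2) \<in> carrier (tuple_module k A)"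
    if "slot_combination k A \<one>\<^bsub>k\<^esub> s s\<^sub>1 s\<^sub>2" for s s\<^sub>1 s\<^sub>2
    using slot_combination_tuples[OF A _ that]
    by (intro ominus) (simp_all add: F_eq lin(2) multilinear_add[OF A N F that])
  have smult: "lincomb k N F (basis_vec k s \<ominus>\<^bsub>tuple_module k A\<^esub> (c \<odot>\<^bsub>tuple_module k A\<^esub> basis_vec k s\<^sub>1)) = \<zero>\<^bsub>N\<^esub>
     \<and> basis_vec k s \<ominus>\<^bsub>tuple_module k A\<^esub> (c \<odot>\<^bsub>tuple_module k A\<^esub> basis_vec k s\<^sub>1) \<in> carrier (tuple_module k A)"
    if "c \<in> carrier k" "slot_combination k A c s s\<^sub>1 z" "slot_combination k A \<one>\<^bsub>k\<^esub> z z z" for s s\<^sub>1 z c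
    using slot_combination_tuples[OF A _ that(2)] that(1)
    by (intro ominus) (simp_all add: F_eq lin(3) multilinear_smult[OF A N F that])
  show ?thesis
    using g
  proof cases
    case (head_add a u b)
    then have "a \<in> carrier A" "b \<in> carrier A"
      by (auto intro: tuples_head)
    then have "slot_combination k A \<one>\<^bsub>k\<^esub> (a \<oplus>\<^bsub>A\<^esub> b, u) (a, u) (b, u)"
      using slot_combination.head[OF head_add(2), of b "\<one>\<^bsub>k\<^esub>"] by simp
    then show ?thesis
      unfolding head_add(1) using add by blast
  next
    case (head_smult c a u)
    \<comment> \<open>The tuple with zero in the scaled slot is the \<open>z\<close> required by
      \<open>multilinear_smult\<close>; types and later letters are treated likewise.\<close>
    then have "a \<in> carrier A" "(\<zero>\<^bsub>A\<^esub>, u) \<in> tuples k A"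
      by (auto intro: tuples_head tuples_change_head)
    then have "slot_combination k A c (c \<odot>\<^bsub>A\<^esub> a, u) (a, u) (\<zero>\<^bsub>A\<^esub>, u)"
      "slot_combination k A \<one>\<^bsub>k\<^esub> (\<zero>\<^bsub>A\<^esub>, u) (\<zero>\<^bsub>A\<^esub>, u) (\<zero>\<^bsub>A\<^esub>, u)"
      using slot_combination.head[OF head_smult(3), of "\<zero>\<^bsub>A\<^esub>" c]
        slot_combination.head[of "\<zero>\<^bsub>A\<^esub>" u k A "\<zero>\<^bsub>A\<^esub>" "\<one>\<^bsub>k\<^esub>"] head_smult(2) by simp_all
    then show ?thesis
      unfolding head_smult(1) using smult[OF head_smult(2)] by blast
  next
    case (type_add a w x b v y)
    then have "slot_combination k A \<one>\<^bsub>k\<^esub> (a, w @ (x \<oplus>\<^bsub>free_module k UNIV\<^esub> y, b) # v) (a, w @ (x, b) # v) (a, w @ (y, b) # v)"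
      using slot_combination_type[OF type_add(2), of y "\<one>\<^bsub>k\<^esub>"] by (simp add: tuples_simps)
    then show ?thesis
      unfolding type_add(1) using add by blast
  next
    case (type_smult c a w x b v)
    let ?z = "\<zero>\<^bsub>free_module k (UNIV :: 'w set)\<^esub>"
    have "(a, w @ (?z, b) # v) \<in> tuples k A"
      using type_smult(3) by (simp add: tuples_simps)
    then have "slot_combination k A c (a, w @ (c \<odot>\<^bsub>free_module k UNIV\<^esub> x, b) # v) (a, w @ (x, b) # v) (a, w @ (?z, b) # v)"
      "slot_combination k A \<one>\<^bsub>k\<^esub> (a, w @ (?z, b) # v) (a, w @ (?z, b) # v) (a, w @ (?z, b) # v)"
      using slot_combination_type[OF type_smult(3), of ?z c] type_smult(2,3)
        slot_combination_type[of a w ?z b v k A ?z "\<one>\<^bsub>k\<^esub>"] by (simp_all add: tuples_simps)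
    then show ?thesis
      unfolding type_smult(1) using smult[OF type_smult(2)] by blast
  next
    case (letter_add a w x b v b')
    then have "(a, w) \<in> tuples k A" "x \<in> carrier (free_module k UNIV)" "(b, v) \<in> tuples k A"
        "b \<in> carrier A" "b' \<in> carrier A"
      by (auto simp: tuples_simps intro: tuples_head)
    then have "slot_combination k A \<one>\<^bsub>k\<^esub> (a, w @ (x, b \<oplus>\<^bsub>A\<^esub> b') # v) (a, w @ (x, b) # v) (a, w @ (x, b') # v)"
      using slot_combination.head[of b v k A b' "\<one>\<^bsub>k\<^esub>"] by (auto intro: slot_combination_append)
    then show ?thesis
      unfolding letter_add(1) using add by blast
  next
    case (letter_smult c a w x b v)
    then have t: "(a, w) \<in> tuples k A" "x \<in> carrier (free_module k UNIV)" "(b, v) \<in> tuples k A"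
        "b \<in> carrier A" "(\<zero>\<^bsub>A\<^esub>, v) \<in> tuples k A"
      by (auto simp: tuples_simps intro: tuples_head tuples_change_head)
    then have "slot_combination k A c (c \<odot>\<^bsub>A\<^esub> b, v) (b, v) (\<zero>\<^bsub>A\<^esub>, v)"
      "slot_combination k A \<one>\<^bsub>k\<^esub> (\<zero>\<^bsub>A\<^esub>, v) (\<zero>\<^bsub>A\<^esub>, v) (\<zero>\<^bsub>A\<^esub>, v)"
      using slot_combination.head[of b v k A "\<zero>\<^bsub>A\<^esub>" c] letter_smult(2)
        slot_combination.head[of "\<zero>\<^bsub>A\<^esub>" v k A "\<zero>\<^bsub>A\<^esub>" "\<one>\<^bsub>k\<^esub>"] by simp_all
    note this[THEN slot_combination_append[OF t(1,2)]]
    then show ?thesis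
      unfolding letter_smult(1) using smult[OF letter_smult(2)] by blast
  qed
qed

lemma multilinearity_closed:
  assumes A: "module k A"
  shows "multilinearity k A \<subseteq> carrier (tuple_module k A)"
proof -
  interpret A: module k A by fact
  \<comment> \<open>The zero map is multilinear, so the carrier half of
    \<open>multilinear_kernel\<close> becomes available.\<close>
  have "multilinear k A A (\<lambda>_. \<zero>\<^bsub>A\<^esub>)"
    by (simp add: multilinear_def)
  then show ?thesis
    using multilinear_kernel[OF A A] by blast
qed

lemma submodule_tensor_relations:
  assumes A: "module k A"
  shows "submodule (tensor_relations k A) k (tuple_module k A)"
proof -
  interpret A: module k A by fact
  interpret M: module k "tuple_module k A" by (rule module_free_module) (rule A.R.is_cring)
  have sub: "H \<subseteq> carrier (tuple_module k A)" "\<zero>\<^bsub>tuple_module k A\<^esub> \<in> H"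
    if "submodule H k (tuple_module k A)" for H
    using M.submoduleE(1)[OF that] subgroup.one_closed[OF submodule.axioms(1)[OF that]] by simp_all
  \<comment> \<open>The family being intersected contains the whole carrier, so the intersection
    stays inside the carrier.\<close>
  have "carrier (tuple_module k A) \<in> {H. submodule H k (tuple_module k A) \<and> multilinearity k A \<subseteq> H}"
    using M.carrier_is_submodule multilinearity_closed[OF A] by simp
  note subset = Inter_lower[OF this]
  show ?thesis
    unfolding tensor_relations_def
    by (intro M.submoduleI subset) (simp_all add: M.submoduleE sub)
qed

lemma multilinearity_tensor_relations: "multilinearity k A \<subseteq> tensor_relations k A"
  by (auto simp: tensor_relations_def)

lemma lincomb_tensor_relations:
  assumes A: "module k A" and N: "module k N" and F: "multilinear k A N F"
    and f: "f \<in> tensor_relations k A"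
  shows "lincomb k N F f = \<zero>\<^bsub>N\<^esub>"
proof -
  interpret N: module k N by fact
  interpret M: module k "tuple_module k A" by (rule module_free_module) (rule N.R.is_cring)
  have Fc: "F \<in> tuples k A \<rightarrow> carrier N"
    using F by (simp add: multilinear_def)
  note lin = linear_mapsD[OF lincomb_linear[OF N Fc]]
  \<comment> \<open>This kernel is a submodule containing the generators, and
    \<open>tensor_relations\<close> is the least one.\<close>
  let ?K = "{f \<in> carrier (tuple_module k A). lincomb k N F f = \<zero>\<^bsub>N\<^esub>}"
  have "submodule ?K k (tuple_module k A)"
  proof (rule M.submoduleI)
    show "\<ominus>\<^bsub>tuple_module k A\<^esub> f \<in> ?K" if "f \<in> ?K" for f
    proof -
      have "\<ominus>\<^bsub>tuple_module k A\<^esub> f = (\<ominus>\<^bsub>k\<^esub> \<one>\<^bsub>k\<^esub>) \<odot>\<^bsub>tuple_module k A\<^esub> f"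
        using that by (simp add: M.smult_l_minus)
      then show ?thesis
        using that by (simp add: lin)
    qed
  qed (auto simp: lin linear_maps_zero[OF M.module_axioms N lincomb_linear[OF N Fc]])
  then have "tensor_relations k A \<subseteq> ?K"
    using multilinear_kernel[OF A N F] by (auto simp: tensor_relations_def)
  with f show ?thesis by auto
qed

text \<open>Converse to the kernel computation. The generators treat addition and scaling
  separately, and likewise the head and the later letters; together they yield every combination
  \<open>c x + y\<close> at any depth.\<close>

lemma slot_combination_tensor_relations:
  assumes A: "module k A" and c: "c \<in> carrier k" and s: "slot_combination k A c s s\<^sub>1 s\<^sub>2"
    and N: "module k N" and h: "h \<in> linear_maps k (tuple_module k A) N"
    and h0: "\<And>f. f \<in> tensor_relations k A \<Longrightarrow> h f = \<zero>\<^bsub>N\<^esub>"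
  shows "h (basis_vec k s) = c \<odot>\<^bsub>N\<^esub> h (basis_vec k s\<^sub>1) \<oplus>\<^bsub>N\<^esub> h (basis_vec k s\<^sub>2)"
proof -
  interpret A: module k A by fact
  interpret N: module k N by fact
  have k: "cring k" by (rule A.R.is_cring)
  interpret M: module k "tuple_module k A" by (rule module_free_module[OF k])
  interpret Fr: module k "free_module k UNIV" by (rule module_free_module[OF k])
  have eq: "h f = h g" if "f \<ominus>\<^bsub>tuple_module k A\<^esub> g \<in> multilinearity k A"
    "f \<in> carrier (tuple_module k A)" "g \<in> carrier (tuple_module k A)" for f g
  proof -
    have "h f = h ((f \<ominus>\<^bsub>tuple_module k A\<^esub> g) \<oplus>\<^bsub>tuple_module k A\<^esub> g)"
      using that by (simp add: a_minus_def M.M.a_assoc M.M.l_neg)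
    also have "\<dots> = h (f \<ominus>\<^bsub>tuple_module k A\<^esub> g) \<oplus>\<^bsub>N\<^esub> h g"
      using that by (simp add: linear_mapsD[OF h])
    also have "h (f \<ominus>\<^bsub>tuple_module k A\<^esub> g) = \<zero>\<^bsub>N\<^esub>"
      using that(1) multilinearity_tensor_relations by (blast intro: h0)
    finally show ?thesis using that(3) linear_mapsD(1)[OF h] by simp
  qed
  note b = basis_vec_closed[OF k] and lin = linear_mapsD[OF h]
  have hb: "h (basis_vec k t) \<in> carrier N" if "t \<in> tuples k A" for t
    using lin(1)[OF b[OF that]] .
  \<comment> \<open>\<open>r\<close> is the tuple with the scaled entry alone in the slot: an
    addition relation leads from \<open>t\<close> to \<open>r\<close> and \<open>t\<^sub>2\<close>,
    and a scaling relation from \<open>r\<close> to \<open>t\<^sub>1\<close>.\<close>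
  have combine: "h (basis_vec k t) = c \<odot>\<^bsub>N\<^esub> h (basis_vec k t\<^sub>1) \<oplus>\<^bsub>N\<^esub> h (basis_vec k t\<^sub>2)"
    if "basis_vec k t \<ominus>\<^bsub>tuple_module k A\<^esub> (basis_vec k r \<oplus>\<^bsub>tuple_module k A\<^esub> basis_vec k t\<^sub>2) \<in> multilinearity k A"
      "basis_vec k r \<ominus>\<^bsub>tuple_module k A\<^esub> (c \<odot>\<^bsub>tuple_module k A\<^esub> basis_vec k t\<^sub>1) \<in> multilinearity k A"
      "t \<in> tuples k A" "r \<in> tuples k A" "t\<^sub>1 \<in> tuples k A" "t\<^sub>2 \<in> tuples k A" for t t\<^sub>1 t\<^sub>2 r
  proof -
    note b = b[OF that(3)] b[OF that(4)] b[OF that(5)] b[OF that(6)]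
    have "h (basis_vec k t) = h (basis_vec k r \<oplus>\<^bsub>tuple_module k A\<^esub> basis_vec k t\<^sub>2)"
      by (rule eq[OF that(1)]) (simp_all add: b)
    also have "\<dots> = h (basis_vec k r) \<oplus>\<^bsub>N\<^esub> h (basis_vec k t\<^sub>2)"
      by (rule lin(2)) (simp_all add: b)
    also have "h (basis_vec k r) = h (c \<odot>\<^bsub>tuple_module k A\<^esub> basis_vec k t\<^sub>1)"
      by (rule eq[OF that(2)]) (simp_all add: b c)
    also have "\<dots> = c \<odot>\<^bsub>N\<^esub> h (basis_vec k t\<^sub>1)"
      by (rule lin(3)) (simp_all add: b c)
    finally show ?thesis .
  qed
  define H where "H t t\<^sub>1 t\<^sub>2 \<longleftrightarrow> h (basis_vec k t) = c \<odot>\<^bsub>N\<^esub> h (basis_vec k t\<^sub>1) \<oplus>\<^bsub>N\<^esub> h (basis_vec k t\<^sub>2)"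
    for t t\<^sub>1 t\<^sub>2
  let ?ext = "\<lambda>a w x t. (a, w @ (x, fst t) # snd t)"
  \<comment> \<open>The induction carries an arbitrary front part: a combination in a head falls
    under the head relations when nothing precedes it, and under the letter relations
    otherwise.\<close>
  have "H s s\<^sub>1 s\<^sub>2 \<and> (\<forall>a w x. (a, w) \<in> tuples k A \<longrightarrow> x \<in> carrier (free_module k UNIV) \<longrightarrow>
      H (?ext a w x s) (?ext a w x s\<^sub>1) (?ext a w x s\<^sub>2))"
    using s
  proof induction
    case (head a u b)
    then have a: "a \<in> carrier A" and u: "(b, u) \<in> tuples k A" "(c \<odot>\<^bsub>A\<^esub> a, u) \<in> tuples k A"
      using c by (auto intro: tuples_head tuples_change_head)
    then have sum: "(c \<odot>\<^bsub>A\<^esub> a \<oplus>\<^bsub>A\<^esub> b, u) \<in> tuples k A"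
      using c head by (auto intro: tuples_change_head)
    have "H (c \<odot>\<^bsub>A\<^esub> a \<oplus>\<^bsub>A\<^esub> b, u) (a, u) (b, u)"
      unfolding H_def
      by (rule combine[OF multilinearity.head_add multilinearity.head_smult]) (use c u sum head in auto)
    moreover have "H (a', w @ (x, c \<odot>\<^bsub>A\<^esub> a \<oplus>\<^bsub>A\<^esub> b) # u) (a', w @ (x, a) # u) (a', w @ (x, b) # u)"
      if "(a', w) \<in> tuples k A" "x \<in> carrier (free_module k UNIV)" for a' w x
      unfolding H_def
      by (rule combine[OF multilinearity.letter_add multilinearity.letter_smult])
        (use c u sum head that in \<open>auto simp: tuples_simps\<close>)
    ultimately show ?case by simp
  next
    case (type a x b u y)
    have *: "H (a', w @ (c \<odot>\<^bsub>free_module k UNIV\<^esub> x \<oplus>\<^bsub>free_module k UNIV\<^esub> y, b) # u)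
        (a', w @ (x, b) # u) (a', w @ (y, b) # u)" if "(a', w) \<in> tuples k A" for a' w
      unfolding H_def
      by (rule combine[OF multilinearity.type_add multilinearity.type_smult])
        (use c type that in \<open>auto simp: tuples_simps\<close>)
    \<comment> \<open>Placing a tuple with head \<open>a\<close> behind \<open>w\<close> and a type
      amounts to lengthening the front part by that type and \<open>a\<close>.\<close>
    show ?case
      using *[of a "[]"] *[of _ "_ @ [(_, a)]"] type by (auto simp: tuples_simps)
  next
    case (tail a x b u b\<^sub>1 u\<^sub>1 b\<^sub>2 u\<^sub>2)
    then have *: "H (a', w @ (x, b) # u) (a', w @ (x, b\<^sub>1) # u\<^sub>1) (a', w @ (x, b\<^sub>2) # u\<^sub>2)"
      if "(a', w) \<in> tuples k A" for a' w
      using that by simp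
    show ?case
      using *[of a "[]"] *[of _ "_ @ [(_, a)]"] tail(1) by (auto simp: tuples_simps)
  qed
  then show ?thesis
    by (simp add: H_def)
qed

section \<open>Commutative extended triassociative semigroups\<close>

context commutative_lambda_ets
begin

lemma lam_closed: "lam E \<alpha> \<beta> \<in> carrier k"
  using lambda_ets_axioms by (simp add: lambda_ets_def lambda_ets_axioms_def)

lemma commute:
  "\<alpha> \<leftharpoonup> \<beta> = \<beta> \<rightharpoonup> \<alpha>" "\<alpha> \<triangleleft> \<beta> = \<beta> \<triangleright> \<alpha>" "\<alpha> \<cdot> \<beta> = \<beta> \<cdot> \<alpha>" "lam E \<alpha> \<beta> = lam E \<beta> \<alpha>"
  using commutative_lambda_ets_axioms
  unfolding commutative_lambda_ets_def commutative_lambda_ets_axioms_def by blast+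

text \<open>Oriented as rewrite rules: brackets move to the right, and in the right argument of
  \<leftharpoonup> a \<rightharpoonup> becomes \<leftharpoonup>.\<close>

lemma larr_laws:
  "\<alpha> \<leftharpoonup> \<beta> \<leftharpoonup> \<gamma> = \<alpha> \<leftharpoonup> (\<beta> \<leftharpoonup> \<gamma>)" "\<alpha> \<leftharpoonup> (\<beta> \<rightharpoonup> \<gamma>) = \<alpha> \<leftharpoonup> (\<beta> \<leftharpoonup> \<gamma>)"
  "\<alpha> \<rightharpoonup> \<beta> \<leftharpoonup> \<gamma> = \<alpha> \<rightharpoonup> (\<beta> \<leftharpoonup> \<gamma>)"
  "\<alpha> \<rightharpoonup> \<beta> \<rightharpoonup> \<gamma> = \<alpha> \<rightharpoonup> (\<beta> \<rightharpoonup> \<gamma>)" "\<alpha> \<leftharpoonup> \<beta> \<rightharpoonup> \<gamma> = \<alpha> \<rightharpoonup> (\<beta> \<rightharpoonup> \<gamma>)"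
  using diassociative_semigroup_axioms unfolding diassociative_semigroup_def by metis+

lemma triangle_laws:
  "\<alpha> \<triangleright> (\<beta> \<leftharpoonup> \<gamma>) = \<alpha> \<triangleright> \<beta>"
  "\<alpha> \<rightharpoonup> \<beta> \<triangleleft> \<gamma> = \<beta> \<triangleleft> \<gamma>"
  "\<alpha> \<triangleleft> \<beta> \<leftharpoonup> (\<alpha> \<leftharpoonup> \<beta> \<triangleleft> \<gamma>) = \<alpha> \<triangleleft> (\<beta> \<leftharpoonup> \<gamma>)"
  "\<alpha> \<triangleleft> \<beta> \<triangleleft> (\<alpha> \<leftharpoonup> \<beta> \<triangleleft> \<gamma>) = \<beta> \<triangleleft> \<gamma>"
  "\<alpha> \<triangleleft> \<beta> \<rightharpoonup> (\<alpha> \<leftharpoonup> \<beta> \<triangleleft> \<gamma>) = \<alpha> \<triangleleft> (\<beta> \<rightharpoonup> \<gamma>)"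
  "\<alpha> \<triangleleft> \<beta> \<triangleright> (\<alpha> \<leftharpoonup> \<beta> \<triangleleft> \<gamma>) = \<beta> \<triangleright> \<gamma>"
  "\<alpha> \<triangleright> (\<beta> \<rightharpoonup> \<gamma>) \<leftharpoonup> (\<beta> \<triangleright> \<gamma>) = \<alpha> \<leftharpoonup> \<beta> \<triangleright> \<gamma>"
  "\<alpha> \<triangleright> (\<beta> \<rightharpoonup> \<gamma>) \<triangleleft> (\<beta> \<triangleright> \<gamma>) = \<alpha> \<triangleleft> \<beta>"
  "\<alpha> \<triangleright> (\<beta> \<rightharpoonup> \<gamma>) \<rightharpoonup> (\<beta> \<triangleright> \<gamma>) = \<alpha> \<rightharpoonup> \<beta> \<triangleright> \<gamma>"
  "\<alpha> \<triangleright> (\<beta> \<rightharpoonup> \<gamma>) \<triangleright> (\<beta> \<triangleright> \<gamma>) = \<alpha> \<triangleright> \<beta>"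
  using extended_diassociative_semigroup_axioms
  unfolding extended_diassociative_semigroup_def extended_diassociative_semigroup_axioms_def by metis+

lemma lam_laws:
  "lam E (\<alpha> \<rightharpoonup> \<beta>) \<gamma> = lam E \<beta> \<gamma>"
  "lam E (\<alpha> \<triangleleft> \<beta>) (\<alpha> \<leftharpoonup> \<beta> \<triangleleft> \<gamma>) = lam E \<beta> \<gamma>"
  "lam E \<alpha> (\<beta> \<rightharpoonup> \<gamma>) = lam E (\<alpha> \<leftharpoonup> \<beta>) \<gamma>"
  "lam E (\<alpha> \<triangleright> (\<beta> \<rightharpoonup> \<gamma>)) (\<beta> \<triangleright> \<gamma>) = lam E \<alpha> \<beta>"
  "lam E \<alpha> (\<beta> \<leftharpoonup> \<gamma>) = lam E \<alpha> \<beta>"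
  "lam E \<beta> \<gamma> \<otimes>\<^bsub>k\<^esub> lam E \<alpha> (\<beta> \<cdot> \<gamma>) = lam E \<alpha> \<beta> \<otimes>\<^bsub>k\<^esub> lam E (\<alpha> \<cdot> \<beta>) \<gamma>"
  using lambda_ets_axioms unfolding lambda_ets_def lambda_ets_axioms_def by simp_all

text \<open>The conditional laws one by one; iterated arrows appear in the bracketing that
  \<open>larr_laws\<close> produces.\<close>

lemma dot_laws:
  "lam E \<beta> \<gamma> \<noteq> \<zero>\<^bsub>k\<^esub> \<Longrightarrow> \<alpha> \<triangleright> (\<beta> \<cdot> \<gamma>) = \<alpha> \<triangleright> \<beta>"
  "lam E \<beta> \<gamma> \<noteq> \<zero>\<^bsub>k\<^esub> \<Longrightarrow> \<alpha> \<rightharpoonup> \<beta> \<cdot> \<gamma> = \<alpha> \<rightharpoonup> (\<beta> \<cdot> \<gamma>)"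
  "lam E \<beta> \<gamma> \<noteq> \<zero>\<^bsub>k\<^esub> \<Longrightarrow> \<alpha> \<triangleleft> \<beta> \<cdot> (\<alpha> \<leftharpoonup> \<beta> \<triangleleft> \<gamma>) = \<alpha> \<triangleleft> (\<beta> \<cdot> \<gamma>)"
  "lam E \<beta> \<gamma> \<noteq> \<zero>\<^bsub>k\<^esub> \<Longrightarrow> \<alpha> \<leftharpoonup> (\<beta> \<leftharpoonup> \<gamma>) = \<alpha> \<leftharpoonup> (\<beta> \<cdot> \<gamma>)"
  "lam E \<alpha> \<beta> \<noteq> \<zero>\<^bsub>k\<^esub> \<Longrightarrow> \<alpha> \<cdot> \<beta> \<rightharpoonup> \<gamma> = \<alpha> \<rightharpoonup> (\<beta> \<rightharpoonup> \<gamma>)"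
  "lam E \<alpha> \<beta> \<noteq> \<zero>\<^bsub>k\<^esub> \<Longrightarrow> \<alpha> \<triangleright> (\<beta> \<rightharpoonup> \<gamma>) \<cdot> (\<beta> \<triangleright> \<gamma>) = \<alpha> \<cdot> \<beta> \<triangleright> \<gamma>"
  "lam E (\<alpha> \<leftharpoonup> \<beta>) \<gamma> \<noteq> \<zero>\<^bsub>k\<^esub> \<Longrightarrow> \<alpha> \<cdot> (\<beta> \<rightharpoonup> \<gamma>) = \<alpha> \<leftharpoonup> \<beta> \<cdot> \<gamma>"
  "lam E (\<alpha> \<leftharpoonup> \<beta>) \<gamma> \<noteq> \<zero>\<^bsub>k\<^esub> \<Longrightarrow> \<beta> \<triangleright> \<gamma> = \<alpha> \<triangleleft> \<beta>"
  "lam E \<alpha> \<beta> \<noteq> \<zero>\<^bsub>k\<^esub> \<Longrightarrow> \<alpha> \<cdot> \<beta> \<triangleleft> \<gamma> = \<beta> \<triangleleft> \<gamma>"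
  "lam E \<alpha> \<beta> \<noteq> \<zero>\<^bsub>k\<^esub> \<Longrightarrow> \<alpha> \<cdot> (\<beta> \<leftharpoonup> \<gamma>) = \<alpha> \<cdot> \<beta> \<leftharpoonup> \<gamma>"
  "lam E \<alpha> \<beta> \<otimes>\<^bsub>k\<^esub> lam E (\<alpha> \<cdot> \<beta>) \<gamma> \<noteq> \<zero>\<^bsub>k\<^esub> \<Longrightarrow> \<alpha> \<cdot> (\<beta> \<cdot> \<gamma>) = \<alpha> \<cdot> \<beta> \<cdot> \<gamma>"
  using lambda_ets_axioms larr_laws(1,4) unfolding lambda_ets_def lambda_ets_axioms_def by metis+

end

section \<open>The module of typed words\<close>

locale typed_word_setting = A: algebra k A + commutative_lambda_ets E k
  for k :: "'k ring" and A :: "('k, 'a) module" and E :: "('w, 'k) ets" (structure)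
begin

abbreviation M :: "('k, ('a, 'w, 'k) tuple \<Rightarrow> 'k) module" where
  "M \<equiv> tuple_module k A"

abbreviation Q :: "('k, (('a, 'w, 'k) tuple \<Rightarrow> 'k) set) module" where
  "Q \<equiv> typed_words k A E"

abbreviation T :: "(('a, 'w, 'k) tuple \<Rightarrow> 'k) set" where
  "T \<equiv> tensor_relations k A"

abbreviation types :: "('k, 'w \<Rightarrow> 'k) module" where
  "types \<equiv> free_module k UNIV"

abbreviation cls :: "(('a, 'w, 'k) tuple \<Rightarrow> 'k) \<Rightarrow> (('a, 'w, 'k) tuple \<Rightarrow> 'k) set" where
  "cls \<equiv> typed_word_class k A"

definition pure :: "('a, 'w, 'k) tuple \<Rightarrow> (('a, 'w, 'k) tuple \<Rightarrow> 'k) set" where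
  "pure s = cls (basis_vec k s)"

lemma cring_k: "cring k"
  by (rule A.R.is_cring)

sublocale M: module k M
  by (rule module_free_module[OF cring_k])

sublocale types: module k types
  by (rule module_free_module[OF cring_k])

lemma module_A: "module k A"
  by (rule A.module_axioms)

lemma module_M: "module k M"
  by (rule M.module_axioms)

lemma module_types: "module k types"
  by (rule types.module_axioms)

lemma submodule_T: "submodule T k M"
  by (rule submodule_tensor_relations[OF module_A])

sublocale T: abelian_subgroup T M
  by (rule abelian_subgroupI3)
    (auto intro: additive_subgroup.intro submodule.axioms(1)[OF submodule_T] M.M.abelian_group_axioms)

lemma typed_words_simps:
  "carrier Q = cls ` carrier M"
  "X \<oplus>\<^bsub>Q\<^esub> Y = X <+>\<^bsub>M\<^esub> Y"
  "\<zero>\<^bsub>Q\<^esub> = T"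
  "\<one>\<^bsub>Q\<^esub> = pure (\<one>\<^bsub>A\<^esub>, [])"
  "c \<odot>\<^bsub>Q\<^esub> X = (\<Union>f\<in>X. cls (c \<odot>\<^bsub>M\<^esub> f))"
  "X \<otimes>\<^bsub>Q\<^esub> Y = (\<Union>f\<in>X. \<Union>g\<in>Y. cls (bilinear_ext k (tuple_mult k A E) f g))"
  unfolding typed_words_def ring.defs module.defs FactRing_def pure_def typed_word_class_def
    rcoset_mult_def A_RCOSETS_def' set_add_def' a_r_coset_def'
  by (auto simp: tuple_algebra_def)

lemma cls_self: "f \<in> carrier M \<Longrightarrow> f \<in> cls f"
  unfolding typed_word_class_def by (rule T.a_rcos_self)

lemma in_clsD:
  assumes "g \<in> cls f" "f \<in> carrier M"
  shows "g \<in> carrier M" "cls g = cls f" "\<exists>t\<in>T. g = t \<oplus>\<^bsub>M\<^esub> f"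
proof -
  show "g \<in> carrier M"
    using assms T.a_elemrcos_carrier by (auto simp: typed_word_class_def)
  show "cls g = cls f"
    using assms T.a_repr_independence' by (auto simp: typed_word_class_def)
  show "\<exists>t\<in>T. g = t \<oplus>\<^bsub>M\<^esub> f"
    using assms by (auto simp: typed_word_class_def a_r_coset_def')
qed

text \<open>Operations on classes are unions over representatives; such a union collapses once its
  members agree.\<close>

lemma UN_cls: "f \<in> carrier M \<Longrightarrow> (\<And>g. g \<in> cls f \<Longrightarrow> \<phi> g = \<phi> f) \<Longrightarrow> (\<Union>g\<in>cls f. \<phi> g) = \<phi> f"
  using cls_self by blast

lemma cls_T: "t \<in> T \<Longrightarrow> cls t = T"
  unfolding typed_word_class_def by (rule T.a_rcos_const)

lemma cls_add: "f \<in> carrier M \<Longrightarrow> g \<in> carrier M \<Longrightarrow> cls (f \<oplus>\<^bsub>M\<^esub> g) = cls f \<oplus>\<^bsub>Q\<^esub> cls g"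
  unfolding typed_word_class_def typed_words_simps by (rule T.a_rcos_sum[symmetric])

lemma cls_add_T:
  assumes "t \<in> T" "f \<in> carrier M"
  shows "cls (t \<oplus>\<^bsub>M\<^esub> f) = cls f"
proof (rule in_clsD(2))
  show "t \<oplus>\<^bsub>M\<^esub> f \<in> cls f"
    using assms by (auto simp: typed_word_class_def a_r_coset_def')
qed fact

lemma cls_smult:
  assumes "c \<in> carrier k" "f \<in> carrier M"
  shows "cls (c \<odot>\<^bsub>M\<^esub> f) = c \<odot>\<^bsub>Q\<^esub> cls f"
  unfolding typed_words_simps
proof (rule UN_cls[symmetric])
  fix g assume "g \<in> cls f"
  then obtain t where t: "t \<in> T" "g = t \<oplus>\<^bsub>M\<^esub> f"
    using in_clsD(3) assms(2) by blast
  then have "c \<odot>\<^bsub>M\<^esub> g = c \<odot>\<^bsub>M\<^esub> t \<oplus>\<^bsub>M\<^esub> c \<odot>\<^bsub>M\<^esub> f"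
    using assms by (simp add: M.smult_r_distr)
  then show "cls (c \<odot>\<^bsub>M\<^esub> g) = cls (c \<odot>\<^bsub>M\<^esub> f)"
    using assms submodule.smult_closed[OF submodule_T assms(1) t(1)] by (simp add: cls_add_T)
qed fact

lemma cls_closed: "f \<in> carrier M \<Longrightarrow> cls f \<in> carrier Q"
  by (simp add: typed_words_simps)

lemma cls_linear: "cls \<in> linear_maps k M Q"
  by (rule linear_mapsI) (simp_all add: cls_closed cls_add cls_smult)

lemma cls_cases:
  assumes "X \<in> carrier Q"
  obtains f where "f \<in> carrier M" "X = cls f"
  using assms by (auto simp: typed_words_simps)

lemma cls_zero: "cls \<zero>\<^bsub>M\<^esub> = \<zero>\<^bsub>Q\<^esub>"
  using cls_T[OF T.zero_closed] by (simp add: typed_words_simps)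

text \<open>The module laws are carried over from \<open>M\<close> along \<open>cls\<close>.
  Quotients of rings by ideals cannot supply them, because \<open>tuple_algebra\<close> need not be
  associative.\<close>

lemma module_Q: "module k Q"
proof (rule moduleI[OF cring_k])
  show "abelian_group Q"
  proof (rule abelian_groupI)
    show "\<zero>\<^bsub>Q\<^esub> \<in> carrier Q"
      using cls_closed[of "\<zero>\<^bsub>M\<^esub>"] by (simp add: cls_zero)
    show "\<exists>Y\<in>carrier Q. Y \<oplus>\<^bsub>Q\<^esub> X = \<zero>\<^bsub>Q\<^esub>" if "X \<in> carrier Q" for X
      using that
    proof (cases rule: cls_cases)
      case (1 f)
      then have "cls (\<ominus>\<^bsub>M\<^esub> f) \<oplus>\<^bsub>Q\<^esub> X = \<zero>\<^bsub>Q\<^esub>"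
        by (simp flip: cls_add cls_zero add: M.M.l_neg)
      then show ?thesis
        using cls_closed 1 by blast
    qed
  qed (auto elim!: cls_cases simp: M.M.a_ac cls_closed simp flip: cls_add cls_zero)
qed (auto elim!: cls_cases simp: M.smult_l_distr M.smult_r_distr M.smult_assoc1 cls_closed
    simp flip: cls_add cls_zero cls_smult)

sublocale Q: module k Q
  by (rule module_Q)

lemma pure_closed [simp]: "s \<in> tuples k A \<Longrightarrow> pure s \<in> carrier Q"
  unfolding pure_def by (intro cls_closed basis_vec_closed cring_k)

lemma multilinear_pure: "multilinear k A Q pure"
  unfolding multilinear_def
proof (intro conjI allI impI)
  fix c and s s\<^sub>1 s\<^sub>2 :: "('a, 'w, 'k) tuple"
  assume "c \<in> carrier k" "slot_combination k A c s s\<^sub>1 s\<^sub>2"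
  then show "pure s = c \<odot>\<^bsub>Q\<^esub> pure s\<^sub>1 \<oplus>\<^bsub>Q\<^esub> pure s\<^sub>2"
    unfolding pure_def
    by (rule slot_combination_tensor_relations[OF module_A _ _ module_Q cls_linear])
      (simp add: cls_T typed_words_simps)
qed auto

section \<open>Linear maps out of the module of typed words\<close>

lemma linear_maps_typed_words_eqI:
  assumes N: "module k N" and h: "h \<in> linear_maps k Q N" "h' \<in> linear_maps k Q N"
    and eq: "\<And>s. s \<in> tuples k A \<Longrightarrow> h (pure s) = h' (pure s)"
    and X: "X \<in> carrier Q"
  shows "h X = h' X"
  using X
proof (cases rule: cls_cases)
  case (1 f)
  have "h (cls f) = h' (cls f)"
    by (rule linear_maps_free_module_eqI[OF N linear_maps_comp[OF cls_linear h(1)]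
          linear_maps_comp[OF cls_linear h(2)] _ 1(1)])
      (use eq in \<open>simp add: pure_def\<close>)
  then show ?thesis
    using 1 by simp
qed

text \<open>The universal property of the tensor products, for all lengths at once. The
  representative chosen by \<open>SOME\<close> does not matter when \<open>F\<close> is multilinear,
  because two representatives differ by an element of \<open>T\<close>, where the linear extension
  vanishes.\<close>

definition lift :: "('k, 'b) module \<Rightarrow> (('a, 'w, 'k) tuple \<Rightarrow> 'b) \<Rightarrow> (('a, 'w, 'k) tuple \<Rightarrow> 'k) set \<Rightarrow> 'b"
  where "lift N F X = lincomb k N F (SOME f. f \<in> X)"

context
  fixes N :: "('k, 'b) module" and F :: "('a, 'w, 'k) tuple \<Rightarrow> 'b"
  assumes N: "module k N" and F: "multilinear k A N F"
begin

lemma lincomb_multilinear_linear: "lincomb k N F \<in> linear_maps k M N"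
  using F by (intro lincomb_linear[OF N]) (simp add: multilinear_def)

lemma lift_cls:
  assumes f: "f \<in> carrier M"
  shows "lift N F (cls f) = lincomb k N F f"
proof -
  interpret N: module k N by (rule N)
  have "(SOME g. g \<in> cls f) \<in> cls f"
    using cls_self[OF f] by (rule someI[where P = "\<lambda>g. g \<in> cls f"])
  then obtain t where t: "t \<in> T" "(SOME g. g \<in> cls f) = t \<oplus>\<^bsub>M\<^esub> f"
    using in_clsD(3) f by blast
  then show ?thesis
    using f linear_mapsD[OF lincomb_multilinear_linear]
    by (simp add: lift_def lincomb_tensor_relations[OF module_A N F])
qed

lemma lift_linear: "lift N F \<in> linear_maps k Q N"
  by (rule linear_mapsI)
    (auto elim!: cls_cases simp: lift_cls linear_mapsD[OF lincomb_multilinear_linear]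
      simp flip: cls_add cls_smult)

lemma lift_pure: "s \<in> tuples k A \<Longrightarrow> lift N F (pure s) = F s"
  using F unfolding pure_def
  by (subst lift_cls) (auto simp: basis_vec_closed cring_k multilinear_def intro: lincomb_basis_vec[OF N])

end

text \<open>The map induced by \<open>prefix\<close> on classes. Defining it as a lift makes its
  linearity immediate; \<open>prefix_closed_cls\<close> relates it to representatives.\<close>

definition pre :: "'a \<Rightarrow> ('w \<Rightarrow> 'k) \<Rightarrow> (('a, 'w, 'k) tuple \<Rightarrow> 'k) set \<Rightarrow> (('a, 'w, 'k) tuple \<Rightarrow> 'k) set" where
  "pre a x = lift Q (\<lambda>(b, u). pure (a, (x, b) # u))"

lemma multilinear_tail:
  assumes "a \<in> carrier A" "x \<in> carrier types" "multilinear k A N F"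
  shows "multilinear k A N (\<lambda>(b, u). F (a, (x, b) # u))"
  unfolding multilinear_def
proof (intro conjI allI impI)
  fix c and s s\<^sub>1 s\<^sub>2 :: "('a, 'w, 'k) tuple"
  assume c: "c \<in> carrier k" and s: "slot_combination k A c s s\<^sub>1 s\<^sub>2"
  show "(case s of (b, u) \<Rightarrow> F (a, (x, b) # u)) =
      c \<odot>\<^bsub>N\<^esub> (case s\<^sub>1 of (b, u) \<Rightarrow> F (a, (x, b) # u)) \<oplus>\<^bsub>N\<^esub> (case s\<^sub>2 of (b, u) \<Rightarrow> F (a, (x, b) # u))"
    using multilinearD[OF assms(3) c slot_combination.tail[OF assms(1,2)]] s
    by (cases s; cases s\<^sub>1; cases s\<^sub>2) simp
next
  show "(\<lambda>(b, u). F (a, (x, b) # u)) \<in> tuples k A \<rightarrow> carrier N"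
    using assms(1,2) by (auto simp: tuples_simps intro!: multilinear_closed[OF assms(3)])
qed

lemma pre_linear: "a \<in> carrier A \<Longrightarrow> x \<in> carrier types \<Longrightarrow> pre a x \<in> linear_maps k Q Q"
  unfolding pre_def by (intro lift_linear module_Q multilinear_tail multilinear_pure)

lemma pre_closed [simp]: "a \<in> carrier A \<Longrightarrow> x \<in> carrier types \<Longrightarrow> X \<in> carrier Q \<Longrightarrow> pre a x X \<in> carrier Q"
  by (rule linear_mapsD(1)[OF pre_linear])

lemma pre_pure:
  "a \<in> carrier A \<Longrightarrow> x \<in> carrier types \<Longrightarrow> (b, u) \<in> tuples k A \<Longrightarrow>
    pre a x (pure (b, u)) = pure (a, (x, b) # u)"
  unfolding pre_def by (simp add: lift_pure[OF module_Q multilinear_tail[OF _ _ multilinear_pure]])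

lemma prefix_closed_cls:
  assumes a: "a \<in> carrier A" and x: "x \<in> carrier types" and f: "f \<in> carrier M"
  shows "prefix k a x f \<in> carrier M" "cls (prefix k a x f) = pre a x (cls f)"
proof -
  let ?G = "\<lambda>(b, u). basis_vec k (a, (x, b) # u)"
  have G: "?G \<in> tuples k A \<rightarrow> carrier M"
    using a x by (auto simp: tuples_simps intro!: basis_vec_closed cring_k)
  have eq: "prefix k a x f = lincomb k M ?G f"
    unfolding prefix_def by (rule linear_ext_eq_lincomb[OF cring_k f G])
  show "prefix k a x f \<in> carrier M"
    unfolding eq by (rule linear_mapsD(1)[OF lincomb_linear[OF module_M G] f])
  have "cls (prefix k a x f) = lincomb k Q (\<lambda>s. cls (?G s)) f"
    unfolding eq by (rule linear_map_lincomb[OF module_M module_Q cls_linear G f])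
  also have "(\<lambda>s. cls (?G s)) = (\<lambda>(b, u). pure (a, (x, b) # u))"
    by (auto simp: pure_def)
  also have "lincomb k Q \<dots> f = pre a x (cls f)"
    unfolding pre_def
    by (rule lift_cls[symmetric, OF module_Q multilinear_tail[OF a x multilinear_pure] f])
  finally show "cls (prefix k a x f) = pre a x (cls f)" .
qed

text \<open>Head and type are slots of the longer tuple, so linearity in either is multilinearity of
  \<open>pure\<close>; linearity in \<open>X\<close> reduces the check to pure tensors.\<close>

lemma pre_head_linear:
  assumes x: "x \<in> carrier types" and X: "X \<in> carrier Q"
  shows "(\<lambda>a. pre a x X) \<in> linear_maps k A Q"
proof (rule linear_mapsI)
  fix a b assume ab: "a \<in> carrier A" "b \<in> carrier A"
  show "pre (a \<oplus>\<^bsub>A\<^esub> b) x X = pre a x X \<oplus>\<^bsub>Q\<^esub> pre b x X"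
  proof (rule linear_maps_typed_words_eqI[OF module_Q _ _ _ X])
    fix s :: "('a, 'w, 'k) tuple"
    assume s: "s \<in> tuples k A"
    obtain d u where [simp]: "s = (d, u)" by (cases s)
    show "pre (a \<oplus>\<^bsub>A\<^esub> b) x (pure s) = pre a x (pure s) \<oplus>\<^bsub>Q\<^esub> pre b x (pure s)"
      using s ab x slot_combination.head[of a "(x, d) # u" k A b "\<one>\<^bsub>k\<^esub>"]
      by (simp add: pre_pure) (rule multilinear_add[OF module_A module_Q multilinear_pure], simp add: tuples_simps)
  qed (intro linear_maps_add module_Q pre_linear x ab A.M.a_closed)+
next
  fix c a assume c: "c \<in> carrier k" and a: "a \<in> carrier A"
  show "pre (c \<odot>\<^bsub>A\<^esub> a) x X = c \<odot>\<^bsub>Q\<^esub> pre a x X"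
  proof (rule linear_maps_typed_words_eqI[OF module_Q _ _ _ X])
    fix s :: "('a, 'w, 'k) tuple"
    assume s: "s \<in> tuples k A"
    obtain d u where [simp]: "s = (d, u)" by (cases s)
    show "pre (c \<odot>\<^bsub>A\<^esub> a) x (pure s) = c \<odot>\<^bsub>Q\<^esub> pre a x (pure s)"
      using s c a x slot_combination.head[of a "(x, d) # u" k A "\<zero>\<^bsub>A\<^esub>" c]
        slot_combination.head[of "\<zero>\<^bsub>A\<^esub>" "(x, d) # u" k A "\<zero>\<^bsub>A\<^esub>" "\<one>\<^bsub>k\<^esub>"]
      by (simp add: pre_pure) (rule multilinear_smult[OF module_A module_Q multilinear_pure], simp_all add: tuples_simps)
  qed (intro linear_maps_smult module_Q pre_linear x c a A.smult_closed)+
qed (use x X in simp)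

lemma pre_type_linear:
  assumes a: "a \<in> carrier A" and X: "X \<in> carrier Q"
  shows "(\<lambda>x. pre a x X) \<in> linear_maps k types Q"
proof (rule linear_mapsI)
  fix x y assume xy: "x \<in> carrier types" "y \<in> carrier types"
  show "pre a (x \<oplus>\<^bsub>types\<^esub> y) X = pre a x X \<oplus>\<^bsub>Q\<^esub> pre a y X"
  proof (rule linear_maps_typed_words_eqI[OF module_Q _ _ _ X])
    fix s :: "('a, 'w, 'k) tuple"
    assume s: "s \<in> tuples k A"
    obtain d u where [simp]: "s = (d, u)" by (cases s)
    show "pre a (x \<oplus>\<^bsub>types\<^esub> y) (pure s) = pre a x (pure s) \<oplus>\<^bsub>Q\<^esub> pre a y (pure s)"
      using s a xy slot_combination.type[of a x d u k A y "\<one>\<^bsub>k\<^esub>"]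
      by (simp add: pre_pure) (rule multilinear_add[OF module_A module_Q multilinear_pure], simp add: tuples_simps)
  qed (intro linear_maps_add module_Q pre_linear a xy types.M.a_closed)+
next
  fix c x assume c: "c \<in> carrier k" and x: "x \<in> carrier types"
  show "pre a (c \<odot>\<^bsub>types\<^esub> x) X = c \<odot>\<^bsub>Q\<^esub> pre a x X"
  proof (rule linear_maps_typed_words_eqI[OF module_Q _ _ _ X])
    fix s :: "('a, 'w, 'k) tuple"
    assume s: "s \<in> tuples k A"
    obtain d u where [simp]: "s = (d, u)" by (cases s)
    show "pre a (c \<odot>\<^bsub>types\<^esub> x) (pure s) = c \<odot>\<^bsub>Q\<^esub> pre a x (pure s)"
      using s c a x slot_combination.type[of a x d u k A "\<zero>\<^bsub>types\<^esub>" c]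
        slot_combination.type[of a "\<zero>\<^bsub>types\<^esub>" d u k A "\<zero>\<^bsub>types\<^esub>" "\<one>\<^bsub>k\<^esub>"]
      by (simp add: pre_pure) (rule multilinear_smult[OF module_A module_Q multilinear_pure], simp_all add: tuples_simps)
  qed (intro linear_maps_smult module_Q pre_linear x c a types.smult_closed)+
qed (use a X in simp)

text \<open>Expands a general type in the basis of k\<Omega>. Through this, typed words with basis
  types span everything.\<close>

lemma pre_eq_lincomb:
  assumes "a \<in> carrier A" "x \<in> carrier types" "X \<in> carrier Q"
  shows "pre a x X = lincomb k Q (\<lambda>\<omega>. pre a (basis_vec k \<omega>) X) x"
proof -
  have b: "basis_vec k \<in> UNIV \<rightarrow> carrier types"
    by (auto intro: basis_vec_closed cring_k)
  show ?thesis
    using linear_map_lincomb[OF module_types module_Q pre_type_linear[OF assms(1,3)] b assms(2)]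
    by (simp add: lincomb_basis[OF cring_k assms(2)])
qed

section \<open>The product of typed words\<close>

abbreviation unit_type :: "'w \<Rightarrow> 'w \<Rightarrow> 'k" (\<open>\<delta>\<close>) where
  "\<delta> \<equiv> basis_vec k"

lemma unit_type_closed [simp]: "\<delta> \<omega> \<in> carrier types"
  by (simp add: basis_vec_closed cring_k)

text \<open>Follows the recursion of \<open>tuple_mult\<close>, each call of which lowers the total
  length. The types in the first two hypotheses are arbitrary, because the recursion replaces the
  leading type by a new one.\<close>

lemma tuple_pair_induct [consumes 2, case_names nil_left nil_right step]:
  assumes "s \<in> tuples k A" "t \<in> tuples k A"
    and nil_left: "\<And>a b v. a \<in> carrier A \<Longrightarrow> (b, v) \<in> tuples k A \<Longrightarrow> P (a, []) (b, v)"
    and nil_right: "\<And>a x a' u b. a \<in> carrier A \<Longrightarrow> x \<in> carrier types \<Longrightarrow> (a', u) \<in> tuples k A \<Longrightarrow>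
      b \<in> carrier A \<Longrightarrow> P (a, (x, a') # u) (b, [])"
    and step: "\<And>a x a' u b y b' v. a \<in> carrier A \<Longrightarrow> x \<in> carrier types \<Longrightarrow> (a', u) \<in> tuples k A \<Longrightarrow>
      b \<in> carrier A \<Longrightarrow> y \<in> carrier types \<Longrightarrow> (b', v) \<in> tuples k A \<Longrightarrow>
      (\<And>z. z \<in> carrier types \<Longrightarrow> P (\<one>\<^bsub>A\<^esub>, (z, a') # u) (b', v)) \<Longrightarrow>
      (\<And>z. z \<in> carrier types \<Longrightarrow> P (a', u) (\<one>\<^bsub>A\<^esub>, (z, b') # v)) \<Longrightarrow>
      P (a', u) (b', v) \<Longrightarrow> P (a, (x, a') # u) (b, (y, b') # v)"
  shows "P s t"
proof -
  have "P (a, u) (b, v)" if "(a, u) \<in> tuples k A" "(b, v) \<in> tuples k A" for a u b v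
    using that
  proof (induction "length u + length v" arbitrary: a u b v rule: less_induct)
    case less
    consider "u = []" | x a' u' where "u = (x, a') # u'" "v = []"
      | x a' u' y b' v' where "u = (x, a') # u'" "v = (y, b') # v'"
      by (metis neq_Nil_conv surj_pair)
    then show ?case
    proof cases
      case 1
      then show ?thesis using less.prems nil_left by (auto simp: tuples_simps)
    next
      case 2
      then show ?thesis using less.prems nil_right by (auto simp: tuples_simps)
    next
      case 3
      have tup: "a \<in> carrier A" "x \<in> carrier types" "(a', u') \<in> tuples k A"
        "b \<in> carrier A" "y \<in> carrier types" "(b', v') \<in> tuples k A"
        using less.prems 3 by (auto simp: tuples_simps)
      show ?thesis
        unfolding 3 by (rule step[OF tup]; rule less.hyps) (use tup in \<open>auto simp: 3 tuples_simps\<close>)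
    qed
  qed
  then show ?thesis
    using assms(1,2) by (cases s; cases t) auto
qed

text \<open>The three-term right side of the recursion, with the inner products kept as independent
  arguments, so that its linearity and symmetry can be treated apart from the recursion.\<close>

definition shuffle_step ::
    "'a \<Rightarrow> 'w \<Rightarrow> 'w \<Rightarrow> (('a, 'w, 'k) tuple \<Rightarrow> 'k) set \<Rightarrow> (('a, 'w, 'k) tuple \<Rightarrow> 'k) set
      \<Rightarrow> (('a, 'w, 'k) tuple \<Rightarrow> 'k) set \<Rightarrow> (('a, 'w, 'k) tuple \<Rightarrow> 'k) set" where
  "shuffle_step a \<alpha> \<beta> X Y Z =
     pre a (\<delta> (\<alpha> \<rightharpoonup> \<beta>)) X \<oplus>\<^bsub>Q\<^esub> pre a (\<delta> (\<alpha> \<leftharpoonup> \<beta>)) Y \<oplus>\<^bsub>Q\<^esub> lam E \<alpha> \<beta> \<odot>\<^bsub>Q\<^esub> pre a (\<delta> (\<alpha> \<cdot> \<beta>)) Z"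

lemma shuffle_step_closed [simp]:
  "a \<in> carrier A \<Longrightarrow> X \<in> carrier Q \<Longrightarrow> Y \<in> carrier Q \<Longrightarrow> Z \<in> carrier Q \<Longrightarrow>
    shuffle_step a \<alpha> \<beta> X Y Z \<in> carrier Q"
  by (simp add: shuffle_step_def lam_closed)

text \<open>Commutativity of the semigroup exchanges the first two terms and fixes the
  third.\<close>

lemma shuffle_step_commute:
  "a \<in> carrier A \<Longrightarrow> X \<in> carrier Q \<Longrightarrow> Y \<in> carrier Q \<Longrightarrow> Z \<in> carrier Q \<Longrightarrow>
    shuffle_step a \<alpha> \<beta> X Y Z = shuffle_step a \<beta> \<alpha> Y X Z"
  unfolding shuffle_step_def
  by (subst commute(1), subst commute(3), subst commute(4), subst commute(1)[symmetric])
    (simp add: lam_closed Q.M.a_comm)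

lemma shuffle_step_head:
  assumes "c \<in> carrier k" "a \<in> carrier A" "b \<in> carrier A"
    "X \<in> carrier Q" "Y \<in> carrier Q" "Z \<in> carrier Q"
  shows "shuffle_step (c \<odot>\<^bsub>A\<^esub> a \<oplus>\<^bsub>A\<^esub> b) \<alpha> \<beta> X Y Z =
    c \<odot>\<^bsub>Q\<^esub> shuffle_step a \<alpha> \<beta> X Y Z \<oplus>\<^bsub>Q\<^esub> shuffle_step b \<alpha> \<beta> X Y Z"
proof -
  have lin: "(\<lambda>a. shuffle_step a \<alpha> \<beta> X Y Z) \<in> linear_maps k A Q"
    unfolding shuffle_step_def
    by (intro linear_maps_add linear_maps_smult module_Q lam_closed pre_head_linear unit_type_closed assms)
  show ?thesis
    using assms by (simp add: linear_mapsD[OF lin])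
qed

lemma shuffle_step_combination:
  assumes "c \<in> carrier k" "a \<in> carrier A" "X \<in> carrier Q" "Y \<in> carrier Q" "Z \<in> carrier Q"
    "X' \<in> carrier Q" "Y' \<in> carrier Q" "Z' \<in> carrier Q"
  shows "shuffle_step a \<alpha> \<beta> (c \<odot>\<^bsub>Q\<^esub> X \<oplus>\<^bsub>Q\<^esub> X') (c \<odot>\<^bsub>Q\<^esub> Y \<oplus>\<^bsub>Q\<^esub> Y') (c \<odot>\<^bsub>Q\<^esub> Z \<oplus>\<^bsub>Q\<^esub> Z') =
    c \<odot>\<^bsub>Q\<^esub> shuffle_step a \<alpha> \<beta> X Y Z \<oplus>\<^bsub>Q\<^esub> shuffle_step a \<alpha> \<beta> X' Y' Z'"
proof -
  have swap: "d \<odot>\<^bsub>Q\<^esub> (c \<odot>\<^bsub>Q\<^esub> V) = c \<odot>\<^bsub>Q\<^esub> (d \<odot>\<^bsub>Q\<^esub> V)" if "d \<in> carrier k" "V \<in> carrier Q" for d V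
    using that assms(1) by (simp add: A.R.m_comm flip: Q.smult_assoc1)
  show ?thesis
    using assms
    by (simp add: shuffle_step_def lam_closed linear_mapsD(2,3)[OF pre_linear] Q.smult_r_distr swap Q.M.a_ac)
qed

text \<open>The class is taken immediately, because \<open>tuple_mult\<close> itself is not
  multilinear: the basis vector it returns for a letter is not additive in that letter.\<close>

definition tuple_prod ::
    "('a, 'w, 'k) tuple \<Rightarrow> ('a, 'w, 'k) tuple \<Rightarrow> (('a, 'w, 'k) tuple \<Rightarrow> 'k) set" where
  "tuple_prod s t = cls (tuple_mult k A E s t)"

lemma cls_bilinear_ext:
  assumes f: "f \<in> carrier (free_module k S)" and g: "g \<in> carrier (free_module k S')"
    and G: "\<And>s t. s \<in> S \<Longrightarrow> t \<in> S' \<Longrightarrow> G s t \<in> carrier M"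
  shows "cls (bilinear_ext k G f g) = lincomb k Q (\<lambda>s. lincomb k Q (\<lambda>t. cls (G s t)) g) f"
proof -
  have Gs: "G s \<in> S' \<rightarrow> carrier M" if "s \<in> S" for s
    using G that by auto
  have cl: "(\<lambda>s. lincomb k M (G s) g) \<in> S \<rightarrow> carrier M"
    using lincomb_closed[OF module_M Gs g] by auto
  have "(\<lambda>t. cls (G s t)) \<in> S' \<rightarrow> carrier Q" if "s \<in> S" for s
    using that G by (auto intro: cls_closed)
  then have cl': "(\<lambda>s. lincomb k Q (\<lambda>t. cls (G s t)) g) \<in> S \<rightarrow> carrier Q"
    using lincomb_closed[OF module_Q _ g] by auto
  have "bilinear_ext k G f g = lincomb k M (\<lambda>s. lincomb k M (G s) g) f"
    by (rule bilinear_ext_eq_lincomb(1)[OF cring_k f g]) (rule G)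
  then have "cls (bilinear_ext k G f g) = lincomb k Q (\<lambda>s. cls (lincomb k M (G s) g)) f"
    using linear_map_lincomb[OF module_M module_Q cls_linear cl f] by simp
  also have "\<dots> = lincomb k Q (\<lambda>s. lincomb k Q (\<lambda>t. cls (G s t)) g) f"
    by (rule lincomb_cong[OF module_Q f cl'])
      (rule linear_map_lincomb[OF module_M module_Q cls_linear Gs g])
  finally show ?thesis .
qed

text \<open>Both conclusions rest on closedness of the three recursive products. It is assumed here,
  so that the first conclusion can serve as an induction step and the second can be used
  afterwards.\<close>

lemma tuple_mult_closed_step:
  assumes "a \<in> carrier A" "x \<in> carrier types" "b \<in> carrier A" "y \<in> carrier types"
    "\<And>\<omega>. tuple_mult k A E (\<one>\<^bsub>A\<^esub>, (\<delta> \<omega>, a') # u) (b', v) \<in> carrier M"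
    "\<And>\<omega>. tuple_mult k A E (a', u) (\<one>\<^bsub>A\<^esub>, (\<delta> \<omega>, b') # v) \<in> carrier M"
    "tuple_mult k A E (a', u) (b', v) \<in> carrier M"
  shows "tuple_mult k A E (a, (x, a') # u) (b, (y, b') # v) \<in> carrier M"
    and "tuple_prod (a, (x, a') # u) (b, (y, b') # v) =
      lincomb k Q (\<lambda>\<alpha>. lincomb k Q (\<lambda>\<beta>. shuffle_step (a \<otimes>\<^bsub>A\<^esub> b) \<alpha> \<beta>
        (tuple_prod (\<one>\<^bsub>A\<^esub>, (\<delta> (\<alpha> \<triangleright> \<beta>), a') # u) (b', v))
        (tuple_prod (a', u) (\<one>\<^bsub>A\<^esub>, (\<delta> (\<alpha> \<triangleleft> \<beta>), b') # v))
        (tuple_prod (a', u) (b', v))) y) x"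
proof -
  let ?G = "\<lambda>\<alpha> \<beta>. prefix k (a \<otimes>\<^bsub>A\<^esub> b) (\<delta> (\<alpha> \<rightharpoonup> \<beta>)) (tuple_mult k A E (\<one>\<^bsub>A\<^esub>, (\<delta> (\<alpha> \<triangleright> \<beta>), a') # u) (b', v))
    \<oplus>\<^bsub>M\<^esub> prefix k (a \<otimes>\<^bsub>A\<^esub> b) (\<delta> (\<alpha> \<leftharpoonup> \<beta>)) (tuple_mult k A E (a', u) (\<one>\<^bsub>A\<^esub>, (\<delta> (\<alpha> \<triangleleft> \<beta>), b') # v))
    \<oplus>\<^bsub>M\<^esub> lam E \<alpha> \<beta> \<odot>\<^bsub>M\<^esub> prefix k (a \<otimes>\<^bsub>A\<^esub> b) (\<delta> (\<alpha> \<cdot> \<beta>)) (tuple_mult k A E (a', u) (b', v))"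
  have d: "a \<otimes>\<^bsub>A\<^esub> b \<in> carrier A"
    using assms by simp
  note p = prefix_closed_cls[OF d unit_type_closed]
  have G: "?G \<alpha> \<beta> \<in> carrier M" for \<alpha> \<beta>
    by (intro M.M.a_closed M.smult_closed lam_closed p(1) assms)
  have cls_G: "cls (?G \<alpha> \<beta>) = shuffle_step (a \<otimes>\<^bsub>A\<^esub> b) \<alpha> \<beta>
        (tuple_prod (\<one>\<^bsub>A\<^esub>, (\<delta> (\<alpha> \<triangleright> \<beta>), a') # u) (b', v))
        (tuple_prod (a', u) (\<one>\<^bsub>A\<^esub>, (\<delta> (\<alpha> \<triangleleft> \<beta>), b') # v))
        (tuple_prod (a', u) (b', v))" for \<alpha> \<beta>
    by (simp add: cls_add cls_smult lam_closed p assms(5-) shuffle_step_def tuple_prod_def)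
  have eq: "tuple_mult k A E (a, (x, a') # u) (b, (y, b') # v) = bilinear_ext k ?G x y"
    by simp
  show "tuple_mult k A E (a, (x, a') # u) (b, (y, b') # v) \<in> carrier M"
    unfolding eq by (rule bilinear_ext_eq_lincomb(2)[OF cring_k assms(2,4) G])
  show "tuple_prod (a, (x, a') # u) (b, (y, b') # v) =
      lincomb k Q (\<lambda>\<alpha>. lincomb k Q (\<lambda>\<beta>. shuffle_step (a \<otimes>\<^bsub>A\<^esub> b) \<alpha> \<beta>
        (tuple_prod (\<one>\<^bsub>A\<^esub>, (\<delta> (\<alpha> \<triangleright> \<beta>), a') # u) (b', v))
        (tuple_prod (a', u) (\<one>\<^bsub>A\<^esub>, (\<delta> (\<alpha> \<triangleleft> \<beta>), b') # v))
        (tuple_prod (a', u) (b', v))) y) x"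
    unfolding tuple_prod_def[of "(a, (x, a') # u)"] eq cls_bilinear_ext[OF assms(2,4) G] cls_G ..
qed

lemma tuple_mult_closed:
  assumes "s \<in> tuples k A" "t \<in> tuples k A"
  shows "tuple_mult k A E s t \<in> carrier M"
  using assms
proof (induction rule: tuple_pair_induct)
  case (nil_left a b v)
  then show ?case
    by (auto intro!: basis_vec_closed cring_k intro: tuples_head tuples_change_head)
next
  case (nil_right a x a' u b)
  then show ?case
    by (auto intro!: basis_vec_closed cring_k simp: tuples_simps)
next
  case (step a x a' u b y b' v)
  then show ?case
    by (intro tuple_mult_closed_step(1)) auto
qed

lemma tuple_prod_closed [simp]: "s \<in> tuples k A \<Longrightarrow> t \<in> tuples k A \<Longrightarrow> tuple_prod s t \<in> carrier Q"
  unfolding tuple_prod_def by (intro cls_closed tuple_mult_closed)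

lemma tuple_prod_nil:
  assumes "a \<in> carrier A" "(b, v) \<in> tuples k A"
  shows "tuple_prod (a, []) (b, v) = pure (a \<otimes>\<^bsub>A\<^esub> b, v)"
    and "tuple_prod (b, v) (a, []) = pure (a \<otimes>\<^bsub>A\<^esub> b, v)"
  using assms by (simp_all add: tuple_prod_def pure_def, cases v) (auto simp: A.m_comm dest: tuples_head)

lemma tuple_prod_step:
  assumes "a \<in> carrier A" "x \<in> carrier types" "b \<in> carrier A" "y \<in> carrier types"
    "(a', u) \<in> tuples k A" "(b', v) \<in> tuples k A"
  shows "tuple_prod (a, (x, a') # u) (b, (y, b') # v) =
      lincomb k Q (\<lambda>\<alpha>. lincomb k Q (\<lambda>\<beta>. shuffle_step (a \<otimes>\<^bsub>A\<^esub> b) \<alpha> \<beta>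
        (tuple_prod (\<one>\<^bsub>A\<^esub>, (\<delta> (\<alpha> \<triangleright> \<beta>), a') # u) (b', v))
        (tuple_prod (a', u) (\<one>\<^bsub>A\<^esub>, (\<delta> (\<alpha> \<triangleleft> \<beta>), b') # v))
        (tuple_prod (a', u) (b', v))) y) x"
  using assms by (intro tuple_mult_closed_step(2) tuple_mult_closed) (simp_all add: tuples_simps)

lemma tuple_prod_commute:
  assumes "s \<in> tuples k A" "t \<in> tuples k A"
  shows "tuple_prod s t = tuple_prod t s"
  using assms
proof (induction rule: tuple_pair_induct)
  case (nil_left a b v)
  then show ?case by (simp add: tuple_prod_nil)
next
  case (nil_right a x a' u b)
  then show ?case by (simp add: tuple_prod_nil tuples_simps)
next
  case (step a x a' u b y b' v)
  let ?X = "\<lambda>\<alpha> \<beta>. tuple_prod (\<one>\<^bsub>A\<^esub>, (\<delta> (\<alpha> \<triangleright> \<beta>), a') # u) (b', v)"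
  let ?Y = "\<lambda>\<alpha> \<beta>. tuple_prod (a', u) (\<one>\<^bsub>A\<^esub>, (\<delta> (\<alpha> \<triangleleft> \<beta>), b') # v)"
  let ?Z = "tuple_prod (a', u) (b', v)"
  \<comment> \<open>Exchanging the words exchanges \<triangleright> and \<triangleleft>, so the
    hypotheses identify the first recursive product of one side with the second of the
    other.\<close>
  have flip: "shuffle_step (b \<otimes>\<^bsub>A\<^esub> a) \<beta> \<alpha>
        (tuple_prod (\<one>\<^bsub>A\<^esub>, (\<delta> (\<beta> \<triangleright> \<alpha>), b') # v) (a', u))
        (tuple_prod (b', v) (\<one>\<^bsub>A\<^esub>, (\<delta> (\<beta> \<triangleleft> \<alpha>), a') # u))
        (tuple_prod (b', v) (a', u)) = shuffle_step (a \<otimes>\<^bsub>A\<^esub> b) \<alpha> \<beta> (?X \<alpha> \<beta>) (?Y \<alpha> \<beta>) ?Z" for \<alpha> \<beta>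
    using step
    by (subst shuffle_step_commute)
      (simp_all add: tuples_simps A.m_comm[of b a] flip: commute(2)[of \<alpha> \<beta>], simp add: commute(2)[of \<beta> \<alpha>])
  show ?case
    unfolding tuple_prod_step[OF step(1,2,4,5,3,6)] tuple_prod_step[OF step(4,5,1,2,6,3)] flip
    \<comment> \<open>The sums over \<alpha> and \<beta> are nested in opposite order on the two
      sides.\<close>
    by (rule lincomb_swap[OF module_Q step(2,5)]) (use step in \<open>simp add: tuples_simps\<close>)
qed

text \<open>A slot of the left word is its head, its first type, or lies behind both. The head
  enters every term through the product of heads, the first type only as coefficient vector of the
  outer sum, and a deeper slot passes to the recursive products.\<close>

lemma tuple_prod_combination:
  assumes "s \<in> tuples k A" "t \<in> tuples k A" "c \<in> carrier k" "slot_combination k A c s s\<^sub>1 s\<^sub>2"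
  shows "tuple_prod s t = c \<odot>\<^bsub>Q\<^esub> tuple_prod s\<^sub>1 t \<oplus>\<^bsub>Q\<^esub> tuple_prod s\<^sub>2 t"
  using assms
proof (induction arbitrary: s\<^sub>1 s\<^sub>2 rule: tuple_pair_induct)
  case (nil_left a b v)
  from nil_left.prems(2) obtain a1 a2 where
    a: "a = c \<odot>\<^bsub>A\<^esub> a1 \<oplus>\<^bsub>A\<^esub> a2" "s\<^sub>1 = (a1, [])" "s\<^sub>2 = (a2, [])" "a1 \<in> carrier A" "a2 \<in> carrier A"
    by cases (auto simp: tuples_simps)
  have b: "b \<in> carrier A"
    using nil_left.hyps(2) by (rule tuples_head)
  have "slot_combination k A c (c \<odot>\<^bsub>A\<^esub> (a1 \<otimes>\<^bsub>A\<^esub> b) \<oplus>\<^bsub>A\<^esub> a2 \<otimes>\<^bsub>A\<^esub> b, v) (a1 \<otimes>\<^bsub>A\<^esub> b, v) (a2 \<otimes>\<^bsub>A\<^esub> b, v)"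
    using nil_left.hyps(2) a b by (intro slot_combination.head) (auto intro: tuples_change_head)
  then have "slot_combination k A c (a \<otimes>\<^bsub>A\<^esub> b, v) (a1 \<otimes>\<^bsub>A\<^esub> b, v) (a2 \<otimes>\<^bsub>A\<^esub> b, v)"
    using a b nil_left.prems(1) by (simp add: A.l_distr A.smult_assoc2)
  from multilinearD[OF multilinear_pure nil_left.prems(1) this] show ?case
    using nil_left a by (simp add: tuple_prod_nil)
next
  case (nil_right a x a' u b)
  obtain a1 u1 a2 u2 where s12: "s\<^sub>1 = (a1, u1)" "s\<^sub>2 = (a2, u2)"
    by (cases s\<^sub>1; cases s\<^sub>2)
  have tup: "(a, (x, a') # u) \<in> tuples k A" "(a1, u1) \<in> tuples k A" "(a2, u2) \<in> tuples k A"
    using slot_combination_tuples[OF module_A nil_right.prems] by (auto simp: s12)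
  have "slot_combination k A c (b \<otimes>\<^bsub>A\<^esub> a, (x, a') # u) (b \<otimes>\<^bsub>A\<^esub> a1, u1) (b \<otimes>\<^bsub>A\<^esub> a2, u2)"
    using nil_right.prems(2)
  proof cases
    case (head d e)
    then have "slot_combination k A c (c \<odot>\<^bsub>A\<^esub> (b \<otimes>\<^bsub>A\<^esub> d) \<oplus>\<^bsub>A\<^esub> b \<otimes>\<^bsub>A\<^esub> e, (x, a') # u)
        (b \<otimes>\<^bsub>A\<^esub> d, (x, a') # u) (b \<otimes>\<^bsub>A\<^esub> e, (x, a') # u)"
      using nil_right.hyps by (intro slot_combination.head) (auto simp: tuples_simps)
    moreover have "b \<otimes>\<^bsub>A\<^esub> (c \<odot>\<^bsub>A\<^esub> d) = c \<odot>\<^bsub>A\<^esub> (b \<otimes>\<^bsub>A\<^esub> d)"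
      using nil_right.hyps head nil_right.prems(1)
      by (metis A.m_comm A.smult_assoc2 A.smult_closed tuples_head)
    ultimately show ?thesis
      using head nil_right.prems(1) nil_right.hyps by (simp add: s12 A.r_distr tuples_simps)
  next
    case (type e y)
    then show ?thesis
      using nil_right.hyps by (auto simp: s12 tuples_simps intro!: slot_combination.type)
  next
    case (tail e\<^sub>1 v\<^sub>1 e\<^sub>2 v\<^sub>2)
    then show ?thesis
      using nil_right.hyps by (auto simp: s12 intro!: slot_combination.tail)
  qed
  from multilinearD[OF multilinear_pure nil_right.prems(1) this] show ?case
    using tup nil_right.hyps(4) unfolding s12 by (simp add: tuple_prod_nil(2))
next
  case (step a x a' u b y b' v)
  note tup = step.hyps(1-6) and c = step.prems(1)
  let ?S = "\<lambda>a a' u \<alpha> \<beta>. shuffle_step (a \<otimes>\<^bsub>A\<^esub> b) \<alpha> \<beta>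
    (tuple_prod (\<one>\<^bsub>A\<^esub>, (\<delta> (\<alpha> \<triangleright> \<beta>), a') # u) (b', v))
    (tuple_prod (a', u) (\<one>\<^bsub>A\<^esub>, (\<delta> (\<alpha> \<triangleleft> \<beta>), b') # v)) (tuple_prod (a', u) (b', v))"
  have S_closed: "?S a a' u \<alpha> \<beta> \<in> carrier Q" if "a \<in> carrier A" "(a', u) \<in> tuples k A" for a a' u \<alpha> \<beta>
    using that tup by (simp add: tuples_simps)
  then have S_sum: "(\<lambda>\<alpha>. lincomb k Q (?S a a' u \<alpha>) y) \<in> UNIV \<rightarrow> carrier Q"
    if "a \<in> carrier A" "(a', u) \<in> tuples k A" for a a' u
    using that tup by (auto intro!: lincomb_closed[OF module_Q _ tup(5)])
  note prod_step = tuple_prod_step[OF _ _ tup(4,5) _ tup(6)]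
  have combine: "lincomb k Q (\<lambda>\<alpha>. lincomb k Q (?S d d' w \<alpha>) y) x =
      c \<odot>\<^bsub>Q\<^esub> lincomb k Q (\<lambda>\<alpha>. lincomb k Q (?S d\<^sub>1 d\<^sub>1' w\<^sub>1 \<alpha>) y) x \<oplus>\<^bsub>Q\<^esub>
      lincomb k Q (\<lambda>\<alpha>. lincomb k Q (?S d\<^sub>2 d\<^sub>2' w\<^sub>2 \<alpha>) y) x"
    if "\<And>\<alpha> \<beta>. ?S d d' w \<alpha> \<beta> = c \<odot>\<^bsub>Q\<^esub> ?S d\<^sub>1 d\<^sub>1' w\<^sub>1 \<alpha> \<beta> \<oplus>\<^bsub>Q\<^esub> ?S d\<^sub>2 d\<^sub>2' w\<^sub>2 \<alpha> \<beta>"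
      "d\<^sub>1 \<in> carrier A" "(d\<^sub>1', w\<^sub>1) \<in> tuples k A" "d\<^sub>2 \<in> carrier A" "(d\<^sub>2', w\<^sub>2) \<in> tuples k A"
    for d d' w d\<^sub>1 d\<^sub>1' w\<^sub>1 d\<^sub>2 d\<^sub>2' w\<^sub>2
    by (rule lincomb_combination[OF module_Q c tup(2) S_sum S_sum],
        (fact that)+, rule lincomb_combination[OF module_Q c tup(5)])
      (use that S_closed in \<open>auto\<close>)
  from step.prems(2) show ?case
  proof cases
    case (head d e)
    then have d: "d \<in> carrier A" "e \<in> carrier A"
      by (auto simp: tuples_simps)
    have "a \<otimes>\<^bsub>A\<^esub> b = c \<odot>\<^bsub>A\<^esub> (d \<otimes>\<^bsub>A\<^esub> b) \<oplus>\<^bsub>A\<^esub> e \<otimes>\<^bsub>A\<^esub> b"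
      using d c tup(4) head by (simp add: A.l_distr A.smult_assoc2)
    then have "?S a a' u \<alpha> \<beta> = c \<odot>\<^bsub>Q\<^esub> ?S d a' u \<alpha> \<beta> \<oplus>\<^bsub>Q\<^esub> ?S e a' u \<alpha> \<beta>" for \<alpha> \<beta>
      using d c tup by (simp add: shuffle_step_head tuples_simps)
    then show ?thesis
      using combine[of a a' u d a' u e a' u] d tup by (simp add: head prod_step)
  next
    case (type e z)
    have z: "e \<in> carrier types" "z \<in> carrier types"
      using type tup by (auto simp: tuples_simps)
    \<comment> \<open>The values of the outer sum involve the binder \<alpha> but not the first
      type, so linearity in the coefficient vector is enough.\<close>
    note lin = lincomb_linear[OF module_Q S_sum[OF tup(1,3)]]
    show ?thesis
      using z c tup by (simp add: type prod_step linear_mapsD[OF lin])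
  next
    case (tail b\<^sub>1 u\<^sub>1 b\<^sub>2 u\<^sub>2)
    note tup' = slot_combination_tuples[OF module_A c tail(5)]
    \<comment> \<open>The first recursive product keeps the tail of the left word behind a fresh
      head and type; the combination moves there before the hypothesis applies.\<close>
    have ext: "slot_combination k A c (\<one>\<^bsub>A\<^esub>, (z, a') # u) (\<one>\<^bsub>A\<^esub>, (z, b\<^sub>1) # u\<^sub>1) (\<one>\<^bsub>A\<^esub>, (z, b\<^sub>2) # u\<^sub>2)"
      if "z \<in> carrier types" for z
      using tail that by (intro slot_combination.tail) simp_all
    have "?S a a' u \<alpha> \<beta> = c \<odot>\<^bsub>Q\<^esub> ?S a b\<^sub>1 u\<^sub>1 \<alpha> \<beta> \<oplus>\<^bsub>Q\<^esub> ?S a b\<^sub>2 u\<^sub>2 \<alpha> \<beta>" for \<alpha> \<beta>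
      using tup tup' c
      by (simp add: step.IH(1)[OF unit_type_closed c ext[OF unit_type_closed]]
          step.IH(2)[OF unit_type_closed c tail(5)] step.IH(3)[OF c tail(5)]
          shuffle_step_combination tuples_simps)
    then show ?thesis
      using combine[of a a' u a b\<^sub>1 u\<^sub>1 a b\<^sub>2 u\<^sub>2] tup tup' by (simp add: tail prod_step)
  qed
qed

section \<open>Descent of the product to classes\<close>

lemma multilinear_tuple_prod:
  assumes t: "t \<in> tuples k A"
  shows "multilinear k A Q (\<lambda>s. tuple_prod s t)" "multilinear k A Q (tuple_prod t)"
proof -
  show *: "multilinear k A Q (\<lambda>s. tuple_prod s t)"
    unfolding multilinear_def
  proof (intro conjI allI impI)
    fix c and s s\<^sub>1 s\<^sub>2 :: "('a, 'w, 'k) tuple"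
    assume c: "c \<in> carrier k" and s: "slot_combination k A c s s\<^sub>1 s\<^sub>2"
    then have "s \<in> tuples k A"
      using slot_combination_tuples[OF module_A c s] by simp
    then show "tuple_prod s t = c \<odot>\<^bsub>Q\<^esub> tuple_prod s\<^sub>1 t \<oplus>\<^bsub>Q\<^esub> tuple_prod s\<^sub>2 t"
      by (rule tuple_prod_combination[OF _ t c s])
  qed (use t in auto)
  show "multilinear k A Q (tuple_prod t)"
    unfolding multilinear_def
  proof (intro conjI allI impI)
    fix c and s s\<^sub>1 s\<^sub>2 :: "('a, 'w, 'k) tuple"
    assume c: "c \<in> carrier k" and s: "slot_combination k A c s s\<^sub>1 s\<^sub>2"
    show "tuple_prod t s = c \<odot>\<^bsub>Q\<^esub> tuple_prod t s\<^sub>1 \<oplus>\<^bsub>Q\<^esub> tuple_prod t s\<^sub>2"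
      using multilinearD[OF * c s] slot_combination_tuples[OF module_A c s]
      by (simp add: tuple_prod_commute[OF t])
  qed (use t in auto)
qed

text \<open>In the first form \<open>g\<close> enters only through its class, in the second form
  \<open>f\<close> does. Together they give independence of both representatives.\<close>

lemma cls_tuple_mult_ext:
  assumes f: "f \<in> carrier M" and g: "g \<in> carrier M"
  shows "cls (bilinear_ext k (tuple_mult k A E) f g) = lincomb k Q (\<lambda>s. lift Q (tuple_prod s) (cls g)) f"
    and "cls (bilinear_ext k (tuple_mult k A E) f g) = lincomb k Q (\<lambda>t. lift Q (\<lambda>s. tuple_prod s t) (cls f)) g"
proof -
  have "cls (bilinear_ext k (tuple_mult k A E) f g) = lincomb k Q (\<lambda>s. lincomb k Q (tuple_prod s) g) f"
    unfolding tuple_prod_def by (rule cls_bilinear_ext[OF f g]) (rule tuple_mult_closed)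
  also have "\<dots> = lincomb k Q (\<lambda>s. lift Q (tuple_prod s) (cls g)) f"
    by (rule lincomb_cong[OF module_Q f])
      (auto simp: lift_cls[OF module_Q multilinear_tuple_prod(2) g] g
        intro!: linear_mapsD(1)[OF lift_linear[OF module_Q multilinear_tuple_prod(2)]] cls_closed)
  finally show *: "cls (bilinear_ext k (tuple_mult k A E) f g) = \<dots>" .
  have "cls (bilinear_ext k (tuple_mult k A E) f g) = lincomb k Q (\<lambda>s. lincomb k Q (tuple_prod s) g) f"
    unfolding tuple_prod_def by (rule cls_bilinear_ext[OF f g]) (rule tuple_mult_closed)
  also have "\<dots> = lincomb k Q (\<lambda>t. lincomb k Q (\<lambda>s. tuple_prod s t) f) g"
    by (rule lincomb_swap[OF module_Q f g]) simp
  also have "\<dots> = lincomb k Q (\<lambda>t. lift Q (\<lambda>s. tuple_prod s t) (cls f)) g"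
    by (rule lincomb_cong[OF module_Q g])
      (auto simp: lift_cls[OF module_Q multilinear_tuple_prod(1) f] f
        intro!: linear_mapsD(1)[OF lift_linear[OF module_Q multilinear_tuple_prod(1)]] cls_closed)
  finally show "cls (bilinear_ext k (tuple_mult k A E) f g) = \<dots>" .
qed

lemma mult_cls:
  assumes f: "f \<in> carrier M" and g: "g \<in> carrier M"
  shows "cls f \<otimes>\<^bsub>Q\<^esub> cls g = cls (bilinear_ext k (tuple_mult k A E) f g)"
proof -
  \<comment> \<open>One representative changes at a time: \<open>g'\<close> to \<open>g\<close> by
    the first form, then \<open>f'\<close> to \<open>f\<close> by the second.\<close>
  have "cls (bilinear_ext k (tuple_mult k A E) f' g') = cls (bilinear_ext k (tuple_mult k A E) f g)"
    if "f' \<in> cls f" "g' \<in> cls g" for f' g'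
    using cls_tuple_mult_ext(1)[of f' g'] cls_tuple_mult_ext(1)[of f' g]
      cls_tuple_mult_ext(2)[of f' g] cls_tuple_mult_ext(2)[of f g]
      in_clsD(1,2)[OF that(1) f] in_clsD(1,2)[OF that(2) g] f g by simp
  then show ?thesis
    unfolding typed_words_simps using cls_self[OF f] cls_self[OF g] by blast
qed

lemma mult_closed [simp]:
  assumes "X \<in> carrier Q" "Y \<in> carrier Q"
  shows "X \<otimes>\<^bsub>Q\<^esub> Y \<in> carrier Q"
proof -
  obtain f g where f: "f \<in> carrier M" "X = cls f" and g: "g \<in> carrier M" "Y = cls g"
    using assms by (metis cls_cases)
  have "bilinear_ext k (tuple_mult k A E) f g \<in> carrier M"
    by (rule bilinear_ext_eq_lincomb(2)[OF cring_k f(1) g(1)]) (rule tuple_mult_closed)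
  then show ?thesis
    using f g by (simp add: mult_cls cls_closed)
qed

lemma mult_linear_left:
  assumes Y: "Y \<in> carrier Q"
  shows "(\<lambda>X. X \<otimes>\<^bsub>Q\<^esub> Y) \<in> linear_maps k Q Q"
proof -
  obtain g where g: "g \<in> carrier M" "Y = cls g"
    using Y by (rule cls_cases)
  have "(\<lambda>s. lift Q (tuple_prod s) Y) \<in> tuples k A \<rightarrow> carrier Q"
    using Y by (auto intro: linear_mapsD(1)[OF lift_linear[OF module_Q multilinear_tuple_prod(2)]])
  note lin = linear_mapsD[OF lincomb_linear[OF module_Q this]]
  have eq: "cls f \<otimes>\<^bsub>Q\<^esub> Y = lincomb k Q (\<lambda>s. lift Q (tuple_prod s) Y) f" if "f \<in> carrier M" for f
    using mult_cls[OF that g(1)] cls_tuple_mult_ext(1)[OF that g(1)] by (simp add: g(2))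
  show ?thesis
  proof (rule linear_mapsI)
    show "X \<otimes>\<^bsub>Q\<^esub> Y \<in> carrier Q" if "X \<in> carrier Q" for X
      using that Y by simp
  qed (auto elim!: cls_cases simp: eq lin simp flip: cls_add cls_smult)
qed

lemma mult_linear_right:
  assumes X: "X \<in> carrier Q"
  shows "(\<lambda>Y. X \<otimes>\<^bsub>Q\<^esub> Y) \<in> linear_maps k Q Q"
proof -
  obtain f where f: "f \<in> carrier M" "X = cls f"
    using X by (rule cls_cases)
  have "(\<lambda>t. lift Q (\<lambda>s. tuple_prod s t) X) \<in> tuples k A \<rightarrow> carrier Q"
    using X by (auto intro: linear_mapsD(1)[OF lift_linear[OF module_Q multilinear_tuple_prod(1)]])
  note lin = linear_mapsD[OF lincomb_linear[OF module_Q this]]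
  have eq: "X \<otimes>\<^bsub>Q\<^esub> cls g = lincomb k Q (\<lambda>t. lift Q (\<lambda>s. tuple_prod s t) X) g" if "g \<in> carrier M" for g
    using mult_cls[OF f(1) that] cls_tuple_mult_ext(2)[OF f(1) that] by (simp add: f(2))
  show ?thesis
  proof (rule linear_mapsI)
    show "X \<otimes>\<^bsub>Q\<^esub> Y \<in> carrier Q" if "Y \<in> carrier Q" for Y
      using that X by simp
  qed (auto elim!: cls_cases simp: eq lin simp flip: cls_add cls_smult)
qed

lemma mult_pure:
  assumes s: "s \<in> tuples k A" and t: "t \<in> tuples k A"
  shows "pure s \<otimes>\<^bsub>Q\<^esub> pure t = tuple_prod s t"
proof -
  have "(\<lambda>s. lift Q (tuple_prod s) (pure t)) \<in> tuples k A \<rightarrow> carrier Q"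
    using t by (auto intro: linear_mapsD(1)[OF lift_linear[OF module_Q multilinear_tuple_prod(2)]])
  then have "pure s \<otimes>\<^bsub>Q\<^esub> pure t = lift Q (tuple_prod s) (pure t)"
    unfolding pure_def using s t
    by (simp add: mult_cls cls_tuple_mult_ext(1) basis_vec_closed cring_k lincomb_basis_vec[OF module_Q])
  then show ?thesis
    using s t by (simp add: lift_pure[OF module_Q multilinear_tuple_prod(2)])
qed

lemma linear_maps_typed_words_eqI2:
  assumes N: "module k N"
    and h: "\<And>Y. Y \<in> carrier Q \<Longrightarrow> (\<lambda>X. h X Y) \<in> linear_maps k Q N"
      "\<And>X. X \<in> carrier Q \<Longrightarrow> h X \<in> linear_maps k Q N"
    and h': "\<And>Y. Y \<in> carrier Q \<Longrightarrow> (\<lambda>X. h' X Y) \<in> linear_maps k Q N"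
      "\<And>X. X \<in> carrier Q \<Longrightarrow> h' X \<in> linear_maps k Q N"
    and eq: "\<And>s t. s \<in> tuples k A \<Longrightarrow> t \<in> tuples k A \<Longrightarrow> h (pure s) (pure t) = h' (pure s) (pure t)"
    and X: "X \<in> carrier Q" and Y: "Y \<in> carrier Q"
  shows "h X Y = h' X Y"
proof (rule linear_maps_typed_words_eqI[OF N h(1)[OF Y] h'(1)[OF Y] _ X])
  show "h (pure s) Y = h' (pure s) Y" if s: "s \<in> tuples k A" for s
    by (rule linear_maps_typed_words_eqI[OF N h(2) h'(2) _ Y]) (use s eq in auto)
qed

lemma mult_commute:
  assumes "X \<in> carrier Q" "Y \<in> carrier Q"
  shows "X \<otimes>\<^bsub>Q\<^esub> Y = Y \<otimes>\<^bsub>Q\<^esub> X"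
  by (rule linear_maps_typed_words_eqI2[OF module_Q _ _ _ _ _ assms, where h = "\<lambda>X Y. X \<otimes>\<^bsub>Q\<^esub> Y"])
    (simp_all add: mult_linear_left mult_linear_right mult_pure tuple_prod_commute)

text \<open>For basis types the double sum of the recursion collapses to a single term, and
  bilinearity extends the resulting identity from pure tensors to all classes.\<close>

lemma mult_pre_pre:
  assumes ab: "a \<in> carrier A" "b \<in> carrier A" and XY: "X \<in> carrier Q" "Y \<in> carrier Q"
  shows "pre a (\<delta> \<alpha>) X \<otimes>\<^bsub>Q\<^esub> pre b (\<delta> \<beta>) Y =
    shuffle_step (a \<otimes>\<^bsub>A\<^esub> b) \<alpha> \<beta> (pre \<one>\<^bsub>A\<^esub> (\<delta> (\<alpha> \<triangleright> \<beta>)) X \<otimes>\<^bsub>Q\<^esub> Y) (X \<otimes>\<^bsub>Q\<^esub> pre \<one>\<^bsub>A\<^esub> (\<delta> (\<alpha> \<triangleleft> \<beta>)) Y) (X \<otimes>\<^bsub>Q\<^esub> Y)"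
proof (rule linear_maps_typed_words_eqI2[OF module_Q _ _ _ _ _ XY,
      where h = "\<lambda>X Y. pre a (\<delta> \<alpha>) X \<otimes>\<^bsub>Q\<^esub> pre b (\<delta> \<beta>) Y"])
  have one: "\<one>\<^bsub>A\<^esub> \<in> carrier A" and d: "a \<otimes>\<^bsub>A\<^esub> b \<in> carrier A"
    using ab by simp_all
  note intros = linear_maps_add linear_maps_smult module_Q lam_closed
    linear_maps_comp[OF pre_linear[OF ab(1) unit_type_closed] mult_linear_left]
    linear_maps_comp[OF pre_linear[OF ab(2) unit_type_closed] mult_linear_right]
    linear_maps_comp[OF _ pre_linear[OF d unit_type_closed]]
    linear_maps_comp[OF pre_linear[OF one unit_type_closed] mult_linear_left]
    linear_maps_comp[OF pre_linear[OF one unit_type_closed] mult_linear_right]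
    mult_linear_left mult_linear_right pre_closed unit_type_closed ab one
  show "(\<lambda>X. pre a (\<delta> \<alpha>) X \<otimes>\<^bsub>Q\<^esub> pre b (\<delta> \<beta>) Y) \<in> linear_maps k Q Q" if "Y \<in> carrier Q" for Y
    by (intro intros that)
  show "(\<lambda>Y. pre a (\<delta> \<alpha>) X \<otimes>\<^bsub>Q\<^esub> pre b (\<delta> \<beta>) Y) \<in> linear_maps k Q Q" if "X \<in> carrier Q" for X
    by (intro intros that)
  show "(\<lambda>X. shuffle_step (a \<otimes>\<^bsub>A\<^esub> b) \<alpha> \<beta> (pre \<one>\<^bsub>A\<^esub> (\<delta> (\<alpha> \<triangleright> \<beta>)) X \<otimes>\<^bsub>Q\<^esub> Y)
      (X \<otimes>\<^bsub>Q\<^esub> pre \<one>\<^bsub>A\<^esub> (\<delta> (\<alpha> \<triangleleft> \<beta>)) Y) (X \<otimes>\<^bsub>Q\<^esub> Y)) \<in> linear_maps k Q Q" if "Y \<in> carrier Q" for Y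
    unfolding shuffle_step_def by (intro intros that)
  show "(\<lambda>Y. shuffle_step (a \<otimes>\<^bsub>A\<^esub> b) \<alpha> \<beta> (pre \<one>\<^bsub>A\<^esub> (\<delta> (\<alpha> \<triangleright> \<beta>)) X \<otimes>\<^bsub>Q\<^esub> Y)
      (X \<otimes>\<^bsub>Q\<^esub> pre \<one>\<^bsub>A\<^esub> (\<delta> (\<alpha> \<triangleleft> \<beta>)) Y) (X \<otimes>\<^bsub>Q\<^esub> Y)) \<in> linear_maps k Q Q" if "X \<in> carrier Q" for X
    unfolding shuffle_step_def by (intro intros that)
  fix s t :: "('a, 'w, 'k) tuple"
  assume s: "s \<in> tuples k A" and t: "t \<in> tuples k A"
  obtain a' u b' v where [simp]: "s = (a', u)" "t = (b', v)"
    by (cases s; cases t)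
  let ?S = "\<lambda>\<alpha> \<beta>. shuffle_step (a \<otimes>\<^bsub>A\<^esub> b) \<alpha> \<beta>
        (tuple_prod (\<one>\<^bsub>A\<^esub>, (\<delta> (\<alpha> \<triangleright> \<beta>), a') # u) (b', v))
        (tuple_prod (a', u) (\<one>\<^bsub>A\<^esub>, (\<delta> (\<alpha> \<triangleleft> \<beta>), b') # v))
        (tuple_prod (a', u) (b', v))"
  have S: "?S \<alpha> \<in> UNIV \<rightarrow> carrier Q" for \<alpha>
    using s t ab by (simp add: tuples_simps)
  have S': "(\<lambda>\<alpha>. ?S \<alpha> \<beta>) \<in> UNIV \<rightarrow> carrier Q" for \<beta>
    using S by auto
  show "pre a (\<delta> \<alpha>) (pure s) \<otimes>\<^bsub>Q\<^esub> pre b (\<delta> \<beta>) (pure t) =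
    shuffle_step (a \<otimes>\<^bsub>A\<^esub> b) \<alpha> \<beta> (pre \<one>\<^bsub>A\<^esub> (\<delta> (\<alpha> \<triangleright> \<beta>)) (pure s) \<otimes>\<^bsub>Q\<^esub> pure t)
      (pure s \<otimes>\<^bsub>Q\<^esub> pre \<one>\<^bsub>A\<^esub> (\<delta> (\<alpha> \<triangleleft> \<beta>)) (pure t)) (pure s \<otimes>\<^bsub>Q\<^esub> pure t)"
    using s t ab
    by (simp add: pre_pure mult_pure tuples_simps tuple_prod_step lincomb_basis_vec[OF module_Q S]
        lincomb_basis_vec[OF module_Q S'])
qed

lemma mult_letter_pre:
  assumes "a \<in> carrier A" "b \<in> carrier A" "x \<in> carrier types" "X \<in> carrier Q"
  shows "pure (a, []) \<otimes>\<^bsub>Q\<^esub> pre b x X = pre (a \<otimes>\<^bsub>A\<^esub> b) x X"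
proof (rule linear_maps_typed_words_eqI[OF module_Q _ _ _ assms(4)])
  show "(\<lambda>X. pure (a, []) \<otimes>\<^bsub>Q\<^esub> pre b x X) \<in> linear_maps k Q Q"
    by (rule linear_maps_comp[OF pre_linear mult_linear_right]) (use assms in \<open>auto simp: tuples_simps\<close>)
  show "pre (a \<otimes>\<^bsub>A\<^esub> b) x \<in> linear_maps k Q Q"
    using assms by (simp add: pre_linear)
  fix s :: "('a, 'w, 'k) tuple"
  assume "s \<in> tuples k A"
  then show "pure (a, []) \<otimes>\<^bsub>Q\<^esub> pre b x (pure s) = pre (a \<otimes>\<^bsub>A\<^esub> b) x (pure s)"
    using assms by (cases s) (simp add: pre_pure mult_pure tuples_simps tuple_prod_nil)
qed

lemma mult_letter_letter:
  "a \<in> carrier A \<Longrightarrow> b \<in> carrier A \<Longrightarrow> pure (a, []) \<otimes>\<^bsub>Q\<^esub> pure (b, []) = pure (a \<otimes>\<^bsub>A\<^esub> b, [])"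
  by (simp add: mult_pure tuples_simps tuple_prod_nil(1))

section \<open>Associativity\<close>

abbreviation op :: "'w \<Rightarrow> (('a, 'w, 'k) tuple \<Rightarrow> 'k) set \<Rightarrow> (('a, 'w, 'k) tuple \<Rightarrow> 'k) set" where
  "op \<omega> \<equiv> pre \<one>\<^bsub>A\<^esub> (\<delta> \<omega>)"

text \<open>Fits the conditional axioms: where the scalar is zero both sides vanish, and elsewhere
  the axioms are available to compare the words.\<close>

lemma smult_eqI:
  "c = c' \<Longrightarrow> X \<in> carrier Q \<Longrightarrow> Y \<in> carrier Q \<Longrightarrow> (c \<noteq> \<zero>\<^bsub>k\<^esub> \<Longrightarrow> X = Y) \<Longrightarrow> c \<odot>\<^bsub>Q\<^esub> X = c' \<odot>\<^bsub>Q\<^esub> Y"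
  by (cases "c = \<zero>\<^bsub>k\<^esub>") auto

text \<open>\<open>mult_pre_pre\<close> with both heads equal to one; this is already the
  Rota-Baxter identity.\<close>

lemma op_mult_op:
  assumes "X \<in> carrier Q" "Y \<in> carrier Q"
  shows "op \<alpha> X \<otimes>\<^bsub>Q\<^esub> op \<beta> Y =
    op (\<alpha> \<rightharpoonup> \<beta>) (op (\<alpha> \<triangleright> \<beta>) X \<otimes>\<^bsub>Q\<^esub> Y) \<oplus>\<^bsub>Q\<^esub> op (\<alpha> \<leftharpoonup> \<beta>) (X \<otimes>\<^bsub>Q\<^esub> op (\<alpha> \<triangleleft> \<beta>) Y) \<oplus>\<^bsub>Q\<^esub>
    lam E \<alpha> \<beta> \<odot>\<^bsub>Q\<^esub> op (\<alpha> \<cdot> \<beta>) (X \<otimes>\<^bsub>Q\<^esub> Y)"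
  using assms by (simp add: mult_pre_pre shuffle_step_def)

text \<open>Each hypothesis is associativity for a triple that has lost at least one leading letter:
  \<open>i1\<close> rebrackets \<open>R11\<close>, \<open>i2\<close> rebrackets \<open>L22\<close>,
  and \<open>i3\<close> to \<open>i7\<close> serve \<open>L12\<close>, \<open>L13\<close>,
  \<open>L23\<close>, \<open>L32\<close> and \<open>L33\<close> in this order. The prefixed types
  are arbitrary because the expansion changes them.\<close>

lemma mult_assoc_step:
  assumes a: "a \<in> carrier A" "b \<in> carrier A" "c \<in> carrier A"
    and x: "x \<in> carrier Q" "y \<in> carrier Q" "z \<in> carrier Q"
    and i1: "\<And>p q. op p x \<otimes>\<^bsub>Q\<^esub> op q y \<otimes>\<^bsub>Q\<^esub> z = op p x \<otimes>\<^bsub>Q\<^esub> (op q y \<otimes>\<^bsub>Q\<^esub> z)"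
    and i2: "\<And>p q. x \<otimes>\<^bsub>Q\<^esub> op p y \<otimes>\<^bsub>Q\<^esub> op q z = x \<otimes>\<^bsub>Q\<^esub> (op p y \<otimes>\<^bsub>Q\<^esub> op q z)"
    and i3: "\<And>p q. op p x \<otimes>\<^bsub>Q\<^esub> y \<otimes>\<^bsub>Q\<^esub> op q z = op p x \<otimes>\<^bsub>Q\<^esub> (y \<otimes>\<^bsub>Q\<^esub> op q z)"
    and i4: "\<And>p. op p x \<otimes>\<^bsub>Q\<^esub> y \<otimes>\<^bsub>Q\<^esub> z = op p x \<otimes>\<^bsub>Q\<^esub> (y \<otimes>\<^bsub>Q\<^esub> z)"
    and i5: "\<And>p. x \<otimes>\<^bsub>Q\<^esub> op p y \<otimes>\<^bsub>Q\<^esub> z = x \<otimes>\<^bsub>Q\<^esub> (op p y \<otimes>\<^bsub>Q\<^esub> z)"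
    and i6: "\<And>p. x \<otimes>\<^bsub>Q\<^esub> y \<otimes>\<^bsub>Q\<^esub> op p z = x \<otimes>\<^bsub>Q\<^esub> (y \<otimes>\<^bsub>Q\<^esub> op p z)"
    and i7: "x \<otimes>\<^bsub>Q\<^esub> y \<otimes>\<^bsub>Q\<^esub> z = x \<otimes>\<^bsub>Q\<^esub> (y \<otimes>\<^bsub>Q\<^esub> z)"
  shows "pre a (\<delta> \<alpha>) x \<otimes>\<^bsub>Q\<^esub> pre b (\<delta> \<beta>) y \<otimes>\<^bsub>Q\<^esub> pre c (\<delta> \<gamma>) z =
    pre a (\<delta> \<alpha>) x \<otimes>\<^bsub>Q\<^esub> (pre b (\<delta> \<beta>) y \<otimes>\<^bsub>Q\<^esub> pre c (\<delta> \<gamma>) z)"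
proof -
  define d where "d = a \<otimes>\<^bsub>A\<^esub> b \<otimes>\<^bsub>A\<^esub> c"
  define t where "t \<omega> = pre d (\<delta> \<omega>)" for \<omega>
  have d: "d \<in> carrier A" "a \<otimes>\<^bsub>A\<^esub> (b \<otimes>\<^bsub>A\<^esub> c) = d"
    using a by (simp_all add: d_def A.m_assoc)
  have t_closed: "t \<omega> X \<in> carrier Q" if "X \<in> carrier Q" for \<omega> X
    using that d by (simp add: t_def)
  note lin = linear_mapsD(2,3)[OF pre_linear[OF _ unit_type_closed]]
    linear_mapsD(2,3)[OF mult_linear_left] linear_mapsD(2,3)[OF mult_linear_right]
  note t_lin = lin(1,2)[OF d(1), folded t_def]
  txt \<open>In \<open>L\<close> the first index refers to the inner product \<open>x \<otimes> y\<close>, in \<open>R\<close> to \<open>y \<otimes> z\<close>, and the second to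
    the outer product; 1, 2, 3 stand for the terms of \<open>\<rightharpoonup>\<close>, \<open>\<leftharpoonup>\<close>, \<open>\<cdot>\<close>. \<open>R11\<close> absorbs the \<open>Li1\<close> and \<open>L22\<close> the \<open>Ri2\<close>.\<close>
  define L11 L12 L13 L21 L22 L23 L31 L32 L33 where
    "L11 = t (\<alpha> \<rightharpoonup> \<beta> \<rightharpoonup> \<gamma>) (op (\<alpha> \<rightharpoonup> \<beta> \<triangleright> \<gamma>) (op (\<alpha> \<triangleright> \<beta>) x \<otimes>\<^bsub>Q\<^esub> y) \<otimes>\<^bsub>Q\<^esub> z)" and
    "L12 = t (\<alpha> \<rightharpoonup> \<beta> \<leftharpoonup> \<gamma>) (op (\<alpha> \<triangleright> \<beta>) x \<otimes>\<^bsub>Q\<^esub> y \<otimes>\<^bsub>Q\<^esub> op (\<alpha> \<rightharpoonup> \<beta> \<triangleleft> \<gamma>) z)" and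
    "L13 = lam E (\<alpha> \<rightharpoonup> \<beta>) \<gamma> \<odot>\<^bsub>Q\<^esub> t (\<alpha> \<rightharpoonup> \<beta> \<cdot> \<gamma>) (op (\<alpha> \<triangleright> \<beta>) x \<otimes>\<^bsub>Q\<^esub> y \<otimes>\<^bsub>Q\<^esub> z)" and
    "L21 = t (\<alpha> \<leftharpoonup> \<beta> \<rightharpoonup> \<gamma>) (op (\<alpha> \<leftharpoonup> \<beta> \<triangleright> \<gamma>) (x \<otimes>\<^bsub>Q\<^esub> op (\<alpha> \<triangleleft> \<beta>) y) \<otimes>\<^bsub>Q\<^esub> z)" and
    "L22 = t (\<alpha> \<leftharpoonup> \<beta> \<leftharpoonup> \<gamma>) (x \<otimes>\<^bsub>Q\<^esub> op (\<alpha> \<triangleleft> \<beta>) y \<otimes>\<^bsub>Q\<^esub> op (\<alpha> \<leftharpoonup> \<beta> \<triangleleft> \<gamma>) z)" and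
    "L23 = lam E (\<alpha> \<leftharpoonup> \<beta>) \<gamma> \<odot>\<^bsub>Q\<^esub> t (\<alpha> \<leftharpoonup> \<beta> \<cdot> \<gamma>) (x \<otimes>\<^bsub>Q\<^esub> op (\<alpha> \<triangleleft> \<beta>) y \<otimes>\<^bsub>Q\<^esub> z)" and
    "L31 = lam E \<alpha> \<beta> \<odot>\<^bsub>Q\<^esub> t (\<alpha> \<cdot> \<beta> \<rightharpoonup> \<gamma>) (op (\<alpha> \<cdot> \<beta> \<triangleright> \<gamma>) (x \<otimes>\<^bsub>Q\<^esub> y) \<otimes>\<^bsub>Q\<^esub> z)" and
    "L32 = lam E \<alpha> \<beta> \<odot>\<^bsub>Q\<^esub> t (\<alpha> \<cdot> \<beta> \<leftharpoonup> \<gamma>) (x \<otimes>\<^bsub>Q\<^esub> y \<otimes>\<^bsub>Q\<^esub> op (\<alpha> \<cdot> \<beta> \<triangleleft> \<gamma>) z)" and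
    "L33 = lam E \<alpha> \<beta> \<odot>\<^bsub>Q\<^esub> (lam E (\<alpha> \<cdot> \<beta>) \<gamma> \<odot>\<^bsub>Q\<^esub> t (\<alpha> \<cdot> \<beta> \<cdot> \<gamma>) (x \<otimes>\<^bsub>Q\<^esub> y \<otimes>\<^bsub>Q\<^esub> z))"
  note L_defs = this
  define R11 R12 R13 R21 R22 R23 R31 R32 R33 where
    "R11 = t (\<alpha> \<rightharpoonup> (\<beta> \<rightharpoonup> \<gamma>)) (op (\<alpha> \<triangleright> (\<beta> \<rightharpoonup> \<gamma>)) x \<otimes>\<^bsub>Q\<^esub> (op (\<beta> \<triangleright> \<gamma>) y \<otimes>\<^bsub>Q\<^esub> z))" and
    "R12 = t (\<alpha> \<leftharpoonup> (\<beta> \<rightharpoonup> \<gamma>)) (x \<otimes>\<^bsub>Q\<^esub> op (\<alpha> \<triangleleft> (\<beta> \<rightharpoonup> \<gamma>)) (op (\<beta> \<triangleright> \<gamma>) y \<otimes>\<^bsub>Q\<^esub> z))" and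
    "R13 = lam E \<alpha> (\<beta> \<rightharpoonup> \<gamma>) \<odot>\<^bsub>Q\<^esub> t (\<alpha> \<cdot> (\<beta> \<rightharpoonup> \<gamma>)) (x \<otimes>\<^bsub>Q\<^esub> (op (\<beta> \<triangleright> \<gamma>) y \<otimes>\<^bsub>Q\<^esub> z))" and
    "R21 = t (\<alpha> \<rightharpoonup> (\<beta> \<leftharpoonup> \<gamma>)) (op (\<alpha> \<triangleright> (\<beta> \<leftharpoonup> \<gamma>)) x \<otimes>\<^bsub>Q\<^esub> (y \<otimes>\<^bsub>Q\<^esub> op (\<beta> \<triangleleft> \<gamma>) z))" and
    "R22 = t (\<alpha> \<leftharpoonup> (\<beta> \<leftharpoonup> \<gamma>)) (x \<otimes>\<^bsub>Q\<^esub> op (\<alpha> \<triangleleft> (\<beta> \<leftharpoonup> \<gamma>)) (y \<otimes>\<^bsub>Q\<^esub> op (\<beta> \<triangleleft> \<gamma>) z))" and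
    "R23 = lam E \<alpha> (\<beta> \<leftharpoonup> \<gamma>) \<odot>\<^bsub>Q\<^esub> t (\<alpha> \<cdot> (\<beta> \<leftharpoonup> \<gamma>)) (x \<otimes>\<^bsub>Q\<^esub> (y \<otimes>\<^bsub>Q\<^esub> op (\<beta> \<triangleleft> \<gamma>) z))" and
    "R31 = lam E \<beta> \<gamma> \<odot>\<^bsub>Q\<^esub> t (\<alpha> \<rightharpoonup> (\<beta> \<cdot> \<gamma>)) (op (\<alpha> \<triangleright> (\<beta> \<cdot> \<gamma>)) x \<otimes>\<^bsub>Q\<^esub> (y \<otimes>\<^bsub>Q\<^esub> z))" and
    "R32 = lam E \<beta> \<gamma> \<odot>\<^bsub>Q\<^esub> t (\<alpha> \<leftharpoonup> (\<beta> \<cdot> \<gamma>)) (x \<otimes>\<^bsub>Q\<^esub> op (\<alpha> \<triangleleft> (\<beta> \<cdot> \<gamma>)) (y \<otimes>\<^bsub>Q\<^esub> z))" and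
    "R33 = lam E \<beta> \<gamma> \<odot>\<^bsub>Q\<^esub> (lam E \<alpha> (\<beta> \<cdot> \<gamma>) \<odot>\<^bsub>Q\<^esub> t (\<alpha> \<cdot> (\<beta> \<cdot> \<gamma>)) (x \<otimes>\<^bsub>Q\<^esub> (y \<otimes>\<^bsub>Q\<^esub> z)))"
  note R_defs = this
  have L: "L11 \<in> carrier Q" "L12 \<in> carrier Q" "L13 \<in> carrier Q" "L21 \<in> carrier Q" "L22 \<in> carrier Q"
    "L23 \<in> carrier Q" "L31 \<in> carrier Q" "L32 \<in> carrier Q" "L33 \<in> carrier Q"
    using x by (simp_all add: L_defs t_closed lam_closed)
  have R: "R11 \<in> carrier Q" "R12 \<in> carrier Q" "R13 \<in> carrier Q" "R21 \<in> carrier Q" "R22 \<in> carrier Q"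
    "R23 \<in> carrier Q" "R31 \<in> carrier Q" "R32 \<in> carrier Q" "R33 \<in> carrier Q"
    using x by (simp_all add: R_defs t_closed lam_closed)
  have step: "shuffle_step d \<mu> \<nu> X Y Z = t (\<mu> \<rightharpoonup> \<nu>) X \<oplus>\<^bsub>Q\<^esub> t (\<mu> \<leftharpoonup> \<nu>) Y \<oplus>\<^bsub>Q\<^esub> lam E \<mu> \<nu> \<odot>\<^bsub>Q\<^esub> t (\<mu> \<cdot> \<nu>) Z" for \<mu> \<nu> X Y Z
    by (simp add: shuffle_step_def t_def)
  have left: "pre a (\<delta> \<alpha>) x \<otimes>\<^bsub>Q\<^esub> pre b (\<delta> \<beta>) y \<otimes>\<^bsub>Q\<^esub> pre c (\<delta> \<gamma>) z =
    (L11 \<oplus>\<^bsub>Q\<^esub> L12 \<oplus>\<^bsub>Q\<^esub> L13) \<oplus>\<^bsub>Q\<^esub> (L21 \<oplus>\<^bsub>Q\<^esub> L22 \<oplus>\<^bsub>Q\<^esub> L23) \<oplus>\<^bsub>Q\<^esub> (L31 \<oplus>\<^bsub>Q\<^esub> L32 \<oplus>\<^bsub>Q\<^esub> L33)"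
    unfolding mult_pre_pre[OF a(1,2) x(1,2)] shuffle_step_def[of "a \<otimes>\<^bsub>A\<^esub> b"]
    using a x by (simp add: lin lam_closed mult_pre_pre step Q.smult_r_distr L_defs t_closed flip: d_def)
  have right: "pre a (\<delta> \<alpha>) x \<otimes>\<^bsub>Q\<^esub> (pre b (\<delta> \<beta>) y \<otimes>\<^bsub>Q\<^esub> pre c (\<delta> \<gamma>) z) =
    (R11 \<oplus>\<^bsub>Q\<^esub> R12 \<oplus>\<^bsub>Q\<^esub> R13) \<oplus>\<^bsub>Q\<^esub> (R21 \<oplus>\<^bsub>Q\<^esub> R22 \<oplus>\<^bsub>Q\<^esub> R23) \<oplus>\<^bsub>Q\<^esub> (R31 \<oplus>\<^bsub>Q\<^esub> R32 \<oplus>\<^bsub>Q\<^esub> R33)"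
    unfolding mult_pre_pre[OF a(2,3) x(2,3)] shuffle_step_def[of "b \<otimes>\<^bsub>A\<^esub> c"]
    using a x by (simp add: lin lam_closed mult_pre_pre step Q.smult_r_distr R_defs t_closed d(2))
  \<comment> \<open>After rebracketing by \<open>i1\<close>, two operators are multiplied. The laws
    pairing \<open>\<alpha> \<triangleright> (\<beta> \<rightharpoonup> \<gamma>)\<close> with
    \<open>\<beta> \<triangleright> \<gamma>\<close> turn the resulting types into those of
    \<open>L11\<close> and \<open>L21\<close> and the scalar into that of
    \<open>L31\<close>.\<close>
  have "R11 = L11 \<oplus>\<^bsub>Q\<^esub> L21 \<oplus>\<^bsub>Q\<^esub> lam E \<alpha> \<beta> \<odot>\<^bsub>Q\<^esub>
      t (\<alpha> \<rightharpoonup> (\<beta> \<rightharpoonup> \<gamma>)) (op (\<alpha> \<triangleright> (\<beta> \<rightharpoonup> \<gamma>) \<cdot> (\<beta> \<triangleright> \<gamma>)) (x \<otimes>\<^bsub>Q\<^esub> y) \<otimes>\<^bsub>Q\<^esub> z)"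
    using x by (simp add: R_defs L_defs i1[symmetric] op_mult_op triangle_laws larr_laws lam_laws
        lin t_lin lam_closed)
  also have "lam E \<alpha> \<beta> \<odot>\<^bsub>Q\<^esub> t (\<alpha> \<rightharpoonup> (\<beta> \<rightharpoonup> \<gamma>)) (op (\<alpha> \<triangleright> (\<beta> \<rightharpoonup> \<gamma>) \<cdot> (\<beta> \<triangleright> \<gamma>)) (x \<otimes>\<^bsub>Q\<^esub> y) \<otimes>\<^bsub>Q\<^esub> z) = L31"
    unfolding L_defs using x by (intro smult_eqI) (simp_all add: t_closed dot_laws)
  finally have R11: "R11 = L11 \<oplus>\<^bsub>Q\<^esub> L21 \<oplus>\<^bsub>Q\<^esub> L31" .
  \<comment> \<open>The mirror image, with a left term being split: now
    \<open>\<alpha> \<triangleleft> \<beta>\<close> is paired with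
    \<open>(\<alpha> \<leftharpoonup> \<beta>) \<triangleleft> \<gamma>\<close>.\<close>
  have "L22 = R12 \<oplus>\<^bsub>Q\<^esub> R22 \<oplus>\<^bsub>Q\<^esub> lam E \<beta> \<gamma> \<odot>\<^bsub>Q\<^esub>
      t (\<alpha> \<leftharpoonup> (\<beta> \<leftharpoonup> \<gamma>)) (x \<otimes>\<^bsub>Q\<^esub> op (\<alpha> \<triangleleft> \<beta> \<cdot> (\<alpha> \<leftharpoonup> \<beta> \<triangleleft> \<gamma>)) (y \<otimes>\<^bsub>Q\<^esub> z))"
    using x by (simp add: R_defs L_defs i2 op_mult_op triangle_laws larr_laws lam_laws
        lin t_lin lam_closed)
  also have "lam E \<beta> \<gamma> \<odot>\<^bsub>Q\<^esub> t (\<alpha> \<leftharpoonup> (\<beta> \<leftharpoonup> \<gamma>)) (x \<otimes>\<^bsub>Q\<^esub> op (\<alpha> \<triangleleft> \<beta> \<cdot> (\<alpha> \<leftharpoonup> \<beta> \<triangleleft> \<gamma>)) (y \<otimes>\<^bsub>Q\<^esub> z)) = R32"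
    unfolding R_defs using x by (intro smult_eqI) (simp_all add: t_closed dot_laws)
  finally have L22: "L22 = R12 \<oplus>\<^bsub>Q\<^esub> R22 \<oplus>\<^bsub>Q\<^esub> R32" .
  \<comment> \<open>The one-to-one match that carries no scalar; unconditional laws suffice.\<close>
  have L12: "L12 = R21"
    by (simp add: L_defs R_defs i3 triangle_laws larr_laws)
  have L13: "L13 = R31"
    unfolding L_defs R_defs lam_laws(1) i4
    using x by (intro smult_eqI) (simp_all add: t_closed dot_laws)
  \<comment> \<open>Even the operators applied to \<open>y\<close> differ here, with type
    \<open>\<alpha> \<triangleleft> \<beta>\<close> on the left and
    \<open>\<beta> \<triangleright> \<gamma>\<close> on the right. The axioms grant their equality
    only where the scalar is nonzero.\<close>
  have L23: "L23 = R13"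
    unfolding L_defs R_defs lam_laws(3) i5
    using x by (intro smult_eqI) (simp_all add: t_closed dot_laws)
  have L32: "L32 = R23"
    unfolding L_defs R_defs lam_laws(5) i6
    using x by (intro smult_eqI) (simp_all add: t_closed dot_laws)
  \<comment> \<open>The scalars are merged first: associativity of \<cdot> is granted when their
    product is nonzero, which in the presence of zero divisors is more than both factors being
    nonzero.\<close>
  have "L33 = (lam E \<alpha> \<beta> \<otimes>\<^bsub>k\<^esub> lam E (\<alpha> \<cdot> \<beta>) \<gamma>) \<odot>\<^bsub>Q\<^esub> t (\<alpha> \<cdot> \<beta> \<cdot> \<gamma>) (x \<otimes>\<^bsub>Q\<^esub> (y \<otimes>\<^bsub>Q\<^esub> z))"
    using x by (simp add: L_defs i7 t_closed lam_closed Q.smult_assoc1)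
  also have "\<dots> = (lam E \<beta> \<gamma> \<otimes>\<^bsub>k\<^esub> lam E \<alpha> (\<beta> \<cdot> \<gamma>)) \<odot>\<^bsub>Q\<^esub> t (\<alpha> \<cdot> (\<beta> \<cdot> \<gamma>)) (x \<otimes>\<^bsub>Q\<^esub> (y \<otimes>\<^bsub>Q\<^esub> z))"
    using x by (intro smult_eqI) (simp_all add: t_closed dot_laws lam_laws(6))
  also have "\<dots> = R33"
    using x by (simp add: R_defs t_closed lam_closed Q.smult_assoc1)
  finally have L33: "L33 = R33" .
  show ?thesis
    unfolding left right R11 L22 L12 L13 L23 L32 L33
    using L R by (simp add: Q.M.a_ac)
qed

text \<open>Indexed by the number of types, so the words in \<open>words n\<close> have length
  \<open>n + 1\<close>. Types are restricted to basis vectors; by \<open>pre_eq_lincomb\<close> such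
  words still span \<open>Q\<close>, and on them the product is given by \<open>mult_pre_pre\<close>
  without sums over types.\<close>

primrec words :: "nat \<Rightarrow> (('a, 'w, 'k) tuple \<Rightarrow> 'k) set set" where
  "words 0 = (\<lambda>a. pure (a, [])) ` carrier A"
| "words (Suc n) = {pre a (\<delta> \<omega>) X |a \<omega> X. a \<in> carrier A \<and> X \<in> words n}"

lemma words_closed: "X \<in> words n \<Longrightarrow> X \<in> carrier Q"
  by (induction n arbitrary: X) (auto simp: tuples_simps)

text \<open>The first type of a tuple is expanded in the basis, and its tail is handled by
  induction. Both maps are generalised there, since the hypothesis is applied to their composites
  with a prefix.\<close>

lemma linear_maps_words_eqI:
  fixes N :: "('k, 'b) module"
  assumes N: "module k N" and h: "h \<in> linear_maps k Q N" "h' \<in> linear_maps k Q N"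
    and eq: "\<And>n X. X \<in> words n \<Longrightarrow> h X = h' X"
    and X: "X \<in> carrier Q"
  shows "h X = h' X"
proof (rule linear_maps_typed_words_eqI[OF N h _ X])
  have "h (pure (a, u)) = h' (pure (a, u))"
    if "(a, u) \<in> tuples k A" "h \<in> linear_maps k Q N" "h' \<in> linear_maps k Q N"
      "\<And>n X. X \<in> words n \<Longrightarrow> h X = h' X" for a u h h'
    using that
  proof (induction u arbitrary: a h h')
    case Nil
    have "pure (a, []) \<in> words 0"
      using Nil.prems(1) by (simp add: tuples_simps)
    then show ?case
      by (rule Nil.prems(4))
  next
    case (Cons p u)
    obtain x b where p: "p = (x, b)" by (cases p)
    have tup: "a \<in> carrier A" "x \<in> carrier types" "(b, u) \<in> tuples k A"
      using Cons.prems(1) by (auto simp: p tuples_simps)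
    note pre = pre_linear[OF tup(1) unit_type_closed]
    have "h (pre a (\<delta> \<omega>) (pure (b, u))) = h' (pre a (\<delta> \<omega>) (pure (b, u)))" for \<omega>
    proof (rule Cons.IH[OF tup(3) linear_maps_comp[OF pre Cons.prems(2)] linear_maps_comp[OF pre Cons.prems(3)]])
      show "h (pre a (\<delta> \<omega>) X) = h' (pre a (\<delta> \<omega>) X)" if "X \<in> words n" for n X
        using that tup(1) by (intro Cons.prems(4)[of _ "Suc n"]) auto
    qed
    then have "lincomb k N (\<lambda>\<omega>. h (pre a (\<delta> \<omega>) (pure (b, u)))) x = lincomb k N (\<lambda>\<omega>. h' (pre a (\<delta> \<omega>) (pure (b, u)))) x"
      by simp
    moreover have "pure (a, p # u) = lincomb k Q (\<lambda>\<omega>. pre a (\<delta> \<omega>) (pure (b, u))) x"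
      using tup by (simp add: p flip: pre_pure pre_eq_lincomb)
    moreover have "(\<lambda>\<omega>. pre a (\<delta> \<omega>) (pure (b, u))) \<in> UNIV \<rightarrow> carrier Q"
      using tup by simp
    ultimately show ?case
      using linear_map_lincomb[OF module_Q N Cons.prems(2) _ tup(2)]
        linear_map_lincomb[OF module_Q N Cons.prems(3) _ tup(2)] by simp
  qed
  from this[OF _ h eq] show "h (pure s) = h' (pure s)" if "s \<in> tuples k A" for s
    using that by (cases s) simp
qed

lemma letter_closed: "a \<in> carrier A \<Longrightarrow> pure (a, []) \<in> carrier Q"
  by (simp add: tuples_simps)

text \<open>Multiplication by a letter changes only the head, and \<open>shuffle_step\<close> hands
  the head of the product to each of its three terms alike.\<close>

lemma mult_letter_assoc:
  assumes a: "a \<in> carrier A" and X: "X \<in> carrier Q" and Y: "Y \<in> carrier Q"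
  shows "pure (a, []) \<otimes>\<^bsub>Q\<^esub> (X \<otimes>\<^bsub>Q\<^esub> Y) = pure (a, []) \<otimes>\<^bsub>Q\<^esub> X \<otimes>\<^bsub>Q\<^esub> Y"
proof -
  let ?a = "pure (a, [])"
  note a' = letter_closed[OF a]
  have words: "?a \<otimes>\<^bsub>Q\<^esub> (X \<otimes>\<^bsub>Q\<^esub> Y) = ?a \<otimes>\<^bsub>Q\<^esub> X \<otimes>\<^bsub>Q\<^esub> Y" if X: "X \<in> words m" and Y: "Y \<in> words n" for X Y m n
  proof -
    have letter: "?a \<otimes>\<^bsub>Q\<^esub> (pure (b, []) \<otimes>\<^bsub>Q\<^esub> Y) = pure (a \<otimes>\<^bsub>A\<^esub> b, []) \<otimes>\<^bsub>Q\<^esub> Y"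
      if "b \<in> carrier A" "Y \<in> words n" for b n Y
      using that a by (cases n)
        (auto simp: mult_letter_letter mult_letter_pre words_closed A.m_assoc)
    show ?thesis
    proof (cases m)
      case 0
      then obtain b where "b \<in> carrier A" "X = pure (b, [])"
        using X by auto
      then show ?thesis
        using letter[OF _ Y] a by (simp add: mult_letter_letter)
    next
      case (Suc m')
      with X obtain b \<omega> X' where b: "b \<in> carrier A" "X' \<in> carrier Q" "X = pre b (\<delta> \<omega>) X'"
        using words_closed by auto blast
      show ?thesis
      proof (cases n)
        case 0
        then obtain c where c: "c \<in> carrier A" "Y = pure (c, [])"
          using Y by auto
        \<comment> \<open>A letter as right factor is moved to the left by commutativity, where
          \<open>mult_letter_pre\<close> can absorb it.\<close>
        then show ?thesis
          using a b letter_closed[OF c(1)] letter_closed[OF a]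
          by (simp add: mult_commute[of _ "pure (c, [])"] mult_letter_pre A.m_ac)
      next
        case (Suc n')
        with Y obtain c \<nu> Y' where c: "c \<in> carrier A" "Y' \<in> carrier Q" "Y = pre c (\<delta> \<nu>) Y'"
          using words_closed by auto blast
        then show ?thesis
          using a b
          by (simp add: mult_pre_pre mult_letter_pre shuffle_step_def lam_closed a' A.m_assoc
              linear_mapsD(2,3)[OF mult_linear_right[OF a']])
      qed
    qed
  qed
  note intros = linear_maps_comp[OF mult_linear_left mult_linear_right]
    linear_maps_comp[OF mult_linear_right mult_linear_left]
    linear_maps_comp[OF mult_linear_right mult_linear_right]
    mult_linear_left mult_linear_right mult_closed a' X Y
  show ?thesis
  proof (rule linear_maps_words_eqI[OF module_Q _ _ _ X])
    show "(\<lambda>X. ?a \<otimes>\<^bsub>Q\<^esub> (X \<otimes>\<^bsub>Q\<^esub> Y)) \<in> linear_maps k Q Q" "(\<lambda>X. ?a \<otimes>\<^bsub>Q\<^esub> X \<otimes>\<^bsub>Q\<^esub> Y) \<in> linear_maps k Q Q"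
      by (intro intros)+
    fix m X assume X: "X \<in> words m"
    note X' = words_closed[OF X]
    show "?a \<otimes>\<^bsub>Q\<^esub> (X \<otimes>\<^bsub>Q\<^esub> Y) = ?a \<otimes>\<^bsub>Q\<^esub> X \<otimes>\<^bsub>Q\<^esub> Y"
      by (rule linear_maps_words_eqI[OF module_Q _ _ words[OF X] Y]) (intro intros X')+
  qed
qed

text \<open>If a factor is a letter, commutativity brings it to the front and
  \<open>mult_letter_assoc\<close> applies. Otherwise the seven hypotheses of
  \<open>mult_assoc_step\<close> concern triples shorter by one, two or three letters, since
  replacing a head by one and changing a type preserves length.\<close>

lemma mult_assoc_words:
  assumes "X \<in> words l" "Y \<in> words m" "Z \<in> words n"
  shows "X \<otimes>\<^bsub>Q\<^esub> Y \<otimes>\<^bsub>Q\<^esub> Z = X \<otimes>\<^bsub>Q\<^esub> (Y \<otimes>\<^bsub>Q\<^esub> Z)"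
  using assms
proof (induction "l + m + n" arbitrary: l m n X Y Z rule: less_induct)
  case less
  note cl = words_closed[OF less.prems(1)] words_closed[OF less.prems(2)] words_closed[OF less.prems(3)]
  consider "l = 0" | "m = 0" | "n = 0" | l' m' n' where "l = Suc l'" "m = Suc m'" "n = Suc n'"
    by (metis not0_implies_Suc)
  then show ?case
  proof cases
    case 1
    then show ?thesis
      using less.prems(1) cl by (auto simp: mult_letter_assoc)
  next
    case 2
    then obtain b where b: "b \<in> carrier A" "Y = pure (b, [])"
      using less.prems(2) by auto
    have "X \<otimes>\<^bsub>Q\<^esub> Y \<otimes>\<^bsub>Q\<^esub> Z = Y \<otimes>\<^bsub>Q\<^esub> (X \<otimes>\<^bsub>Q\<^esub> Z)"
      using b cl by (simp add: mult_letter_assoc mult_commute[of X "pure (b, [])"])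
    also have "\<dots> = Y \<otimes>\<^bsub>Q\<^esub> Z \<otimes>\<^bsub>Q\<^esub> X"
      using b cl by (simp add: mult_commute[of X Z] flip: mult_letter_assoc)
    also have "\<dots> = X \<otimes>\<^bsub>Q\<^esub> (Y \<otimes>\<^bsub>Q\<^esub> Z)"
      using cl by (simp add: mult_commute[of X])
    finally show ?thesis .
  next
    case 3
    then obtain c where c: "c \<in> carrier A" "Z = pure (c, [])"
      using less.prems(3) by auto
    have "X \<otimes>\<^bsub>Q\<^esub> Y \<otimes>\<^bsub>Q\<^esub> Z = Z \<otimes>\<^bsub>Q\<^esub> (Y \<otimes>\<^bsub>Q\<^esub> X)"
      using cl by (simp add: mult_commute[of X] mult_commute[of _ Z])
    also have "\<dots> = Z \<otimes>\<^bsub>Q\<^esub> Y \<otimes>\<^bsub>Q\<^esub> X"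
      using c cl by (simp add: mult_letter_assoc)
    also have "\<dots> = X \<otimes>\<^bsub>Q\<^esub> (Y \<otimes>\<^bsub>Q\<^esub> Z)"
      using cl by (simp add: mult_commute[of X] mult_commute[of _ Z])
    finally show ?thesis .
  next
    case 4
    obtain a \<alpha> x where x: "a \<in> carrier A" "x \<in> words l'" "X = pre a (\<delta> \<alpha>) x"
      using less.prems(1) 4 by auto
    obtain b \<beta> y where y: "b \<in> carrier A" "y \<in> words m'" "Y = pre b (\<delta> \<beta>) y"
      using less.prems(2) 4 by auto
    obtain c \<gamma> z where z: "c \<in> carrier A" "z \<in> words n'" "Z = pre c (\<delta> \<gamma>) z"
      using less.prems(3) 4 by auto
    have op: "op \<omega> V \<in> words (Suc i)" if "V \<in> words i" for \<omega> V i
      using that by auto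
    note [intro] = op[OF x(2)] op[OF y(2)] op[OF z(2)] x(2) y(2) z(2)
    show ?thesis
      unfolding x(3) y(3) z(3)
    proof (rule mult_assoc_step)
      show "op p x \<otimes>\<^bsub>Q\<^esub> op q y \<otimes>\<^bsub>Q\<^esub> z = op p x \<otimes>\<^bsub>Q\<^esub> (op q y \<otimes>\<^bsub>Q\<^esub> z)" for p q
        by (rule less.hyps[of "Suc l'" "Suc m'" n']) (use 4 in auto)
      show "x \<otimes>\<^bsub>Q\<^esub> op p y \<otimes>\<^bsub>Q\<^esub> op q z = x \<otimes>\<^bsub>Q\<^esub> (op p y \<otimes>\<^bsub>Q\<^esub> op q z)" for p q
        by (rule less.hyps[of l' "Suc m'" "Suc n'"]) (use 4 in auto)
      show "op p x \<otimes>\<^bsub>Q\<^esub> y \<otimes>\<^bsub>Q\<^esub> op q z = op p x \<otimes>\<^bsub>Q\<^esub> (y \<otimes>\<^bsub>Q\<^esub> op q z)" for p q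
        by (rule less.hyps[of "Suc l'" m' "Suc n'"]) (use 4 in auto)
      show "op p x \<otimes>\<^bsub>Q\<^esub> y \<otimes>\<^bsub>Q\<^esub> z = op p x \<otimes>\<^bsub>Q\<^esub> (y \<otimes>\<^bsub>Q\<^esub> z)" for p
        by (rule less.hyps[of "Suc l'" m' n']) (use 4 in auto)
      show "x \<otimes>\<^bsub>Q\<^esub> op p y \<otimes>\<^bsub>Q\<^esub> z = x \<otimes>\<^bsub>Q\<^esub> (op p y \<otimes>\<^bsub>Q\<^esub> z)" for p
        by (rule less.hyps[of l' "Suc m'" n']) (use 4 in auto)
      show "x \<otimes>\<^bsub>Q\<^esub> y \<otimes>\<^bsub>Q\<^esub> op p z = x \<otimes>\<^bsub>Q\<^esub> (y \<otimes>\<^bsub>Q\<^esub> op p z)" for p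
        by (rule less.hyps[of l' m' "Suc n'"]) (use 4 in auto)
      show "x \<otimes>\<^bsub>Q\<^esub> y \<otimes>\<^bsub>Q\<^esub> z = x \<otimes>\<^bsub>Q\<^esub> (y \<otimes>\<^bsub>Q\<^esub> z)"
        by (rule less.hyps[of l' m' n']) (use 4 in auto)
    qed (use x y z in \<open>auto intro: words_closed\<close>)
  qed
qed

lemma mult_assoc:
  assumes X: "X \<in> carrier Q" and Y: "Y \<in> carrier Q" and Z: "Z \<in> carrier Q"
  shows "X \<otimes>\<^bsub>Q\<^esub> Y \<otimes>\<^bsub>Q\<^esub> Z = X \<otimes>\<^bsub>Q\<^esub> (Y \<otimes>\<^bsub>Q\<^esub> Z)"
proof -
  note intros = linear_maps_comp[OF mult_linear_left mult_linear_right]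
    linear_maps_comp[OF mult_linear_right mult_linear_left]
    linear_maps_comp[OF mult_linear_right mult_linear_right]
    linear_maps_comp[OF mult_linear_left mult_linear_left]
    mult_linear_left mult_linear_right mult_closed
  show ?thesis
  proof (rule linear_maps_words_eqI[OF module_Q _ _ _ X])
    fix l X assume X: "X \<in> words l"
    note X' = words_closed[OF X]
    show "X \<otimes>\<^bsub>Q\<^esub> Y \<otimes>\<^bsub>Q\<^esub> Z = X \<otimes>\<^bsub>Q\<^esub> (Y \<otimes>\<^bsub>Q\<^esub> Z)"
    proof (rule linear_maps_words_eqI[OF module_Q _ _ _ Y])
      fix m Y assume Y: "Y \<in> words m"
      note Y' = words_closed[OF Y]
      show "X \<otimes>\<^bsub>Q\<^esub> Y \<otimes>\<^bsub>Q\<^esub> Z = X \<otimes>\<^bsub>Q\<^esub> (Y \<otimes>\<^bsub>Q\<^esub> Z)"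
        by (rule linear_maps_words_eqI[OF module_Q _ _ mult_assoc_words[OF X Y] Z]) (intro intros X' Y')+
    qed (intro intros X' Z)+
  qed (intro intros Y Z)+
qed

section \<open>The algebra structure and the operators\<close>

lemma one_closed_typed_words: "\<one>\<^bsub>Q\<^esub> \<in> carrier Q"
  by (simp add: typed_words_simps(4) letter_closed)

lemma one_mult:
  assumes "X \<in> carrier Q"
  shows "\<one>\<^bsub>Q\<^esub> \<otimes>\<^bsub>Q\<^esub> X = X"
proof (rule linear_maps_words_eqI[OF module_Q _ _ _ assms])
  show "(\<lambda>X. \<one>\<^bsub>Q\<^esub> \<otimes>\<^bsub>Q\<^esub> X) \<in> linear_maps k Q Q"
    by (rule mult_linear_right[OF one_closed_typed_words])
  show "(\<lambda>X. X) \<in> linear_maps k Q Q"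
    by (rule linear_mapsI) simp_all
  show "\<one>\<^bsub>Q\<^esub> \<otimes>\<^bsub>Q\<^esub> X = X" if "X \<in> words n" for n X
    using that
    by (cases n) (auto simp: typed_words_simps(4) mult_letter_letter mult_letter_pre words_closed)
qed

lemma algebra_typed_words: "algebra k Q"
proof (rule algebraI[OF cring_k])
  show "cring Q"
  proof (rule cringI)
    show "abelian_group Q"
      by (rule Q.M.abelian_group_axioms)
    show "comm_monoid Q"
      by (rule comm_monoidI)
        (simp_all add: mult_assoc one_mult one_closed_typed_words, rule mult_commute)
  qed (simp add: linear_mapsD(2)[OF mult_linear_left])
qed (simp_all add: Q.smult_l_distr Q.smult_r_distr Q.smult_assoc1 linear_mapsD(3)[OF mult_linear_left])

lemma typed_word_op_eq:
  assumes "X \<in> carrier Q"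
  shows "typed_word_op k A \<omega> X = op \<omega> X"
  using assms
proof (cases rule: cls_cases)
  case (1 f)
  have "cls (prefix k \<one>\<^bsub>A\<^esub> (\<delta> \<omega>) g) = op \<omega> X" if "g \<in> cls f" for g
    using in_clsD[OF that 1(1)] 1 by (simp add: prefix_closed_cls)
  then show ?thesis
    unfolding typed_word_op_def using cls_self[OF 1(1)] 1(2) by blast
qed

lemma comm_rota_baxter_typed_words: "comm_rota_baxter_algebra k E Q (typed_word_op k A)"
  unfolding comm_rota_baxter_algebra_def
proof (intro conjI allI ballI algebra_typed_words)
  show "typed_word_op k A \<omega> \<in> linear_maps k Q Q" for \<omega>
    by (rule linear_mapsI) (simp_all add: typed_word_op_eq linear_mapsD[OF pre_linear])
qed (simp add: typed_word_op_eq op_mult_op)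

lemma length_one_word_eq: "length_one_word k A a = pure (a, [])"
  by (simp add: length_one_word_def pure_def)

lemma length_one_word_hom: "length_one_word k A \<in> algebra_homs k A Q"
proof -
  have lin: "(\<lambda>a. pure (a, [])) \<in> linear_maps k A Q"
  proof (rule linear_mapsI)
    show "pure (a \<oplus>\<^bsub>A\<^esub> b, []) = pure (a, []) \<oplus>\<^bsub>Q\<^esub> pure (b, [])" if "a \<in> carrier A" "b \<in> carrier A" for a b
      using slot_combination.head[of a "[]" k A b "\<one>\<^bsub>k\<^esub>"] that
      by (intro multilinear_add[OF module_A module_Q multilinear_pure]) (simp add: tuples_simps)
    show "pure (c \<odot>\<^bsub>A\<^esub> a, []) = c \<odot>\<^bsub>Q\<^esub> pure (a, [])" if "c \<in> carrier k" "a \<in> carrier A" for c a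
      using slot_combination.head[of a "[]" k A "\<zero>\<^bsub>A\<^esub>" c] slot_combination.head[of "\<zero>\<^bsub>A\<^esub>" "[]" k A "\<zero>\<^bsub>A\<^esub>" "\<one>\<^bsub>k\<^esub>"] that
      by (intro multilinear_smult[OF module_A module_Q multilinear_pure]) (simp_all add: tuples_simps)
  qed (simp add: letter_closed)
  show ?thesis
    unfolding algebra_homs_def
    using linear_mapsD[OF lin] lin
    by (auto simp: length_one_word_eq mult_letter_letter typed_words_simps(4)
        intro!: ring_hom_memI linear_mapsI)
qed

section \<open>The universal property\<close>

context
  fixes R :: "('k, 'r) module" and P :: "'w \<Rightarrow> 'r \<Rightarrow> 'r" and f :: "'a \<Rightarrow> 'r"
  assumes RB: "comm_rota_baxter_algebra k E R P" and f: "f \<in> algebra_homs k A R"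
begin

interpretation R: algebra k R
  using RB by (simp add: comm_rota_baxter_algebra_def)

lemma module_R: "module k R"
  by (rule R.module_axioms)

lemma P_linear: "P \<omega> \<in> linear_maps k R R"
  using RB by (simp add: comm_rota_baxter_algebra_def)

lemma P_closed: "r \<in> carrier R \<Longrightarrow> P \<omega> r \<in> carrier R"
  by (rule linear_mapsD(1)[OF P_linear])

lemma P_mult_P:
  assumes "r \<in> carrier R" "s \<in> carrier R"
  shows "P \<alpha> r \<otimes>\<^bsub>R\<^esub> P \<beta> s = P (\<alpha> \<rightharpoonup> \<beta>) (P (\<alpha> \<triangleright> \<beta>) r \<otimes>\<^bsub>R\<^esub> s)
    \<oplus>\<^bsub>R\<^esub> P (\<alpha> \<leftharpoonup> \<beta>) (r \<otimes>\<^bsub>R\<^esub> P (\<alpha> \<triangleleft> \<beta>) s) \<oplus>\<^bsub>R\<^esub> lam E \<alpha> \<beta> \<odot>\<^bsub>R\<^esub> P (\<alpha> \<cdot> \<beta>) (r \<otimes>\<^bsub>R\<^esub> s)"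
  using RB assms unfolding comm_rota_baxter_algebra_def by blast

lemma f_linear: "f \<in> linear_maps k A R"
  using f by (simp add: algebra_homs_def)

lemma f_closed: "a \<in> carrier A \<Longrightarrow> f a \<in> carrier R"
  by (rule linear_mapsD(1)[OF f_linear])

lemma f_ring_hom:
  "a \<in> carrier A \<Longrightarrow> b \<in> carrier A \<Longrightarrow> f (a \<otimes>\<^bsub>A\<^esub> b) = f a \<otimes>\<^bsub>R\<^esub> f b"
  "f \<one>\<^bsub>A\<^esub> = \<one>\<^bsub>R\<^esub>"
  using f by (auto simp: algebra_homs_def ring_hom_def)

text \<open>A word is to be sent to its letters under \<open>f\<close> with the operators nested
  from the right. The tail is evaluated apart from the head, so that linearity in the head is
  visible and the empty tail gives the unit; the sum extends the value to types that are not basis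
  vectors.\<close>

primrec eval_tail :: "(('w \<Rightarrow> 'k) \<times> 'a) list \<Rightarrow> 'r" where
  "eval_tail [] = \<one>\<^bsub>R\<^esub>"
| "eval_tail (p # u) = lincomb k R (\<lambda>\<omega>. P \<omega> (f (snd p) \<otimes>\<^bsub>R\<^esub> eval_tail u)) (fst p)"

definition eval_tuple :: "('a, 'w, 'k) tuple \<Rightarrow> 'r" where
  "eval_tuple s = f (fst s) \<otimes>\<^bsub>R\<^esub> eval_tail (snd s)"

lemma eval_tuple_simps:
  "a \<in> carrier A \<Longrightarrow> eval_tuple (a, []) = f a"
  "eval_tuple (a, (x, b) # u) = f a \<otimes>\<^bsub>R\<^esub> lincomb k R (\<lambda>\<omega>. P \<omega> (eval_tuple (b, u))) x"
  by (simp_all add: eval_tuple_def f_closed)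

lemma eval_tail_closed: "(a, u) \<in> tuples k A \<Longrightarrow> eval_tail u \<in> carrier R"
proof (induction u arbitrary: a)
  case (Cons p u)
  obtain x b where p: "p = (x, b)" by (cases p)
  show ?case
    using Cons p tuples_head[of b u]
    by (auto simp: tuples_simps intro!: lincomb_closed[OF module_R, where S = UNIV] P_closed f_closed)
qed simp

lemma eval_tuple_closed: "s \<in> tuples k A \<Longrightarrow> eval_tuple s \<in> carrier R"
  unfolding eval_tuple_def
  by (cases s) (auto intro!: f_closed eval_tail_closed dest: tuples_head)

lemma lincomb_P_linear:
  assumes "x \<in> carrier types"
  shows "(\<lambda>r. lincomb k R (\<lambda>\<omega>. P \<omega> r) x) \<in> linear_maps k R R"
  by (rule lincomb_linear_coeffs[OF module_R module_R assms]) (rule P_linear)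

text \<open>Letters enter through the linear map \<open>f\<close>, types as coefficient vectors, and
  everything deeper through the linear operators and the product of \<open>R\<close>.\<close>

lemma multilinear_eval_tuple: "multilinear k A R eval_tuple"
  unfolding multilinear_def
proof (intro conjI allI impI)
  fix c and s s\<^sub>1 s\<^sub>2 :: "('a, 'w, 'k) tuple"
  assume c: "c \<in> carrier k" and s: "slot_combination k A c s s\<^sub>1 s\<^sub>2"
  from s show "eval_tuple s = c \<odot>\<^bsub>R\<^esub> eval_tuple s\<^sub>1 \<oplus>\<^bsub>R\<^esub> eval_tuple s\<^sub>2"
  proof induction
    case (head a u b)
    then have "a \<in> carrier A" "eval_tail u \<in> carrier R"
      by (auto intro: tuples_head eval_tail_closed)
    then show ?case
      using c head(2) by (simp add: eval_tuple_def linear_mapsD[OF f_linear] R.l_distr R.smult_assoc2)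
  next
    case (type a x b u y)
    then have tup: "a \<in> carrier A" "x \<in> carrier types" "(b, u) \<in> tuples k A"
      by (auto simp: tuples_simps)
    have "(\<lambda>\<omega>. P \<omega> (eval_tuple (b, u))) \<in> UNIV \<rightarrow> carrier R"
      using tup by (simp add: P_closed eval_tuple_closed)
    note lin = linear_mapsD[OF lincomb_linear[OF module_R this]]
    show ?case
      using c tup type(2) f_closed[OF tup(1)]
      by (simp add: eval_tuple_simps lin R.r_distr R.smult_assoc2 R.m_comm[of "f a"])
  next
    case (tail a x b u b\<^sub>1 u\<^sub>1 b\<^sub>2 u\<^sub>2)
    have tup: "eval_tuple (b\<^sub>1, u\<^sub>1) \<in> carrier R" "eval_tuple (b\<^sub>2, u\<^sub>2) \<in> carrier R"
      using slot_combination_tuples[OF module_A c tail(3)] by (auto intro: eval_tuple_closed)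
    note lin = linear_mapsD[OF lincomb_P_linear[OF tail(2)]]
    show ?case
      using c tup f_closed[OF tail(1)]
      by (simp add: eval_tuple_simps tail.IH lin R.r_distr R.smult_assoc2 R.m_comm[of "f a"])
  qed
qed (auto intro: eval_tuple_closed)

section \<open>The extension of \<open>f\<close> to typed words\<close>

definition eval_words :: "(('a, 'w, 'k) tuple \<Rightarrow> 'k) set \<Rightarrow> 'r" where
  "eval_words = lift R eval_tuple"

lemma eval_words_linear: "eval_words \<in> linear_maps k Q R"
  unfolding eval_words_def by (rule lift_linear[OF module_R multilinear_eval_tuple])

lemma eval_words_closed: "X \<in> carrier Q \<Longrightarrow> eval_words X \<in> carrier R"
  by (rule linear_mapsD(1)[OF eval_words_linear])

lemma eval_words_letter: "a \<in> carrier A \<Longrightarrow> eval_words (pure (a, [])) = f a"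
  unfolding eval_words_def
  by (simp add: lift_pure[OF module_R multilinear_eval_tuple] tuples_simps eval_tuple_simps)

lemma eval_words_pre:
  assumes a: "a \<in> carrier A" and X: "X \<in> carrier Q"
  shows "eval_words (pre a (\<delta> \<omega>) X) = f a \<otimes>\<^bsub>R\<^esub> P \<omega> (eval_words X)"
proof (rule linear_maps_typed_words_eqI[OF module_R linear_maps_comp[OF pre_linear[OF a unit_type_closed] eval_words_linear] _ _ X])
  have "(\<lambda>r. f a \<otimes>\<^bsub>R\<^esub> r) \<in> linear_maps k R R"
    using f_closed[OF a]
    by (intro linear_mapsI) (simp_all add: R.r_distr R.smult_assoc2 R.m_comm[of "f a"])
  from linear_maps_comp[OF linear_maps_comp[OF eval_words_linear P_linear] this]
  show "(\<lambda>X. f a \<otimes>\<^bsub>R\<^esub> P \<omega> (eval_words X)) \<in> linear_maps k Q R" .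
  fix s :: "('a, 'w, 'k) tuple"
  assume s: "s \<in> tuples k A"
  have "(\<lambda>\<omega>. P \<omega> (eval_tuple s)) \<in> UNIV \<rightarrow> carrier R"
    using s by (simp add: P_closed eval_tuple_closed)
  from lincomb_basis_vec[OF module_R this, of \<omega>]
  show "eval_words (pre a (\<delta> \<omega>) (pure s)) = f a \<otimes>\<^bsub>R\<^esub> P \<omega> (eval_words (pure s))"
    using s a unfolding eval_words_def
    by (cases s) (simp add: pre_pure lift_pure[OF module_R multilinear_eval_tuple] tuples_simps
        eval_tuple_simps(2))
qed

text \<open>Base case of multiplicativity: only heads are multiplied, and there \<open>f\<close> is
  multiplicative.\<close>

lemma eval_words_letter_mult:
  assumes a: "a \<in> carrier A" and X: "X \<in> words n"
  shows "eval_words (pure (a, []) \<otimes>\<^bsub>Q\<^esub> X) = f a \<otimes>\<^bsub>R\<^esub> eval_words X"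
proof (cases n)
  case 0
  with X a show ?thesis
    by (auto simp: mult_letter_letter eval_words_letter f_ring_hom)
next
  case (Suc m)
  with X obtain b \<omega> Y where "b \<in> carrier A" "Y \<in> words m" "X = pre b (\<delta> \<omega>) Y"
    by auto
  then show ?thesis
    using a words_closed[of Y m]
    by (simp add: mult_letter_pre eval_words_pre f_ring_hom f_closed P_closed eval_words_closed R.m_assoc)
qed

lemma eval_words_mult_words:
  assumes "X \<in> words m" "Y \<in> words n"
  shows "eval_words (X \<otimes>\<^bsub>Q\<^esub> Y) = eval_words X \<otimes>\<^bsub>R\<^esub> eval_words Y"
  using assms
proof (induction "m + n" arbitrary: m n X Y rule: less_induct)
  case less
  note cl = words_closed[OF less.prems(1)] words_closed[OF less.prems(2)]
  consider "m = 0" | "n = 0" | m' n' where "m = Suc m'" "n = Suc n'"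
    by (metis not0_implies_Suc)
  then show ?case
  proof cases
    case 1
    then show ?thesis
      using less.prems by (auto simp: eval_words_letter_mult eval_words_letter)
  next
    case 2
    then show ?thesis
      using less.prems cl
      by (auto simp: mult_commute[of X] eval_words_letter_mult eval_words_letter R.m_comm
          eval_words_closed f_closed)
  next
    case 3
    obtain a \<alpha> x where x: "a \<in> carrier A" "x \<in> words m'" "X = pre a (\<delta> \<alpha>) x"
      using less.prems(1) 3 by auto
    obtain b \<beta> y where y: "b \<in> carrier A" "y \<in> words n'" "Y = pre b (\<delta> \<beta>) y"
      using less.prems(2) 3 by auto
    note xy = words_closed[OF x(2)] words_closed[OF y(2)]
    have op: "op \<omega> V \<in> words (Suc i)" if "V \<in> words i" for \<omega> V i
      using that by auto
    have eval_op: "eval_words (op \<omega> V) = P \<omega> (eval_words V)" if "V \<in> carrier Q" for \<omega> V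
      using that by (simp add: eval_words_pre f_ring_hom P_closed eval_words_closed)
    have ih1: "eval_words (op \<omega> x \<otimes>\<^bsub>Q\<^esub> y) = P \<omega> (eval_words x) \<otimes>\<^bsub>R\<^esub> eval_words y" for \<omega>
      using less.hyps[OF _ op[OF x(2)] y(2)] 3 xy by (simp add: eval_op)
    have ih2: "eval_words (x \<otimes>\<^bsub>Q\<^esub> op \<omega> y) = eval_words x \<otimes>\<^bsub>R\<^esub> P \<omega> (eval_words y)" for \<omega>
      using less.hyps[OF _ x(2) op[OF y(2)]] 3 xy by (simp add: eval_op)
    have ih3: "eval_words (x \<otimes>\<^bsub>Q\<^esub> y) = eval_words x \<otimes>\<^bsub>R\<^esub> eval_words y"
      using less.hyps[OF _ x(2) y(2)] 3 by simp
    define r s where rs: "r = eval_words x" "s = eval_words y"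
    have cl: "r \<in> carrier R" "s \<in> carrier R" "f a \<in> carrier R" "f b \<in> carrier R"
      using xy x y by (simp_all add: rs eval_words_closed f_closed)
    have "eval_words (X \<otimes>\<^bsub>Q\<^esub> Y) = f (a \<otimes>\<^bsub>A\<^esub> b) \<otimes>\<^bsub>R\<^esub> P (\<alpha> \<rightharpoonup> \<beta>) (P (\<alpha> \<triangleright> \<beta>) r \<otimes>\<^bsub>R\<^esub> s)
      \<oplus>\<^bsub>R\<^esub> f (a \<otimes>\<^bsub>A\<^esub> b) \<otimes>\<^bsub>R\<^esub> P (\<alpha> \<leftharpoonup> \<beta>) (r \<otimes>\<^bsub>R\<^esub> P (\<alpha> \<triangleleft> \<beta>) s)
      \<oplus>\<^bsub>R\<^esub> lam E \<alpha> \<beta> \<odot>\<^bsub>R\<^esub> (f (a \<otimes>\<^bsub>A\<^esub> b) \<otimes>\<^bsub>R\<^esub> P (\<alpha> \<cdot> \<beta>) (r \<otimes>\<^bsub>R\<^esub> s))"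
      unfolding x(3) y(3) using x(1) y(1) xy
      by (simp add: mult_pre_pre shuffle_step_def linear_mapsD(2,3)[OF eval_words_linear] lam_closed
          eval_words_pre ih1 ih2 ih3 rs)
    \<comment> \<open>The common factor comes out, and what remains is the Rota-Baxter expansion in
      \<open>R\<close> read backwards.\<close>
    also have "\<dots> = f (a \<otimes>\<^bsub>A\<^esub> b) \<otimes>\<^bsub>R\<^esub> (P \<alpha> r \<otimes>\<^bsub>R\<^esub> P \<beta> s)"
      using cl x(1) y(1)
      by (simp add: P_mult_P P_closed lam_closed R.r_distr f_closed R.smult_assoc2
          R.m_comm[of "f (a \<otimes>\<^bsub>A\<^esub> b)"])
    also have "\<dots> = eval_words X \<otimes>\<^bsub>R\<^esub> eval_words Y"
      using cl x y xy by (simp add: f_ring_hom eval_words_pre P_closed rs[symmetric] R.m_ac)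
    finally show ?thesis .
  qed
qed

lemma eval_words_mult:
  assumes X: "X \<in> carrier Q" and Y: "Y \<in> carrier Q"
  shows "eval_words (X \<otimes>\<^bsub>Q\<^esub> Y) = eval_words X \<otimes>\<^bsub>R\<^esub> eval_words Y"
proof -
  have mult_lin: "(\<lambda>r. r \<otimes>\<^bsub>R\<^esub> t) \<in> linear_maps k R R" "(\<lambda>r. t \<otimes>\<^bsub>R\<^esub> r) \<in> linear_maps k R R"
    if "t \<in> carrier R" for t
    using that by (auto intro!: linear_mapsI simp: R.l_distr R.r_distr R.smult_assoc2 R.m_comm[of t])
  note intros = linear_maps_comp[OF mult_linear_left eval_words_linear]
    linear_maps_comp[OF mult_linear_right eval_words_linear]
    linear_maps_comp[OF eval_words_linear mult_lin(1)]
    linear_maps_comp[OF eval_words_linear mult_lin(2)] eval_words_closed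
  show ?thesis
  proof (rule linear_maps_words_eqI[OF module_R _ _ _ X])
    fix m X assume X: "X \<in> words m"
    show "eval_words (X \<otimes>\<^bsub>Q\<^esub> Y) = eval_words X \<otimes>\<^bsub>R\<^esub> eval_words Y"
      by (rule linear_maps_words_eqI[OF module_R _ _ eval_words_mult_words[OF X] Y])
        (intro intros words_closed[OF X])+
  qed (intro intros Y)+
qed

lemma eval_words_hom: "eval_words \<in> rota_baxter_homs k Q (typed_word_op k A) R P"
proof -
  have "eval_words \<in> ring_hom Q R"
    by (rule ring_hom_memI)
      (simp_all add: eval_words_closed eval_words_mult linear_mapsD(2)[OF eval_words_linear]
        typed_words_simps(4) eval_words_letter f_ring_hom)
  then show ?thesis
    by (simp add: rota_baxter_homs_def algebra_homs_def eval_words_linear typed_word_op_eq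
        eval_words_pre f_ring_hom P_closed eval_words_closed)
qed

lemma eval_words_unique:
  assumes h: "h \<in> rota_baxter_homs k Q (typed_word_op k A) R P"
    and letter: "\<And>a. a \<in> carrier A \<Longrightarrow> h (pure (a, [])) = f a"
    and X: "X \<in> carrier Q"
  shows "h X = eval_words X"
proof -
  have h_lin: "h \<in> linear_maps k Q R"
    and h_mult: "\<And>X Y. X \<in> carrier Q \<Longrightarrow> Y \<in> carrier Q \<Longrightarrow> h (X \<otimes>\<^bsub>Q\<^esub> Y) = h X \<otimes>\<^bsub>R\<^esub> h Y"
    and h_op: "\<And>\<omega> X. X \<in> carrier Q \<Longrightarrow> h (op \<omega> X) = P \<omega> (h X)"
    using h by (auto simp: rota_baxter_homs_def algebra_homs_def ring_hom_def typed_word_op_eq)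
  show ?thesis
  proof (rule linear_maps_words_eqI[OF module_R h_lin eval_words_linear _ X])
    show "h X = eval_words X" if "X \<in> words n" for n X
      using that
    proof (induction n arbitrary: X)
      case 0
      then show ?case by (auto simp: letter eval_words_letter)
    next
      case (Suc n)
      then obtain a \<omega> Y where Y: "a \<in> carrier A" "Y \<in> words n" "X = pre a (\<delta> \<omega>) Y"
        by auto
      note cl = words_closed[OF Y(2)]
      have "X = pure (a, []) \<otimes>\<^bsub>Q\<^esub> op \<omega> Y"
        using Y cl by (simp add: mult_letter_pre)
      then have "h X = f a \<otimes>\<^bsub>R\<^esub> P \<omega> (eval_words Y)"
        using Y(1,2) cl by (simp add: h_mult letter_closed h_op letter Suc.IH)
      then show ?case
        using Y cl by (simp add: eval_words_pre)
    qed
  qed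
qed

lemma universal_property:
  "\<exists>g \<in> rota_baxter_homs k Q (typed_word_op k A) R P.
     (\<forall>a\<in>carrier A. g (length_one_word k A a) = f a) \<and>
     (\<forall>h \<in> rota_baxter_homs k Q (typed_word_op k A) R P.
        (\<forall>a\<in>carrier A. h (length_one_word k A a) = f a) \<longrightarrow> (\<forall>X\<in>carrier Q. h X = g X))"
  by (rule bexI[OF _ eval_words_hom])
    (auto simp: length_one_word_eq eval_words_letter intro: eval_words_unique)

end

text \<open>The algebra \<open>A\<close> with all operators zero is a Rota-Baxter algebra, and lifting the identity of
  \<open>A\<close> to it retracts the embedding of letters.\<close>

lemma inj_on_length_one_word:
  "inj_on (length_one_word k A :: 'a \<Rightarrow> (('a, 'w, 'k) tuple \<Rightarrow> 'k) set) (carrier A)"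
proof -
  have "comm_rota_baxter_algebra k E A (\<lambda>_ _. \<zero>\<^bsub>A\<^esub>)"
    using A.algebra_axioms by (auto simp: comm_rota_baxter_algebra_def lam_closed intro!: linear_mapsI)
  moreover have "(\<lambda>a. a) \<in> algebra_homs k A A"
    by (auto simp: algebra_homs_def intro!: ring_hom_memI linear_mapsI)
  ultimately obtain g where
    "\<forall>a\<in>carrier A. g (length_one_word k A a :: (('a, 'w, 'k) tuple \<Rightarrow> 'k) set) = a"
    using universal_property by blast
  then show ?thesis
    by (metis inj_onI)
qed

end

text \<open>The second and third conjuncts make precise that \<open>A\<close> sits inside as the
  words of length one. Uniqueness is equality on the carrier, since a function is unconstrained
  outside it.\<close>

theorem proposition2p18:
  fixes k :: "'k ring" and A :: "('k, 'a) module" and E :: "('w, 'k) ets"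
  assumes "algebra k A" and "commutative_lambda_ets E k"
  shows "comm_rota_baxter_algebra k E (typed_words k A E) (typed_word_op k A) \<and>
    length_one_word k A \<in> algebra_homs k A (typed_words k A E) \<and>
    inj_on (length_one_word k A :: 'a \<Rightarrow> (('a, 'w, 'k) tuple \<Rightarrow> 'k) set) (carrier A) \<and>
    (\<forall>(R :: ('k, 'r) module) P f.
       comm_rota_baxter_algebra k E R P \<and> f \<in> algebra_homs k A R \<longrightarrow>
       (\<exists>g \<in> rota_baxter_homs k (typed_words k A E) (typed_word_op k A) R P.
          (\<forall>a\<in>carrier A. g (length_one_word k A a) = f a) \<and>
          (\<forall>h \<in> rota_baxter_homs k (typed_words k A E) (typed_word_op k A) R P.
             (\<forall>a\<in>carrier A. h (length_one_word k A a) = f a) \<longrightarrow>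
             (\<forall>x\<in>carrier (typed_words k A E). h x = g x))))"
proof -
  interpret typed_word_setting k A E
    using assms by (rule typed_word_setting.intro)
  show ?thesis
    using comm_rota_baxter_typed_words length_one_word_hom inj_on_length_one_word universal_property
    by blast
qed

end
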